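(* Let $N>1$, $s\in(0,1)$, $p\in(1,\infty)$, and let $\Omega\subset\mathbb R^N$ be a bounded domain with $C^{1,1}$ boundary. There exist $\alpha\in(0,s]$ depending only on $N,p,s$, and $C_\Omega>0$ depending only on $N,p,s,\Omega$, such that for every $f\in L^\infty(\Omega)$ and every weak solution $u\in W^{s,p}_0(\Omega)$ of $$(-\Delta)^s_p u=f \ \text{in } \Omega,\qquad u=0 \ \text{in } \Omega^c,$$ one has $u\in C^\alpha(\overline\Omega)$ and $$\|u\|_{C^\alpha(\overline\Omega)}\le C_\Omega\,\|f\|_{L^\infty(\Omega)}^{\frac{1}{p-1}}.$$
   Context: Notation: for $a\in\mathbb R$, $q>0$, $a^{q}:=|a|^{q-1}a$. $\Omega^c=\mathbb R^N\setminus\Omega$. $W^{s,p}_0(\Omega)=\{u\in L^p(\mathbb R^N): \int_{\mathbb R^N\times\mathbb R^N}\frac{|u(x)-u(y)|^p}{|x-y|^{N+ps}}dx\,dy<\infty,\ u=0\text{ a.e. in }\Omega^c\}$. A weak solution $u\in W^{s,p}_0(\Omega)$ of the Dirichlet problem means: for every $\varphi\in W^{s,p}_0(\Omega)$, $$\int_{\mathbb R^N\times\mathbb R^N}\frac{(u(x)-u(y))^{p-1}(\varphi(x)-\varphi(y))}{|x-y|^{N+ps}}\,dx\,dy=\int_\Omega f\varphi\,dx.$$ $C^\alpha(\overline\Omega)$ is the space of continuous functions on $\overline\Omega$ with finite $[u]_{C^\alpha(\overline\Omega)}=\sup_{x\ne y\in\overline\Omega}|u(x)-u(y)|/|x-y|^\alpha$,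 normed by $\|u\|_{L^\infty(\Omega)}+[u]_{C^\alpha(\overline\Omega)}$ (the conclusion means $u$ has such a representative). *)

theory Defs
  imports "HOL-Analysis.Analysis"
begin

definition spow :: "real \<Rightarrow> real \<Rightarrow> real" where
  "spow a q = \<bar>a\<bar> powr (q - 1) * a"

text \<open>Bounded domain with C^{1,1} boundary: near every boundary point, after a
  rigid motion, the domain is the strict epigraph (in some coordinate direction k)
  of a C^{1,1} function (differentiable with Lipschitz derivative) of the other
  coordinates.\<close>
definition C11_domain :: "(real^'n) set \<Rightarrow> bool" where
  "C11_domain \<Omega> \<longleftrightarrow> open \<Omega> \<and> connected \<Omega> \<and> bounded \<Omega> \<and> \<Omega> \<noteq> {} \<and>
     (\<forall>x0 \<in> frontier \<Omega>. \<exists>r>0. \<exists>(R::real^'n \<Rightarrow> real^'n) (k::'n) (\<gamma>::real^'n \<Rightarrow> real)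
          (D::real^'n \<Rightarrow> real^'n \<Rightarrow> real) (L::real).
        orthogonal_transformation R \<and>
        (\<forall>z. \<gamma> z = \<gamma> (z + (- (z $ k)) *\<^sub>R axis k (1::real))) \<and>
        (\<forall>z. (\<gamma> has_derivative D z) (at z)) \<and>
        (\<forall>z w h. \<bar>D z h - D w h\<bar> \<le> L * norm (z - w) * norm h) \<and>
        \<Omega> \<inter> ball x0 r = {x \<in> ball x0 r. R (x - x0) $ k > \<gamma> (R (x - x0))})"

definition gagliardo :: "real \<Rightarrow> real \<Rightarrow> (real^'n \<Rightarrow> real) \<Rightarrow> ennreal" where
  "gagliardo s p u = (\<integral>\<^sup>+ xy. ennreal (\<bar>u (fst xy) - u (snd xy)\<bar> powr p /
        norm (fst xy - snd xy) powr (real CARD('n) + p * s)) \<partial>(lebesgue \<Otimes>\<^sub>M lebesgue))"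

definition W0 :: "real \<Rightarrow> real \<Rightarrow> (real^'n) set \<Rightarrow> (real^'n \<Rightarrow> real) set" where
  "W0 s p \<Omega> = {u. u \<in> borel_measurable lebesgue \<and>
      (\<integral>\<^sup>+ x. ennreal (\<bar>u x\<bar> powr p) \<partial>lebesgue) < \<infinity> \<and>
      gagliardo s p u < \<infinity> \<and>
      (AE x in lebesgue. x \<notin> \<Omega> \<longrightarrow> u x = 0)}"

definition Linf :: "(real^'n) set \<Rightarrow> (real^'n \<Rightarrow> real) set" where
  "Linf \<Omega> = {f. set_borel_measurable lebesgue \<Omega> f \<and>
      (\<exists>C. AE x in lebesgue. x \<in> \<Omega> \<longrightarrow> \<bar>f x\<bar> \<le> C)}"

definition Linf_norm :: "(real^'n) set \<Rightarrow> (real^'n \<Rightarrow> real) \<Rightarrow> real" where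
  "Linf_norm \<Omega> f = Inf {C. 0 \<le> C \<and> (AE x in lebesgue. x \<in> \<Omega> \<longrightarrow> \<bar>f x\<bar> \<le> C)}"

definition weak_solution ::
  "real \<Rightarrow> real \<Rightarrow> (real^'n) set \<Rightarrow> (real^'n \<Rightarrow> real) \<Rightarrow> (real^'n \<Rightarrow> real) \<Rightarrow> bool" where
  "weak_solution s p \<Omega> f u \<longleftrightarrow> u \<in> W0 s p \<Omega> \<and>
     (\<forall>\<phi> \<in> W0 s p \<Omega>.
        (\<integral> xy. spow (u (fst xy) - u (snd xy)) (p - 1) * (\<phi> (fst xy) - \<phi> (snd xy)) /
            norm (fst xy - snd xy) powr (real CARD('n) + p * s) \<partial>(lebesgue \<Otimes>\<^sub>M lebesgue))
        = (\<integral>x\<in>\<Omega>. f x * \<phi> x \<partial>lebesgue))"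

definition holder_quotients :: "(real^'n) set \<Rightarrow> real \<Rightarrow> (real^'n \<Rightarrow> real) \<Rightarrow> real set" where
  "holder_quotients K \<alpha> v = {\<bar>v x - v y\<bar> / dist x y powr \<alpha> | x y. x \<in> K \<and> y \<in> K \<and> x \<noteq> y}"

definition holder_seminorm :: "(real^'n) set \<Rightarrow> real \<Rightarrow> (real^'n \<Rightarrow> real) \<Rightarrow> real" where
  "holder_seminorm K \<alpha> v = Sup (holder_quotients K \<alpha> v)"

definition holder_space :: "(real^'n) set \<Rightarrow> real \<Rightarrow> (real^'n \<Rightarrow> real) set" where
  "holder_space K \<alpha> = {v. continuous_on K v \<and> bdd_above (holder_quotients K \<alpha> v)}"

end

theory Submission
  imports Defs
begin

text \<open>Boundedness follows by testing with \<open>(u - \<kappa>)\<^sup>+\<close>, because the interaction with the exterior, where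
  \<open>u = 0\<close>, controls the integral of the test function. For the Hoelder estimate let \<open>V = u - m\<close> or
  \<open>V = M - u\<close> be nonnegative on a ball \<open>B\<close>, and at least \<open>\<mu>\<close> on a part of \<open>B\<close> of positive density. A small multiple
  of a smooth bump of height \<open>\<mu>\<close> is a subsolution once the nonlocal contribution of that part is added, so by the
  comparison principle \<open>V\<close> is bounded below by a multiple of \<open>\<mu>\<close> on a smaller concentric ball, and the oscillation of
  \<open>u\<close> decays geometrically. Near the boundary the required density is provided by an exterior ball at each
  frontier point, whose relative size does not depend on the domain at small scales, so that the exponent depends
  only on the dimension, \<open>p\<close> and \<open>s\<close>.\<close>

section \<open>The singular kernel\<close>

definition kern :: "real \<Rightarrow> 'a::euclidean_space \<Rightarrow> real" where
  "kern a h = norm h powr (- (real DIM('a) + a))"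

lemma kern_nonneg [simp]: "0 \<le> kern a h"
  by (simp add: kern_def)

lemma kern_minus [simp]: "kern a (- h) = kern a h"
  by (simp add: kern_def)

lemma kern_commute: "kern a (x - y) = kern a (y - x)"
  by (simp add: kern_def norm_minus_commute)

lemma kern_measurable [measurable]: "kern a \<in> borel_measurable borel"
  unfolding kern_def[abs_def] by measurable

lemma kern_scaleR: "0 < r \<Longrightarrow> kern a (r *\<^sub>R h :: 'a::euclidean_space)
  = r powr (- (real DIM('a) + a)) * kern a h"
  by (simp add: kern_def powr_mult)

lemma norm_powr_mult_kern: "norm h powr b * kern a h = kern (a - b) h"
  by (simp add: kern_def powr_add[symmetric] algebra_simps)

lemma kern_ge:
  fixes h :: "'a::euclidean_space"
  assumes "h \<noteq> 0" "norm h \<le> d" "0 \<le> a"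
  shows "d powr (- (real DIM('a) + a)) \<le> kern a h"
  unfolding kern_def using assms by (intro powr_mono2') auto

subsection \<open>Invariance of Lebesgue integrals\<close>

lemma nn_integral_lborel_affine:
  fixes g :: "'a::euclidean_space \<Rightarrow> ennreal"
  assumes [measurable]: "g \<in> borel_measurable borel" and r: "r > 0"
  shows "(\<integral>\<^sup>+ y. g ((y - x) /\<^sub>R r) \<partial>lborel) = ennreal (r ^ DIM('a)) * (\<integral>\<^sup>+ h. g h \<partial>lborel)"
proof -
  have "(\<integral>\<^sup>+ y. g ((y - x) /\<^sub>R r) \<partial>lborel)
     = (\<integral>\<^sup>+ y. g ((y - x) /\<^sub>R r) \<partial>density (distr lborel borel (\<lambda>h. x + r *\<^sub>R h)) (\<lambda>_. \<bar>r\<bar> ^ DIM('a)))"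
    by (subst lborel_affine[of r x]) (use r in auto)
  also have "\<dots> = ennreal (r ^ DIM('a)) * (\<integral>\<^sup>+ h. g ((x + r *\<^sub>R h - x) /\<^sub>R r) \<partial>lborel)"
    using r by (simp add: nn_integral_density nn_integral_distr nn_integral_cmult)
  finally show ?thesis using r by simp
qed

lemma nn_integral_lborel_kern_scale:
  fixes g :: "'a::euclidean_space \<Rightarrow> ennreal"
  assumes [measurable]: "g \<in> borel_measurable borel" and r: "r > 0"
  shows "(\<integral>\<^sup>+ y. ennreal (r powr (- (real DIM('a) + a))) * g ((y - x) /\<^sub>R r) \<partial>lborel)
    = ennreal (r powr (- a)) * (\<integral>\<^sup>+ h. g h \<partial>lborel)"
proof -
  have "r powr (- (real DIM('a) + a)) * r ^ DIM('a) = r powr (- a)"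
    using r by (simp add: powr_realpow[symmetric] powr_add[symmetric])
  then have "ennreal (r powr (- (real DIM('a) + a))) * ennreal (r ^ DIM('a)) = ennreal (r powr (- a))"
    by (simp add: ennreal_mult'[symmetric])
  then show ?thesis
    using r by (simp add: nn_integral_cmult nn_integral_lborel_affine mult.assoc[symmetric])
qed

lemma nn_integral_lborel_shift:
  fixes g :: "'a::euclidean_space \<Rightarrow> ennreal"
  assumes [measurable]: "g \<in> borel_measurable borel"
  shows "(\<integral>\<^sup>+ y. g (y + x) \<partial>lborel) = (\<integral>\<^sup>+ h. g h \<partial>lborel)"
  using nn_integral_lborel_affine[OF assms, of 1 "- x"] by simp

lemma lborel_distr_reflect: "distr lborel borel (\<lambda>h::'a::euclidean_space. x - h) = lborel"
proof -
  have "lborel = density (distr lborel borel (\<lambda>h::'a. x + (-1) *\<^sub>R h)) (\<lambda>_. ennreal (\<bar>-1\<bar> ^ DIM('a)))"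
    by (rule lborel_affine) simp
  then show ?thesis by (simp add: density_1)
qed

lemma nn_integral_lborel_reflect:
  fixes g :: "'a::euclidean_space \<Rightarrow> ennreal"
  assumes [measurable]: "g \<in> borel_measurable borel"
  shows "(\<integral>\<^sup>+ y. g (x - y) \<partial>lborel) = (\<integral>\<^sup>+ h. g h \<partial>lborel)"
  by (subst (2) lborel_distr_reflect[of x, symmetric], subst nn_integral_distr) auto

lemma orthogonal_transformation_measurable:
  fixes T :: "'a::euclidean_space \<Rightarrow> 'a"
  assumes "orthogonal_transformation T"
  shows "T \<in> borel_measurable borel"
  using orthogonal_transformation_linear[OF assms]
  by (intro borel_measurable_continuous_onI linear_continuous_on) (simp add: linear_conv_bounded_linear)

text \<open>The integrals are compared with the volume of the unit ball by Tonelli's theorem and translation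
  invariance, as in the uniqueness proof for Haar measure; an isometry fixes the ball.\<close>
lemma nn_integral_lborel_orthogonal:
  fixes T :: "'a::euclidean_space \<Rightarrow> 'a" and g :: "'a \<Rightarrow> ennreal"
  assumes T: "orthogonal_transformation T" and [measurable]: "g \<in> borel_measurable borel"
  shows "(\<integral>\<^sup>+ h. g (T h) \<partial>lborel) = (\<integral>\<^sup>+ h. g h \<partial>lborel)"
proof -
  define B :: "'a \<Rightarrow> ennreal" where "B = indicator (ball 0 1)"
  note [measurable] = orthogonal_transformation_measurable[OF T]
  have [measurable]: "B \<in> borel_measurable borel" unfolding B_def by (intro borel_measurable_indicator) simp
  have BT: "B (T h) = B h" for h
    using T by (simp add: B_def indicator_def orthogonal_transformation_norm)
  have "(\<integral>\<^sup>+ h. g (T h) \<partial>lborel) * (\<integral>\<^sup>+ z. B z \<partial>lborel)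
    = (\<integral>\<^sup>+ h. (\<integral>\<^sup>+ z. g (T h) * B (z + T h) \<partial>lborel) \<partial>lborel)"
    by (subst nn_integral_multc[symmetric]) (auto simp: nn_integral_cmult nn_integral_lborel_shift)
  also have "\<dots> = (\<integral>\<^sup>+ z. (\<integral>\<^sup>+ h. g (T h) * B (z + T h) \<partial>lborel) \<partial>lborel)"
    by (rule lborel_pair.Fubini') measurable
  also have "\<dots> = (\<integral>\<^sup>+ z. (\<integral>\<^sup>+ h. g (T h - z) * B (T h) \<partial>lborel) \<partial>lborel)"
  proof (rule nn_integral_cong)
    fix z :: 'a
    obtain w where "T w = z" using orthogonal_transformation_surj[OF T] by (metis surjD)
    then have "T (h + w) = T h + z" for h
      using orthogonal_transformation_linear[OF T] by (simp add: linear_add)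
    then show "(\<integral>\<^sup>+ h. g (T h) * B (z + T h) \<partial>lborel) = (\<integral>\<^sup>+ h. g (T h - z) * B (T h) \<partial>lborel)"
      using nn_integral_lborel_shift[of "\<lambda>h. g (T h - z) * B (T h)" w] by (simp add: add.commute)
  qed
  also have "\<dots> = (\<integral>\<^sup>+ h. (\<integral>\<^sup>+ z. g (T h - z) * B (T h) \<partial>lborel) \<partial>lborel)"
    by (rule lborel_pair.Fubini') measurable
  also have "\<dots> = (\<integral>\<^sup>+ h. g h \<partial>lborel) * (\<integral>\<^sup>+ z. B z \<partial>lborel)"
    by (simp add: nn_integral_multc nn_integral_cmult nn_integral_lborel_reflect BT)
  finally have eq: "(\<integral>\<^sup>+ h. g (T h) \<partial>lborel) * (\<integral>\<^sup>+ z. B z \<partial>lborel)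
    = (\<integral>\<^sup>+ h. g h \<partial>lborel) * (\<integral>\<^sup>+ z. B z \<partial>lborel)" .
  have "(\<integral>\<^sup>+ z. B z \<partial>lborel) = ennreal (unit_ball_vol (real DIM('a)))"
    by (simp add: B_def emeasure_ball)
  moreover have "unit_ball_vol (real DIM('a)) \<noteq> 0"
    using unit_ball_vol_pos[of "real DIM('a)"] by (simp del: unit_ball_vol_pos)
  ultimately show ?thesis
    using eq by (simp add: mult.commute[of _ "ennreal _"] ennreal_mult_cancel_left)
qed

subsection \<open>Integrability of the kernel near the origin and at infinity\<close>

lemma nn_integral_even_real:
  fixes g :: "real \<Rightarrow> real"
  assumes [measurable]: "g \<in> borel_measurable borel"
  shows "(\<integral>\<^sup>+ t. ennreal (g \<bar>t\<bar>) \<partial>lborel) \<le> 2 * (\<integral>\<^sup>+ t. ennreal (indicator {0..} t * g t) \<partial>lborel)"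
proof -
  let ?h = "\<lambda>t::real. ennreal (indicator {0..} t * g t)"
  have "(\<integral>\<^sup>+ t. ennreal (g \<bar>t\<bar>) \<partial>lborel) \<le> (\<integral>\<^sup>+ t. ?h t + ?h (0 - t) \<partial>lborel)"
    by (intro nn_integral_mono) (auto simp: indicator_def)
  also have "\<dots> = (\<integral>\<^sup>+ t. ?h t \<partial>lborel) + (\<integral>\<^sup>+ t. ?h (0 - t) \<partial>lborel)"
    by (intro nn_integral_add) measurable
  also have "\<dots> = 2 * (\<integral>\<^sup>+ t. ?h t \<partial>lborel)"
    by (subst nn_integral_lborel_reflect) (measurable, simp add: mult_2)
  finally show ?thesis .
qed

lemma nn_integral_powr_near_0:
  fixes d :: real
  assumes d: "d > 0"
  shows "(\<integral>\<^sup>+ t. ennreal (indicator {-1..1} t * \<bar>t\<bar> powr (d - 1)) \<partial>lborel) < \<infinity>"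
proof -
  let ?g = "\<lambda>t::real. indicator {..1} t * t powr (d - 1)"
  have hi: "((\<lambda>t. if t \<in> {0..1} then t powr (d - 1) else 0) has_integral (1 / d)) UNIV"
    using has_integral_powr_from_0[of "d - 1" 1] d by (simp only: has_integral_restrict_UNIV) simp
  have "(\<integral>\<^sup>+ t. ennreal (indicator {-1..1} t * \<bar>t\<bar> powr (d - 1)) \<partial>lborel)
    = (\<integral>\<^sup>+ t. ennreal (?g \<bar>t\<bar>) \<partial>lborel)"
    by (intro nn_integral_cong) (auto simp: indicator_def)
  also have "\<dots> \<le> 2 * (\<integral>\<^sup>+ t. ennreal (indicator {0..} t * ?g t) \<partial>lborel)"
    by (rule nn_integral_even_real) measurable
  also have "(\<integral>\<^sup>+ t. ennreal (indicator {0..} t * ?g t) \<partial>lborel)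
     = (\<integral>\<^sup>+ t. ennreal (if t \<in> {0..1} then t powr (d - 1) else 0) \<partial>lborel)"
    by (intro nn_integral_cong) (auto simp: indicator_def)
  also have "\<dots> = ennreal (1 / d)"
    by (rule nn_integral_has_integral_lborel[OF _ _ hi]) auto
  finally show ?thesis by (rule le_less_trans) (simp add: ennreal_mult_less_top)
qed

lemma nn_integral_powr_at_infinity:
  fixes b :: real
  assumes b: "b > 0"
  shows "(\<integral>\<^sup>+ t. ennreal ((1 + \<bar>t\<bar>) powr (- 1 - b)) \<partial>lborel) < \<infinity>"
proof -
  let ?g = "\<lambda>t::real. (1 + t) powr (- 1 - b)"
  let ?h = "\<lambda>t::real. if t \<in> {1..} then t powr (- 1 - b) else 0"
  have hi: "(?h has_integral (1 / b)) UNIV"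
    using has_integral_powr_to_inf[of "- 1 - b" 1] b by (simp only: has_integral_restrict_UNIV) simp
  have "(\<integral>\<^sup>+ t. ennreal (?g \<bar>t\<bar>) \<partial>lborel) \<le> 2 * (\<integral>\<^sup>+ t. ennreal (indicator {0..} t * ?g t) \<partial>lborel)"
    by (rule nn_integral_even_real) measurable
  also have "(\<integral>\<^sup>+ t. ennreal (indicator {0..} t * ?g t) \<partial>lborel) = (\<integral>\<^sup>+ t. ennreal (?h (t + 1)) \<partial>lborel)"
    by (intro nn_integral_cong) (auto simp: indicator_def add.commute)
  also have "\<dots> = (\<integral>\<^sup>+ t. ennreal (?h t) \<partial>lborel)"
    by (rule nn_integral_lborel_shift) measurable
  also have "\<dots> = ennreal (1 / b)"
    by (rule nn_integral_has_integral_lborel[OF _ _ hi]) auto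
  finally show ?thesis by (rule le_less_trans) (simp add: ennreal_mult_less_top)
qed

lemma nn_integral_finite_if_le_prod_Basis:
  fixes g :: "'a::euclidean_space \<Rightarrow> real" and f :: "real \<Rightarrow> real"
  assumes [measurable]: "f \<in> borel_measurable borel" and f: "\<And>t. 0 \<le> f t" and A: "0 \<le> A"
    and le: "AE h in lborel. g h \<le> A * (\<Prod>i\<in>Basis. f (h \<bullet> i))"
    and fin: "(\<integral>\<^sup>+ t. ennreal (f t) \<partial>lborel) < \<infinity>"
  shows "(\<integral>\<^sup>+ h. ennreal (g h) \<partial>lborel) < \<infinity>"
proof -
  have "AE h in lborel. ennreal (g h) \<le> ennreal A * (\<Prod>i\<in>Basis. ennreal (f (h \<bullet> i)))"
    using le by eventually_elim (use f A in \<open>simp add: prod_ennreal ennreal_mult'[symmetric] ennreal_leI\<close>)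
  then have "(\<integral>\<^sup>+ h. ennreal (g h) \<partial>lborel)
    \<le> (\<integral>\<^sup>+ (h :: 'a). ennreal A * (\<Prod>i\<in>Basis. ennreal (f (h \<bullet> i))) \<partial>lborel)"
    by (rule nn_integral_mono_AE)
  also have "\<dots> = ennreal A * (\<Prod>i\<in>(Basis :: 'a set). (\<integral>\<^sup>+ t. ennreal (f t) \<partial>lborel))"
    by (subst nn_integral_cmult, measurable, subst nn_integral_lborel_prod) auto
  also have "\<dots> < \<infinity>"
    using fin by (simp add: ennreal_mult_less_top power_less_top_ennreal)
  finally show ?thesis .
qed

lemma kern_le_prod_outside_ball:
  fixes h :: "'a::euclidean_space"
  assumes b: "0 < b" and r: "0 < r" "r \<le> norm h"
  shows "kern b h
    \<le> (1 + 1 / r) powr (real DIM('a) + b) * (\<Prod>i\<in>Basis. (1 + \<bar>h \<bullet> i\<bar>) powr (- 1 - b / real DIM('a)))"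
proof -
  let ?N = "real DIM('a)" and ?c = "- 1 - b / real DIM('a)"
  define n where "n = norm h * (1 + 1 / r)"
  have pos: "0 < norm h" "0 < 1 + 1 / r" using r by (auto simp: add_pos_pos)
  then have n: "0 < n" by (simp add: n_def)
  have "n powr ?c \<le> (1 + \<bar>h \<bullet> i\<bar>) powr ?c" if "i \<in> Basis" for i
  proof (rule powr_mono2')
    have "1 \<le> norm h / r" using r by simp
    moreover have "\<bar>h \<bullet> i\<bar> \<le> norm h" using that by (rule Basis_le_norm)
    ultimately show "1 + \<bar>h \<bullet> i\<bar> \<le> n" by (simp add: n_def algebra_simps)
    have "0 \<le> b / real DIM('a)" using b by simp
    then show "?c \<le> 0" by linarith
  qed simp
  then have "(\<Prod>i\<in>(Basis::'a set). n powr ?c) \<le> (\<Prod>i\<in>Basis. (1 + \<bar>h \<bullet> i\<bar>) powr ?c)"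
    by (intro prod_mono) auto
  moreover have "(\<Prod>i\<in>(Basis::'a set). n powr ?c) = n powr (- (?N + b))"
  proof -
    have "?c * ?N = - (?N + b)" by (simp add: field_simps)
    moreover have "(\<Prod>i\<in>(Basis::'a set). n powr ?c) = (n powr ?c) powr ?N"
      using n by (subst powr_realpow) auto
    ultimately show ?thesis by (simp only: powr_powr)
  qed
  moreover have "kern b h = (1 + 1 / r) powr (?N + b) * n powr (- (?N + b))"
    using pos unfolding kern_def n_def by (simp only: powr_mult powr_minus) (simp add: field_simps)
  ultimately show ?thesis by (simp add: mult_left_mono)
qed

lemma nn_integral_kern_outside_ball:
  fixes b r :: real
  assumes b: "b > 0" and r: "r > 0"
  shows "(\<integral>\<^sup>+ h. ennreal (indicator {h. r \<le> norm h} h * kern b (h :: 'a::euclidean_space)) \<partial>lborel) < \<infinity>"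
proof (rule nn_integral_finite_if_le_prod_Basis)
  show "(\<integral>\<^sup>+ t. ennreal ((1 + \<bar>t\<bar>) powr (- 1 - b / real DIM('a))) \<partial>lborel) < \<infinity>"
    using b by (intro nn_integral_powr_at_infinity) simp
  show "AE h in lborel. indicator {h. r \<le> norm h} h * kern b (h :: 'a)
      \<le> (1 + 1 / r) powr (real DIM('a) + b) * (\<Prod>i\<in>Basis. (1 + \<bar>h \<bullet> i\<bar>) powr (- 1 - b / real DIM('a)))"
    using kern_le_prod_outside_ball[OF b r] by (auto simp: indicator_def prod_nonneg)
qed auto

lemma AE_lborel_inner_nonzero:
  fixes e :: "'a::euclidean_space"
  assumes "e \<noteq> 0"
  shows "AE h in lborel. e \<bullet> h \<noteq> 0"
proof -
  have "negligible {h. e \<bullet> h = 0}" using assms by (intro negligible_hyperplane) auto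
  then have "{h. e \<bullet> h = 0} \<in> null_sets lborel"
    by (subst (asm) negligible_iff_null_sets) (auto simp: null_sets_def)
  then show ?thesis by (rule AE_I') auto
qed

lemma directional_kern_le_prod:
  fixes h e :: "'a::euclidean_space"
  assumes e: "e \<in> Basis" and h: "norm h < 1" "\<forall>i\<in>Basis. i \<bullet> h \<noteq> 0"
    and \<theta>: "0 \<le> \<theta>" and \<delta>: "\<delta> \<le> 1 - \<theta>" "real DIM('a) * \<delta> \<le> - a - \<theta>"
  shows "\<bar>e \<bullet> h\<bar> powr (- \<theta>) * kern a h \<le> (\<Prod>i\<in>Basis. indicator {-1..1} (h \<bullet> i) * \<bar>h \<bullet> i\<bar> powr (\<delta> - 1))"
proof -
  let ?N = "real DIM('a)"
  have hi: "0 < \<bar>h \<bullet> i\<bar>" "\<bar>h \<bullet> i\<bar> \<le> norm h" if "i \<in> Basis" for i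
    using that h by (auto simp: Basis_le_norm inner_commute)
  have nh: "0 < norm h" using hi[OF e] by linarith
  have N1: "real (DIM('a) - 1) = ?N - 1" using DIM_positive[where 'a='a] by (simp add: of_nat_diff)
  have "kern a h \<le> norm h powr (- (1 - \<theta> - \<delta>) + (\<delta> - 1) * (?N - 1))"
    unfolding kern_def using h nh \<delta> by (intro powr_mono') (auto simp: algebra_simps)
  also have "\<dots> = norm h powr (- (1 - \<theta> - \<delta>)) * (norm h powr (\<delta> - 1)) powr real (DIM('a) - 1)"
    by (simp only: powr_add powr_powr N1)
  also have "(norm h powr (\<delta> - 1)) powr real (DIM('a) - 1) = (\<Prod>i\<in>Basis - {e}. norm h powr (\<delta> - 1))"
    using e nh by (subst powr_realpow) auto
  also have "norm h powr (- (1 - \<theta> - \<delta>)) * \<dots>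
    \<le> \<bar>h \<bullet> e\<bar> powr (- (1 - \<theta> - \<delta>)) * (\<Prod>i\<in>Basis - {e}. \<bar>h \<bullet> i\<bar> powr (\<delta> - 1))"
    using e hi \<delta> \<theta> by (intro mult_mono prod_mono conjI powr_mono2' prod_nonneg) auto
  finally have "\<bar>e \<bullet> h\<bar> powr (- \<theta>) * kern a h
      \<le> \<bar>h \<bullet> e\<bar> powr (- \<theta>) * (\<bar>h \<bullet> e\<bar> powr (- (1 - \<theta> - \<delta>)) * (\<Prod>i\<in>Basis - {e}. \<bar>h \<bullet> i\<bar> powr (\<delta> - 1)))"
    by (subst inner_commute) (intro mult_left_mono, auto)
  also have "\<dots> = \<bar>h \<bullet> e\<bar> powr (\<delta> - 1) * (\<Prod>i\<in>Basis - {e}. \<bar>h \<bullet> i\<bar> powr (\<delta> - 1))"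
    by (simp add: mult.assoc[symmetric] powr_add[symmetric])
  also have "\<dots> = (\<Prod>i\<in>Basis. \<bar>h \<bullet> i\<bar> powr (\<delta> - 1))"
    using e by (subst prod.remove[of Basis e]) auto
  also have "\<dots> = (\<Prod>i\<in>Basis. indicator {-1..1} (h \<bullet> i) * \<bar>h \<bullet> i\<bar> powr (\<delta> - 1))"
  proof (rule prod.cong)
    fix i :: 'a assume "i \<in> Basis"
    then have "\<bar>h \<bullet> i\<bar> \<le> 1" using hi h by force
    then show "\<bar>h \<bullet> i\<bar> powr (\<delta> - 1) = indicator {-1..1} (h \<bullet> i) * \<bar>h \<bullet> i\<bar> powr (\<delta> - 1)"
      by (simp add: indicator_def abs_le_iff)
  qed simp
  finally show ?thesis .
qed

lemma nn_integral_directional_kern_Basis: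
  fixes e :: "'a::euclidean_space"
  assumes e: "e \<in> Basis" and \<theta>: "0 \<le> \<theta>" "\<theta> < 1" and a: "a + \<theta> < 0"
  shows "(\<integral>\<^sup>+ h. ennreal (indicator (ball 0 1) h * (\<bar>e \<bullet> h\<bar> powr (- \<theta>) * kern a h)) \<partial>lborel) < \<infinity>"
proof -
  define \<delta> where "\<delta> = min (1 - \<theta>) ((- a - \<theta>) / real DIM('a))"
  have "\<delta> \<le> (- a - \<theta>) / real DIM('a)" by (simp add: \<delta>_def)
  moreover have "0 < \<delta>" "\<delta> \<le> 1 - \<theta>" using \<theta> a by (simp_all add: \<delta>_def)
  ultimately have \<delta>: "0 < \<delta>" "\<delta> \<le> 1 - \<theta>" "real DIM('a) * \<delta> \<le> - a - \<theta>"
    by (simp_all add: le_divide_eq mult.commute)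
  show ?thesis
  proof (rule nn_integral_finite_if_le_prod_Basis)
    have "AE h in lborel. \<forall>i\<in>Basis. i \<bullet> (h :: 'a) \<noteq> 0"
      by (intro AE_finite_allI AE_lborel_inner_nonzero) auto
    then show "AE h in lborel. indicator (ball 0 1) h * (\<bar>e \<bullet> h\<bar> powr (- \<theta>) * kern a h)
        \<le> 1 * (\<Prod>i\<in>Basis. indicator {-1..1} (h \<bullet> i) * \<bar>h \<bullet> i\<bar> powr (\<delta> - 1))"
    proof eventually_elim
      fix h :: 'a assume "\<forall>i\<in>Basis. i \<bullet> h \<noteq> 0"
      then show "indicator (ball 0 1) h * (\<bar>e \<bullet> h\<bar> powr (- \<theta>) * kern a h)
          \<le> 1 * (\<Prod>i\<in>Basis. indicator {-1..1} (h \<bullet> i) * \<bar>h \<bullet> i\<bar> powr (\<delta> - 1))"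
        using directional_kern_le_prod[OF e _ _ \<theta>(1) \<delta>(2,3), of h] by (simp add: indicator_def prod_nonneg)
    qed
    show "(\<integral>\<^sup>+ t. ennreal (indicator {-1..1} t * \<bar>t\<bar> powr (\<delta> - 1)) \<partial>lborel) < \<infinity>"
      using \<delta> by (intro nn_integral_powr_near_0)
  qed auto
qed

lemma nn_integral_kern_inside_ball:
  assumes "a < 0"
  shows "(\<integral>\<^sup>+ h. ennreal (indicator (ball 0 1) h * kern a (h :: 'a::euclidean_space)) \<partial>lborel) < \<infinity>"
proof -
  obtain e :: 'a where e: "e \<in> Basis" using nonempty_Basis by blast
  have "AE h in lborel. e \<bullet> h \<noteq> 0"
    using e by (intro AE_lborel_inner_nonzero) auto
  then have "(\<integral>\<^sup>+ h. ennreal (indicator (ball 0 1) h * kern a (h :: 'a)) \<partial>lborel)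
    = (\<integral>\<^sup>+ h. ennreal (indicator (ball 0 1) h * (\<bar>e \<bullet> h\<bar> powr (- 0) * kern a h)) \<partial>lborel)"
    by (intro nn_integral_cong_AE) (auto elim: eventually_mono)
  also have "\<dots> < \<infinity>"
    using e assms by (intro nn_integral_directional_kern_Basis) auto
  finally show ?thesis .
qed

lemma nn_integral_directional_kern_bounded:
  assumes \<theta>: "0 \<le> \<theta>" "\<theta> < 1" and a: "a + \<theta> < 0"
  obtains C where "0 \<le> C"
    "\<And>e :: real^'n. norm e = 1 \<Longrightarrow>
       (\<integral>\<^sup>+ h. ennreal (indicator (ball 0 1) h * (\<bar>e \<bullet> h\<bar> powr (- \<theta>) * kern a h)) \<partial>lborel) \<le> ennreal C"
proof -
  define G where "G e h = ennreal (indicator (ball 0 1) h *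
    (\<bar>e \<bullet> h\<bar> powr (- \<theta>) * kern a h))" for e h :: "real^'n"
  have [measurable]: "ball (0::real^'n) 1 \<in> sets borel" by simp
  have [measurable]: "G e \<in> borel_measurable borel" for e
    unfolding G_def[abs_def] by measurable
  let ?k = "axis undefined 1 :: real^'n"
  have "(\<integral>\<^sup>+ h. G ?k h \<partial>lborel) < \<infinity>"
    unfolding G_def using assms by (intro nn_integral_directional_kern_Basis) (auto simp: Basis_vec_def)
  then obtain C where C: "0 \<le> C" "(\<integral>\<^sup>+ h. G ?k h \<partial>lborel) = ennreal C"
    by (metis enn2real_nonneg ennreal_enn2real infinity_ennreal_def)
  have "(\<integral>\<^sup>+ h. G e h \<partial>lborel) = ennreal C" if "norm e = 1" for e
  proof -
    have "norm e = norm ?k" using that by (simp add: norm_axis_1)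
    then obtain T where T: "orthogonal_transformation T" "T e = ?k"
      by (rule orthogonal_transformation_exists)
    have "G e h = G ?k (T h)" for h
    proof -
      have "T e \<bullet> T h = e \<bullet> h" using T(1) unfolding orthogonal_transformation_def by blast
      then show ?thesis
        using orthogonal_transformation_norm[OF T(1), of h] by (simp add: G_def kern_def indicator_def T(2))
    qed
    then show ?thesis using nn_integral_lborel_orthogonal[OF T(1), of "G ?k"] C by simp
  qed
  then show ?thesis using that[of C] C by (auto simp: G_def)
qed

section \<open>Signed powers\<close>

lemma spow_0 [simp]: "spow 0 q = 0"
  by (simp add: spow_def)

lemma spow_nonneg_eq: "0 \<le> a \<Longrightarrow> spow a q = a powr q"
  by (cases "a = 0") (auto simp: spow_def powr_mult_base powr_diff)

lemma spow_minus: "spow (- a) q = - spow a q"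
  by (simp add: spow_def)

lemma spow_nonpos_eq: "a \<le> 0 \<Longrightarrow> spow a q = - ((- a) powr q)"
  using spow_nonneg_eq[of "- a" q] by (simp add: spow_minus)

lemma abs_spow: "\<bar>spow a q\<bar> = \<bar>a\<bar> powr q"
  by (cases "a \<ge> 0") (auto simp: spow_nonneg_eq spow_nonpos_eq)

lemma spow_nonneg_iff [simp]: "0 \<le> spow a q \<longleftrightarrow> 0 \<le> a"
  by (auto simp: spow_def zero_le_mult_iff)

lemma spow_mono:
  assumes "a \<le> b" "0 < q"
  shows "spow a q \<le> spow b q"
proof -
  consider "0 \<le> a" | "a < 0" "0 \<le> b" | "b < 0" using assms by linarith
  then show ?thesis
  proof cases
    case 1
    with assms show ?thesis by (simp add: spow_nonneg_eq powr_mono2)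
  next
    case 2
    then have "spow a q \<le> 0" by (simp add: spow_nonpos_eq)
    also have "0 \<le> spow b q" using 2 by simp
    finally show ?thesis .
  next
    case 3
    with assms show ?thesis by (simp add: spow_nonpos_eq powr_mono2)
  qed
qed

lemma spow_mult: "0 \<le> c \<Longrightarrow> spow (c * a) q = c powr q * spow a q"
  using powr_mult_base[of c "q - 1"] by (simp add: spow_def abs_mult powr_mult mult_ac)

lemma spow_measurable [measurable]: "(\<lambda>a. spow a q) \<in> borel_measurable borel"
  unfolding spow_def by measurable

lemma powr_eq_mult_powr: "0 \<le> a \<Longrightarrow> a powr q = a * a powr (q - 1)" for a q :: real
  using powr_mult_base[of a "q - 1"] by simp

lemma powr_add_le:
  fixes a b p :: real
  assumes "0 \<le> a" "0 \<le> b" "0 \<le> p"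
  shows "(a + b) powr p \<le> 2 powr p * (a powr p + b powr p)"
proof -
  have "(a + b) powr p \<le> (2 * max a b) powr p"
    using assms by (intro powr_mono2) auto
  also have "\<dots> = 2 powr p * (max a b) powr p" using assms by (simp add: powr_mult)
  also have "(max a b) powr p \<le> a powr p + b powr p" by (simp add: max_def)
  finally show ?thesis by simp
qed

lemma powr_diff_le_convex:
  fixes A B q :: real
  assumes "0 \<le> A" "0 \<le> B" "1 \<le> q"
  shows "A powr q - B powr q \<le> q * (A - B) * A powr (q - 1)"
proof (cases "q = 1")
  case True
  then show ?thesis using assms by simp
next
  case False
  have "B * A powr (q - 1) \<le> B powr q / q + (A powr (q - 1)) powr (q / (q - 1)) / (q / (q - 1))"
    using assms False by (intro Youngs_inequality) (auto simp: field_simps)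
  also have "(A powr (q - 1)) powr (q / (q - 1)) = A powr q"
    using assms False by (simp add: powr_powr)
  also have "B powr q / q + A powr q / (q / (q - 1)) = (B powr q + (q - 1) * A powr q) / q"
    using assms by (simp add: add_divide_distrib)
  finally have "q * (B * A powr (q - 1)) \<le> B powr q + (q - 1) * A powr q"
    using assms by (simp add: field_simps)
  then show ?thesis
    using powr_eq_mult_powr[of A q] assms by (simp add: algebra_simps)
qed

lemma powr_diff_le_concave:
  fixes A B q :: real
  assumes "0 \<le> B" "B \<le> A" "q \<le> 1"
  shows "A powr q - B powr q \<le> (A - B) * A powr (q - 1)"
proof (cases "B = 0")
  case False
  then have "A powr (q - 1) \<le> B powr (q - 1)" using assms by (intro powr_mono2') auto
  then have "B * A powr (q - 1) \<le> B powr q"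
    using assms powr_eq_mult_powr[of B q] by (simp add: mult_left_mono)
  then show ?thesis using assms powr_eq_mult_powr[of A q] by (simp add: algebra_simps)
qed (use assms powr_eq_mult_powr[of A q] in simp)

lemma powr_diff_le:
  fixes A B q :: real
  assumes AB: "0 \<le> B" "B \<le> A" "0 < A" and q: "0 < q"
  shows "A powr q - B powr q \<le> (q + 2) * (A - B) * (A + B) powr (q - 1)"
proof (cases "1 \<le> q")
  case True
  then have "A powr q - B powr q \<le> q * (A - B) * A powr (q - 1)"
    using AB by (intro powr_diff_le_convex) auto
  also have "\<dots> \<le> (q + 2) * (A - B) * (A + B) powr (q - 1)"
    using AB q True by (intro mult_mono powr_mono2 mult_nonneg_nonneg) auto
  finally show ?thesis .
next
  case False
  then have "A powr q - B powr q \<le> (A - B) * A powr (q - 1)"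
    using AB by (intro powr_diff_le_concave) auto
  also have "A powr (q - 1) \<le> (1 / 2 * (A + B)) powr (q - 1)"
    using AB False by (intro powr_mono2') auto
  also have "\<dots> = (1 / 2) powr (q - 1) * (A + B) powr (q - 1)"
    by (rule powr_mult)
  also have "(1 / 2 :: real) powr (q - 1) \<le> q + 2"
    using powr_mono'[of "- 1" "q - 1" "1 / 2 :: real"] q by (simp add: powr_minus)
  finally show ?thesis using AB by (simp add: mult_left_mono mult_right_mono mult_ac)
qed

lemma spow_add_le:
  fixes A B q :: real
  assumes "0 \<le> A + B" "0 < q"
  shows "spow A q + spow B q \<le> (q + 2) * (A + B) * (\<bar>A\<bar> + \<bar>B\<bar>) powr (q - 1)"
  using assms(1)
proof (induction A B rule: linorder_wlog)
  case (sym A B)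
  then show ?case by (simp add: add.commute)
next
  case (le B A)
  consider "A = 0" | "0 < A" "0 \<le> B" | "0 < A" "B < 0" using le by linarith
  then show ?case
  proof cases
    case 1
    then show ?thesis using le by simp
  next
    case 2
    have "spow A q + spow B q \<le> (A + B) powr q + (A + B) powr q"
      using 2 assms powr_mono2[of q A "A + B"] powr_mono2[of q B "A + B"] by (simp add: spow_nonneg_eq)
    also have "\<dots> = 2 * (A + B) * (A + B) powr (q - 1)"
      using 2 powr_eq_mult_powr[of "A + B" q] by simp
    also have "\<dots> \<le> (q + 2) * (A + B) * (A + B) powr (q - 1)"
      using 2 assms by (intro mult_right_mono) auto
    finally show ?thesis using 2 by (simp add: add.commute)
  next
    case 3
    then show ?thesis
      using powr_diff_le[of "- B" A q] le assms by (simp add: spow_nonneg_eq spow_nonpos_eq add.commute)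
  qed
qed

section \<open>A barrier for the fractional p-Laplacian\<close>

subsection \<open>Differences of even powers of the norm\<close>

definition norm_power :: "nat \<Rightarrow> 'a::real_normed_vector \<Rightarrow> real" where
  "norm_power i x = norm x ^ (2 * Suc i)"

lemma norm_power_nonneg [simp]: "0 \<le> norm_power i x"
  by (simp add: norm_power_def del: mult_Suc_right)

lemma norm_power_le_1: "norm x \<le> 1 \<Longrightarrow> norm_power i x \<le> 1"
  unfolding norm_power_def by (rule power_le_one) auto

lemma norm_power_ge_1: "1 \<le> norm x \<Longrightarrow> 1 \<le> norm_power i x"
  unfolding norm_power_def by (rule one_le_power)

lemma norm_power_measurable [measurable]:
  "norm_power i \<in> borel_measurable (borel :: 'a::{real_normed_vector, second_countable_topology} measure)"
  unfolding norm_power_def[abs_def] by measurable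

lemma norm_power_inner: "norm_power i x = (x \<bullet> x) ^ Suc i"
  unfolding norm_power_def power_mult power2_norm_eq_inner ..

lemma norm_power_add: "norm_power i (x + h) = (x \<bullet> x + h \<bullet> h + 2 * (x \<bullet> h)) ^ Suc i"
  unfolding norm_power_inner
  by (rule arg_cong[where f = "\<lambda>t. t ^ Suc i"]) (simp add: inner_simps inner_commute)

lemma norm_power_diff_eq: "norm_power i (x - h) = (x \<bullet> x + h \<bullet> h - 2 * (x \<bullet> h)) ^ Suc i"
  using norm_power_add[of i x "- h"] by simp

lemma abs_two_inner_le: "\<bar>2 * (x \<bullet> h)\<bar> \<le> x \<bullet> x + h \<bullet> h"
  using inner_ge_zero[of "x + h"] inner_ge_zero[of "x - h"]
  by (simp add: inner_simps inner_commute abs_le_iff)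

lemma abs_power_Suc_diff_le:
  fixes y t M :: real
  assumes "\<bar>y\<bar> \<le> M" "\<bar>t\<bar> \<le> M"
  shows "\<bar>y ^ Suc i - t ^ Suc i\<bar> \<le> real (Suc i) * M ^ i * \<bar>y - t\<bar>"
proof (cases "M = 0")
  case False
  then have M: "0 < M" using assms by linarith
  have "y ^ Suc i - t ^ Suc i = M ^ Suc i * ((y / M) ^ Suc i - (t / M) ^ Suc i)"
    using M by (simp add: power_divide right_diff_distrib del: power_Suc)
  then have "\<bar>y ^ Suc i - t ^ Suc i\<bar> = M ^ Suc i * \<bar>(y / M) ^ Suc i - (t / M) ^ Suc i\<bar>"
    using M by (simp add: abs_mult del: power_Suc)
  also have "\<dots> \<le> M ^ Suc i * (real (Suc i) * \<bar>y / M - t / M\<bar>)"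
    using norm_power_diff[of "y / M" "t / M" "Suc i"] assms M by (intro mult_left_mono) auto
  also have "\<bar>y / M - t / M\<bar> = \<bar>y - t\<bar> / M"
    using M by (simp add: diff_divide_distrib[symmetric])
  finally show ?thesis using M by (simp add: mult_ac)
qed (use assms in simp)

lemma power_second_order_remainder:
  fixes a b :: real
  assumes "0 < b" "\<bar>a\<bar> \<le> b"
  shows "\<bar>(b + a) ^ j - b ^ j - real j * a * b ^ j / b\<bar> \<le> 4 ^ j * a\<^sup>2 * b ^ j / b\<^sup>2"
proof (induction j)
  case (Suc j)
  let ?E = "(b + a) ^ j - b ^ j - real j * a * b ^ j / b"
  have "(b + a) ^ Suc j - b ^ Suc j - real (Suc j) * a * b ^ Suc j / b
       = (b + a) * ?E + real j * a\<^sup>2 * b ^ j / b"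
    using assms by (simp add: field_simps power2_eq_square)
  then have "\<bar>(b + a) ^ Suc j - b ^ Suc j - real (Suc j) * a * b ^ Suc j / b\<bar>
      \<le> \<bar>(b + a) * ?E\<bar> + \<bar>real j * a\<^sup>2 * b ^ j / b\<bar>"
    by (metis abs_triangle_ineq)
  also have "\<dots> = \<bar>b + a\<bar> * \<bar>?E\<bar> + real j * a\<^sup>2 * b ^ j / b"
    using assms by (simp add: abs_mult)
  also have "\<dots> \<le> (2 * b) * (4 ^ j * a\<^sup>2 * b ^ j / b\<^sup>2) + 2 * 4 ^ j * a\<^sup>2 * b ^ j / b"
  proof (intro add_mono mult_mono Suc divide_right_mono)
    have "real j < 2 ^ j" by (rule of_nat_less_two_power)
    also have "(2::real) ^ j \<le> 4 ^ j" by (intro power_mono) auto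
    finally have "real j < 4 ^ j" .
    then show "real j \<le> 2 * 4 ^ j" by linarith
  qed (use assms in auto)
  also have "\<dots> = 4 ^ Suc j * a\<^sup>2 * b ^ Suc j / b\<^sup>2"
    using assms by (simp add: field_simps power2_eq_square)
  finally show ?case .
qed simp

lemma power_symmetric_gap_ge:
  fixes a b :: real
  assumes "\<bar>a\<bar> \<le> b"
  shows "2 * \<bar>a\<bar> * b ^ i \<le> \<bar>(b + a) ^ Suc i - (b - a) ^ Suc i\<bar>"
proof -
  have "2 * a * b ^ i \<le> (b + a) ^ Suc i - (b - a) ^ Suc i" if "0 \<le> a" "a \<le> b" for a
  proof -
    have "(b + a) * b ^ i \<le> (b + a) * (b + a) ^ i"
      using that by (intro mult_left_mono power_mono) auto
    moreover have "(b - a) * (b - a) ^ i \<le> (b - a) * b ^ i"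
      using that by (intro mult_left_mono power_mono) auto
    ultimately show ?thesis by (simp add: algebra_simps)
  qed
  from this[of a] this[of "- a"] show ?thesis using assms by (cases "a \<ge> 0") auto
qed

definition second_difference_const :: "nat \<Rightarrow> real" where
  "second_difference_const i = (8 * 4 ^ Suc i + 2 * real (Suc i)) * 2 ^ i"

lemma second_difference_const_nonneg: "0 \<le> second_difference_const i"
  by (simp add: second_difference_const_def)

lemma power_second_difference_le:
  fixes a t \<tau> :: real
  assumes t: "0 < t" and \<tau>: "0 \<le> \<tau>" "\<tau> \<le> t" and a: "\<bar>a\<bar> \<le> t" "a\<^sup>2 \<le> 4 * t * \<tau>"
  defines "b \<equiv> t + \<tau>"
  shows "((b + a) ^ Suc i - t ^ Suc i) + ((b - a) ^ Suc i - t ^ Suc i)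
    \<le> second_difference_const i * (\<tau> * t ^ i)"
proof -
  have b: "0 < b" "\<bar>a\<bar> \<le> b" "b \<le> 2 * t" using assms by auto
  have remainder: "(b + a') ^ Suc i \<le> b ^ Suc i + real (Suc i) * b ^ i * a' + 4 * 4 ^ Suc i * \<tau> * b ^ i"
    if "a' \<in> {a, - a}" for a'
  proof -
    have "(b + a') ^ Suc i - b ^ Suc i - real (Suc i) * a' * b ^ Suc i / b
      \<le> 4 ^ Suc i * a\<^sup>2 * b ^ Suc i / b\<^sup>2"
      using power_second_order_remainder[of b a' "Suc i"] b that by auto
    also have "\<dots> \<le> 4 ^ Suc i * (4 * b * \<tau>) * b ^ Suc i / b\<^sup>2"
    proof (intro divide_right_mono mult_right_mono mult_left_mono)
      have "4 * t * \<tau> \<le> 4 * b * \<tau>" using \<tau> by (intro mult_right_mono) (auto simp: b_def)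
      with a(2) show "a\<^sup>2 \<le> 4 * b * \<tau>" by linarith
    qed (use b in auto)
    also have "\<dots> = 4 * 4 ^ Suc i * \<tau> * b ^ i"
      using b by (simp add: field_simps power2_eq_square)
    finally show ?thesis using b by (simp add: mult_ac)
  qed
  have "b ^ Suc i - t ^ Suc i \<le> real (Suc i) * b ^ i * \<tau>"
    using abs_power_Suc_diff_le[of b b t i] t \<tau> by (auto simp: b_def)
  then have "((b + a) ^ Suc i - t ^ Suc i) + ((b - a) ^ Suc i - t ^ Suc i)
    \<le> (8 * 4 ^ Suc i + 2 * real (Suc i)) * \<tau> * b ^ i"
    using remainder[of a] remainder[of "- a"] by (simp add: algebra_simps del: power_Suc)
  also have "\<dots> \<le> (8 * 4 ^ Suc i + 2 * real (Suc i)) * \<tau> * (2 * t) ^ i"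
    using b \<tau> by (intro mult_left_mono power_mono) auto
  finally show ?thesis by (simp only: second_difference_const_def power_mult_distrib mult_ac)
qed

lemma norm_power_second_difference_le:
  fixes x h :: "'a::real_inner"
  assumes "h \<noteq> 0" "2 * norm h \<le> norm x"
  shows "(norm_power i (x + h) - norm_power i x) + (norm_power i (x - h) - norm_power i x)
    \<le> second_difference_const i * ((norm h)\<^sup>2 * norm x ^ (2 * i))"
proof -
  have "0 < norm h" using assms by simp
  then have x: "0 < x \<bullet> x" using assms by auto
  have "norm h \<le> norm x" using assms norm_ge_zero[of h] by linarith
  then have "h \<bullet> h \<le> x \<bullet> x" by (simp only: norm_le)
  moreover have "\<bar>2 * (x \<bullet> h)\<bar> \<le> x \<bullet> x"
  proof -
    have "\<bar>2 * (x \<bullet> h)\<bar> \<le> norm x * (2 * norm h)" using Cauchy_Schwarz_ineq2[of x h] by (simp add: abs_mult)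
    also have "\<dots> \<le> norm x * norm x" using assms by (intro mult_left_mono) auto
    finally show ?thesis by (simp add: dot_square_norm power2_eq_square)
  qed
  moreover have "(2 * (x \<bullet> h))\<^sup>2 \<le> 4 * (x \<bullet> x) * (h \<bullet> h)"
    using Cauchy_Schwarz_ineq[of x h] by (simp add: power_mult_distrib)
  ultimately show ?thesis
    using power_second_difference_le[OF x inner_ge_zero, of h "2 * (x \<bullet> h)" i]
    unfolding norm_power_add norm_power_diff_eq norm_power_inner[of i x] power_mult power2_norm_eq_inner
    by blast
qed

lemma norm_power_symmetric_gap_ge:
  "norm x ^ (2 * i) * \<bar>x \<bullet> h\<bar> \<le> \<bar>norm_power i (x + h) - norm_power i (x - h)\<bar>"
proof -
  have "norm x ^ (2 * i) * \<bar>x \<bullet> h\<bar> \<le> (x \<bullet> x + h \<bullet> h) ^ i * \<bar>x \<bullet> h\<bar>"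
    unfolding power_mult power2_norm_eq_inner by (intro mult_right_mono power_mono) auto
  also have "\<dots> \<le> 2 * \<bar>2 * (x \<bullet> h)\<bar> * (x \<bullet> x + h \<bullet> h) ^ i"
    by (simp add: abs_mult)
  also have "\<dots> \<le> \<bar>norm_power i (x + h) - norm_power i (x - h)\<bar>"
    unfolding norm_power_add norm_power_diff_eq by (intro power_symmetric_gap_ge abs_two_inner_le)
  finally show ?thesis .
qed

lemma norm_power_difference_le:
  assumes "norm x \<le> 1" "norm h \<le> 1"
  shows "\<bar>norm_power i (x + h) - norm_power i x\<bar> \<le> 3 * real (Suc i) * 4 ^ i * norm h"
proof -
  have n: "norm (x + h) \<le> 2" "\<bar>norm (x + h) - norm x\<bar> \<le> norm h"
    using assms norm_triangle_ineq[of x h] norm_triangle_ineq3[of "x + h" x] by auto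
  have "norm_power i (x + h) - norm_power i x = ((norm (x + h))\<^sup>2) ^ Suc i - ((norm x)\<^sup>2) ^ Suc i"
    by (simp only: norm_power_def power_mult)
  also have "\<bar>\<dots>\<bar> \<le> real (Suc i) * 4 ^ i * \<bar>(norm (x + h))\<^sup>2 - (norm x)\<^sup>2\<bar>"
  proof (rule abs_power_Suc_diff_le)
    show "\<bar>(norm (x + h))\<^sup>2\<bar> \<le> 4" "\<bar>(norm x)\<^sup>2\<bar> \<le> 4"
      using n assms power_mono[of "norm (x + h)" 2 2] power_mono[of "norm x" 2 2] by auto
  qed
  also have "\<bar>(norm (x + h))\<^sup>2 - (norm x)\<^sup>2\<bar> = \<bar>norm (x + h) - norm x\<bar> * (norm (x + h) + norm x)"
    by (simp add: power2_eq_square square_diff_square_factored abs_mult mult.commute)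
  also have "\<dots> \<le> norm h * 3"
    using n assms by (intro mult_mono) auto
  also have "real (Suc i) * 4 ^ i * (norm h * 3) = 3 * real (Suc i) * 4 ^ i * norm h" by simp
  finally show ?thesis by (simp add: mult_left_mono)
qed

lemma norm_power_near_le:
  assumes "norm x \<le> 2 * norm h"
  shows "norm_power i (x + h) - norm_power i x \<le> 9 ^ Suc i * norm h ^ (2 * Suc i)"
proof -
  have "norm_power i (x + h) \<le> (3 * norm h) ^ (2 * Suc i)"
    unfolding norm_power_def using assms norm_triangle_ineq[of x h] by (intro power_mono) auto
  also have "\<dots> = 9 ^ Suc i * norm h ^ (2 * Suc i)"
    by (simp only: power_mult_distrib power_mult) simp
  finally show ?thesis using norm_power_nonneg[of i x] by linarith
qed

subsection \<open>Symmetric differences\<close>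

definition sym_spow_diff :: "real \<Rightarrow> ('a::real_vector \<Rightarrow> real) \<Rightarrow> 'a \<Rightarrow> 'a \<Rightarrow> real" where
  "sym_spow_diff q f x h = spow (f (x + h) - f x) q + spow (f (x - h) - f x) q"

lemma sym_spow_diff_norm_power_near_le:
  assumes q: "0 < q" and near: "norm x \<le> 2 * norm h"
  shows "sym_spow_diff q (norm_power i) x h \<le> 2 * (9 ^ Suc i) powr q * norm h powr (real (2 * Suc i) * q)"
proof -
  let ?B = "9 ^ Suc i * norm h ^ (2 * Suc i)"
  have "sym_spow_diff q (norm_power i) x h \<le> spow ?B q + spow ?B q"
    unfolding sym_spow_diff_def
    using norm_power_near_le[of x h i] norm_power_near_le[of x "- h" i] near q
    by (intro add_mono spow_mono) auto
  also have "\<dots> = 2 * (9 ^ Suc i) powr q * (norm h ^ (2 * Suc i)) powr q"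
    by (simp add: spow_nonneg_eq powr_mult del: power_Suc mult_Suc_right)
  also have "norm h ^ (2 * Suc i) = norm h powr real (2 * Suc i)"
    by (subst powr_realpow') auto
  finally show ?thesis by (simp only: powr_powr)
qed

lemma sym_spow_diff_norm_power_far_le:
  fixes x h :: "'a::real_inner" and i :: nat
  assumes p: "1 < p" and far: "h \<noteq> 0" "2 * norm h \<le> norm x"
  shows "sym_spow_diff (p - 1) (norm_power i) x h
    \<le> (p + 1) * second_difference_const i * ((norm h)\<^sup>2 * norm x ^ (2 * i) *
    (\<bar>norm_power i (x + h) - norm_power i x\<bar> + \<bar>norm_power i (x - h) - norm_power i x\<bar>) powr (p - 2))"
    (is "_ \<le> (p + 1) * second_difference_const i * (?Z * (\<bar>?A\<bar> + \<bar>?B\<bar>) powr (p - 2))")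
proof (cases "0 \<le> ?A + ?B")
  case True
  have exponents: "p - 1 + 2 = p + 1" "p - 1 - 1 = p - 2" by auto
  have "sym_spow_diff (p - 1) (norm_power i) x h \<le> (p + 1) * (?A + ?B) * (\<bar>?A\<bar> + \<bar>?B\<bar>) powr (p - 2)"
    using spow_add_le[OF True, of "p - 1"] p unfolding sym_spow_diff_def exponents by simp
  also have "\<dots> \<le> (p + 1) * (second_difference_const i * ?Z) * (\<bar>?A\<bar> + \<bar>?B\<bar>) powr (p - 2)"
    using far p by (intro mult_right_mono mult_left_mono norm_power_second_difference_le) auto
  finally show ?thesis by (simp only: mult.assoc)
next
  case False
  then have "spow ?A (p - 1) \<le> - spow ?B (p - 1)"
    using p unfolding spow_minus[symmetric] by (intro spow_mono) auto
  then have "sym_spow_diff (p - 1) (norm_power i) x h \<le> 0" by (simp add: sym_spow_diff_def)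
  also have "0 \<le> (p + 1) * second_difference_const i * (?Z * (\<bar>?A\<bar> + \<bar>?B\<bar>) powr (p - 2))"
    using p by (simp add: second_difference_const_nonneg)
  finally show ?thesis .
qed

lemma sym_spow_diff_norm_power_far_le_of_ge_2:
  fixes x h :: "'a::real_inner" and i :: nat
  assumes p: "2 \<le> p" and far: "h \<noteq> 0" "2 * norm h \<le> norm x" and x: "norm x \<le> 1"
  shows "sym_spow_diff (p - 1) (norm_power i) x h
    \<le> (p + 1) * second_difference_const i * (6 * real (Suc i) * 4 ^ i) powr (p - 2) * norm h powr p"
proof -
  let ?A = "norm_power i (x + h) - norm_power i x" and ?B = "norm_power i (x - h) - norm_power i x"
  let ?c = "6 * real (Suc i) * 4 ^ i"
  have h: "norm h \<le> 1" using far x norm_ge_zero[of h] by linarith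
  have "sym_spow_diff (p - 1) (norm_power i) x h
      \<le> (p + 1) * second_difference_const i * ((norm h)\<^sup>2 * norm x ^ (2 * i) * (\<bar>?A\<bar> + \<bar>?B\<bar>) powr (p - 2))"
    using p far by (intro sym_spow_diff_norm_power_far_le) auto
  also have "((norm h)\<^sup>2 * norm x ^ (2 * i)) * (\<bar>?A\<bar> + \<bar>?B\<bar>) powr (p - 2)
      \<le> ((norm h)\<^sup>2 * 1) * (?c * norm h) powr (p - 2)"
  proof (intro mult_mono mult_left_mono powr_mono2 power_le_one)
    show "\<bar>?A\<bar> + \<bar>?B\<bar> \<le> ?c * norm h"
      using norm_power_difference_le[OF x h, of i] norm_power_difference_le[OF x, of "- h" i] h
      by (simp add: algebra_simps)
  qed (use p x in auto)
  also have "\<dots> = ?c powr (p - 2) * (norm h powr 2 * norm h powr (p - 2))"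
    using far by (simp add: powr_mult)
  also have "norm h powr 2 * norm h powr (p - 2) = norm h powr p"
    by (simp only: powr_add[symmetric]) simp
  finally show ?thesis using p by (simp add: second_difference_const_nonneg mult_left_mono mult.assoc)
qed

lemma sym_spow_diff_norm_power_far_le_of_less_2:
  fixes x h e :: "'a::real_inner" and i :: nat
  assumes p: "1 < p" "p < 2" and i: "1 \<le> (2 * real i + 1) * (p - 1)"
    and far: "2 * norm h \<le> norm x" and x: "norm x \<le> 1" "norm x *\<^sub>R e = x" and eh: "e \<bullet> h \<noteq> 0"
  shows "sym_spow_diff (p - 1) (norm_power i) x h
    \<le> (p + 1) * second_difference_const i * (\<bar>e \<bullet> h\<bar> powr (p - 2) * (norm h)\<^sup>2)"
proof -
  let ?A = "norm_power i (x + h) - norm_power i x" and ?B = "norm_power i (x - h) - norm_power i x"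
  define r where "r = norm x"
  have h: "h \<noteq> 0" using eh by auto
  then have "0 < norm h" by simp
  then have r: "0 < r" "r \<le> 1" using far x by (auto simp: r_def)
  have xh: "\<bar>x \<bullet> h\<bar> = r * \<bar>e \<bullet> h\<bar>"
    using arg_cong[OF x(2), of "\<lambda>x. \<bar>x \<bullet> h\<bar>"] by (simp add: r_def abs_mult)
  have "r ^ (2 * i + 1) * \<bar>e \<bullet> h\<bar> = norm x ^ (2 * i) * \<bar>x \<bullet> h\<bar>"
    unfolding xh by (simp add: r_def)
  also have "\<dots> \<le> \<bar>?A - ?B\<bar>" using norm_power_symmetric_gap_ge[of x i h] by simp
  also have "\<dots> \<le> \<bar>?A\<bar> + \<bar>?B\<bar>" by (rule abs_triangle_ineq4)
  finally have "(\<bar>?A\<bar> + \<bar>?B\<bar>) powr (p - 2) \<le> (r ^ (2 * i + 1) * \<bar>e \<bullet> h\<bar>) powr (p - 2)"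
    using p r eh by (intro powr_mono2') auto
  also have "\<dots> = r powr (real (2 * i + 1) * (p - 2)) * \<bar>e \<bullet> h\<bar> powr (p - 2)"
    using r by (simp only: powr_mult powr_powr flip: powr_realpow)
  finally have gap: "(\<bar>?A\<bar> + \<bar>?B\<bar>) powr (p - 2)
    \<le> r powr (real (2 * i + 1) * (p - 2)) * \<bar>e \<bullet> h\<bar> powr (p - 2)" .
  have "r powr real (2 * i) * r powr (real (2 * i + 1) * (p - 2)) = r powr ((2 * real i + 1) * (p - 1) - 1)"
    by (simp add: algebra_simps flip: powr_add)
  also have "\<dots> \<le> 1" using i r by (intro powr_le1) auto
  finally have weight: "r ^ (2 * i) * r powr (real (2 * i + 1) * (p - 2)) \<le> 1"
    using r by (simp only: powr_realpow)
  have "sym_spow_diff (p - 1) (norm_power i) x h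
      \<le> (p + 1) * second_difference_const i * ((norm h)\<^sup>2 * r ^ (2 * i) * (\<bar>?A\<bar> + \<bar>?B\<bar>) powr (p - 2))"
    unfolding r_def using p far h by (intro sym_spow_diff_norm_power_far_le) auto
  also have "(norm h)\<^sup>2 * r ^ (2 * i) * (\<bar>?A\<bar> + \<bar>?B\<bar>) powr (p - 2)
      \<le> ((norm h)\<^sup>2 * r ^ (2 * i)) * (r powr (real (2 * i + 1) * (p - 2)) * \<bar>e \<bullet> h\<bar> powr (p - 2))"
    using gap r by (intro mult_left_mono) auto
  also have "\<dots> = (\<bar>e \<bullet> h\<bar> powr (p - 2) * (norm h)\<^sup>2) * (r ^ (2 * i) * r powr (real (2 * i + 1) * (p - 2)))"
    by (simp only: mult_ac)
  also have "\<dots> \<le> (\<bar>e \<bullet> h\<bar> powr (p - 2) * (norm h)\<^sup>2) * 1"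
    using weight by (intro mult_left_mono) auto
  finally show ?thesis using p by (simp add: second_difference_const_nonneg mult_left_mono mult.assoc)
qed

lemma norm_powr_le_directional:
  fixes e h :: "'a::real_inner"
  assumes "norm e = 1" "e \<bullet> h \<noteq> 0" "0 \<le> \<theta>"
  shows "norm h powr p \<le> \<bar>e \<bullet> h\<bar> powr (- \<theta>) * norm h powr (p + \<theta>)"
proof -
  have "\<bar>e \<bullet> h\<bar> \<le> norm h" using Cauchy_Schwarz_ineq2[of e h] assms by simp
  then have "norm h powr (- \<theta>) \<le> \<bar>e \<bullet> h\<bar> powr (- \<theta>)"
    using assms by (intro powr_mono2') auto
  then have "norm h powr (- \<theta>) * norm h powr (p + \<theta>) \<le> \<bar>e \<bullet> h\<bar> powr (- \<theta>) * norm h powr (p + \<theta>)"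
    by (intro mult_right_mono) auto
  then show ?thesis by (simp flip: powr_add)
qed

lemma sym_spow_diff_norm_power_le_directional:
  fixes p :: real and i :: nat and x h e :: "'a::real_inner"
  assumes p: "1 < p" and i: "1 \<le> (2 * real i + 1) * (p - 1)"
    and x: "norm x \<le> 1" and h: "norm h \<le> 1" and e: "norm e = 1" "norm x *\<^sub>R e = x" "e \<bullet> h \<noteq> 0"
  defines "\<theta> \<equiv> max 0 (2 - p)" and "C\<^sub>1 \<equiv> 2 * (9 ^ Suc i) powr (p - 1)"
    and "C\<^sub>2 \<equiv> (p + 1) * second_difference_const i" and "C\<^sub>3 \<equiv> (6 * real (Suc i) * 4 ^ i) powr (p - 2)"
  shows "sym_spow_diff (p - 1) (norm_power i) x h
    \<le> (C\<^sub>1 + C\<^sub>2 + C\<^sub>2 * C\<^sub>3) * (\<bar>e \<bullet> h\<bar> powr (- \<theta>) * norm h powr (p + \<theta>))" (is "_ \<le> _ * ?R")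
proof -
  have C: "0 \<le> C\<^sub>1" "0 \<le> C\<^sub>2" "0 \<le> C\<^sub>3"
    using p second_difference_const_nonneg[of i] by (simp_all add: C\<^sub>1_def C\<^sub>2_def C\<^sub>3_def)
  have R: "norm h powr p \<le> ?R" using e by (intro norm_powr_le_directional) (simp_all add: \<theta>_def)
  have h0: "h \<noteq> 0" using e by auto
  consider "norm x \<le> 2 * norm h" | "2 * norm h \<le> norm x" "2 \<le> p" | "2 * norm h \<le> norm x" "p < 2" by linarith
  then obtain C' where C': "C' \<in> {C\<^sub>1, C\<^sub>2, C\<^sub>2 * C\<^sub>3}" "sym_spow_diff (p - 1) (norm_power i) x h \<le> C' * ?R"
  proof cases
    case 1
    have "sym_spow_diff (p - 1) (norm_power i) x h \<le> C\<^sub>1 * norm h powr (real (2 * Suc i) * (p - 1))"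
      unfolding C\<^sub>1_def using p 1 by (intro sym_spow_diff_norm_power_near_le) auto
    also have "norm h powr (real (2 * Suc i) * (p - 1)) \<le> norm h powr p"
      using h h0 i by (intro powr_mono') (auto simp: algebra_simps)
    also note R
    finally show ?thesis using that[of C\<^sub>1] C by (simp add: mult_left_mono)
  next
    case 2
    then have "sym_spow_diff (p - 1) (norm_power i) x h \<le> C\<^sub>2 * C\<^sub>3 * norm h powr p"
      unfolding C\<^sub>2_def C\<^sub>3_def using h0 x by (intro sym_spow_diff_norm_power_far_le_of_ge_2)
    also have "\<dots> \<le> C\<^sub>2 * C\<^sub>3 * ?R" using C R by (intro mult_left_mono mult_nonneg_nonneg)
    finally show ?thesis using that by blast
  next
    case 3
    then have "?R = \<bar>e \<bullet> h\<bar> powr (p - 2) * (norm h)\<^sup>2"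
      using h0 by (simp add: \<theta>_def powr_numeral)
    then show ?thesis
      using sym_spow_diff_norm_power_far_le_of_less_2[of p i h x e] p i 3 x e that[of C\<^sub>2]
      by (simp add: C\<^sub>2_def)
  qed
  have "C' * ?R \<le> (C\<^sub>1 + C\<^sub>2 + C\<^sub>2 * C\<^sub>3) * ?R"
    using C C'(1) by (intro mult_right_mono) auto
  with C'(2) show ?thesis by linarith
qed

text \<open>The even part of an increment of \<open>norm_power i\<close> is \<open>O(\<bar>h\<bar>\<^sup>2)\<close>, while the odd part is at least of
  order \<open>\<bar>e \<bullet> h\<bar>\<close>; this controls the singularity of \<open>t powr (p - 2)\<close> for \<open>p < 2\<close>. The exponent
  is so high that \<open>norm_power i\<close> is flat enough at its only critical point.\<close>
lemma sym_spow_diff_norm_power_le: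
  fixes p :: real and i :: nat
  assumes p: "1 < p" and i: "1 \<le> (2 * real i + 1) * (p - 1)"
  defines "\<theta> \<equiv> max 0 (2 - p)"
  obtains C where "0 \<le> C"
    "\<And>x :: 'a::euclidean_space. norm x < 1 \<Longrightarrow> \<exists>e. norm e = 1 \<and> (\<forall>h. norm h < 1 \<longrightarrow> e \<bullet> h \<noteq> 0 \<longrightarrow>
        sym_spow_diff (p - 1) (norm_power i) x h \<le> C * (\<bar>e \<bullet> h\<bar> powr (- \<theta>) * norm h powr (p + \<theta>)))"
proof
  let ?C\<^sub>2 = "(p + 1) * second_difference_const i"
  let ?C = "2 * (9 ^ Suc i) powr (p - 1) + ?C\<^sub>2 + ?C\<^sub>2 * (6 * real (Suc i) * 4 ^ i) powr (p - 2)"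
  show "0 \<le> ?C" using p second_difference_const_nonneg[of i] by simp
  fix x :: 'a
  assume x: "norm x < 1"
  obtain e :: 'a where "norm e = 1" "norm x *\<^sub>R e = x"
  proof (cases "x = 0")
    case True
    then show ?thesis using that vector_choose_size[of 1] by auto
  next
    case False
    then show ?thesis by (intro that[of "x /\<^sub>R norm x"]) simp_all
  qed
  then show "\<exists>e. norm e = 1 \<and> (\<forall>h. norm h < 1 \<longrightarrow> e \<bullet> h \<noteq> 0 \<longrightarrow>
      sym_spow_diff (p - 1) (norm_power i) x h \<le> ?C * (\<bar>e \<bullet> h\<bar> powr (- \<theta>) * norm h powr (p + \<theta>)))"
    unfolding \<theta>_def using x
    by (intro exI[of _ e] conjI allI impI sym_spow_diff_norm_power_le_directional p i) auto
qed

subsection \<open>The barrier\<close>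

definition barrier :: "nat \<Rightarrow> 'a::euclidean_space \<Rightarrow> real \<Rightarrow> 'a \<Rightarrow> real" where
  "barrier i x0 \<rho> x = max 0 (1 - norm_power i ((x - x0) /\<^sub>R \<rho>))"

lemma barrier_nonneg [simp]: "0 \<le> barrier i x0 \<rho> x"
  by (simp add: barrier_def)

lemma barrier_le_1 [simp]: "barrier i x0 \<rho> x \<le> 1"
  by (simp add: barrier_def)

lemma abs_barrier_diff_le_1: "\<bar>barrier i x0 \<rho> x - barrier i x0 \<rho> y\<bar> \<le> 1"
  using barrier_nonneg[of i x0 \<rho> x] barrier_nonneg[of i x0 \<rho> y] barrier_le_1[of i x0 \<rho> x]
      barrier_le_1[of i x0 \<rho> y]
  by linarith

lemma norm_centred_scale: "0 < \<rho> \<Longrightarrow> norm ((x - x0) /\<^sub>R \<rho>) = dist x0 x / \<rho>"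
  by (simp add: dist_norm norm_minus_commute divide_inverse mult.commute)

lemma barrier_outside: "0 < \<rho> \<Longrightarrow> x \<notin> ball x0 \<rho> \<Longrightarrow> barrier i x0 \<rho> x = 0"
  using norm_power_ge_1[of "(x - x0) /\<^sub>R \<rho>" i] norm_centred_scale[of \<rho> x x0] by (simp add: barrier_def)

lemma barrier_inside: "0 < \<rho> \<Longrightarrow> x \<in> ball x0 \<rho> \<Longrightarrow> barrier i x0 \<rho> x = 1 - norm_power i ((x - x0) /\<^sub>R \<rho>)"
  using norm_power_le_1[of "(x - x0) /\<^sub>R \<rho>" i] norm_centred_scale[of \<rho> x x0] by (simp add: barrier_def)

lemma barrier_ge_half:
  assumes "0 < \<rho>" "x \<in> ball x0 (\<rho> / 2)"
  shows "1 / 2 \<le> barrier i x0 \<rho> x"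
proof -
  have "norm_power i ((x - x0) /\<^sub>R \<rho>) \<le> (1 / 2) ^ (2 * Suc i)"
    unfolding norm_power_def using assms
    by (intro power_mono) (auto simp: norm_centred_scale simp del: norm_scaleR)
  also have "\<dots> \<le> (1 / 2) ^ 1" by (intro power_decreasing) auto
  finally show ?thesis by (simp add: barrier_def)
qed

lemma barrier_lipschitz:
  assumes "0 < \<rho>"
  shows "\<bar>barrier i x0 \<rho> x - barrier i x0 \<rho> y\<bar> \<le> real (2 * Suc i) / \<rho> * norm (x - y)"
proof -
  define n where "n x = min 1 (dist x0 x / \<rho>)" for x
  have eq: "barrier i x0 \<rho> x = 1 - n x ^ (2 * Suc i)" for x
  proof (cases "x \<in> ball x0 \<rho>")
    case True
    then show ?thesis
      using assms by (simp only: barrier_inside)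
        (simp add: norm_power_def norm_centred_scale n_def del: norm_scaleR power_Suc mult_Suc_right)
  next
    case False
    then show ?thesis using assms by (simp add: barrier_outside n_def)
  qed
  have "\<bar>n x ^ (2 * Suc i) - n y ^ (2 * Suc i)\<bar> \<le> real (2 * Suc i) * \<bar>n x - n y\<bar>"
    using norm_power_diff[of "n x" "n y" "2 * Suc i"] assms by (simp add: n_def)
  also have "\<bar>n x - n y\<bar> \<le> \<bar>dist x0 x / \<rho> - dist x0 y / \<rho>\<bar>"
    by (auto simp: n_def min_def)
  also have "\<dots> = \<bar>dist x0 x - dist x0 y\<bar> / \<rho>"
    using assms by (simp flip: diff_divide_distrib)
  also have "\<dots> \<le> norm (x - y) / \<rho>"
    using assms abs_dist_diff_le[of x x0 y] by (simp add: divide_right_mono dist_commute dist_norm)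
  finally have "\<bar>n x ^ (2 * Suc i) - n y ^ (2 * Suc i)\<bar> \<le> real (2 * Suc i) * (norm (x - y) / \<rho>)"
    by (simp add: mult_left_mono)
  then show ?thesis by (simp add: eq abs_minus_commute del: of_nat_Suc power_Suc mult_Suc_right)
qed

lemma barrier_measurable [measurable]: "barrier i x0 \<rho> \<in> borel_measurable borel"
  unfolding barrier_def[abs_def] by measurable

lemma barrier_sym_spow_diff_le:
  assumes q: "0 < q" and \<rho>: "0 < \<rho>" and x: "x \<in> ball x0 \<rho>"
  shows "spow (barrier i x0 \<rho> x - barrier i x0 \<rho> (x + h)) q
    + spow (barrier i x0 \<rho> x - barrier i x0 \<rho> (x - h)) q
    \<le> sym_spow_diff q (norm_power i) ((x - x0) /\<^sub>R \<rho>) (h /\<^sub>R \<rho>)"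
proof -
  have "barrier i x0 \<rho> x - barrier i x0 \<rho> (x + h)
    \<le> norm_power i ((x - x0) /\<^sub>R \<rho> + h /\<^sub>R \<rho>) - norm_power i ((x - x0) /\<^sub>R \<rho>)" for h
  proof -
    have "(x + h - x0) /\<^sub>R \<rho> = (x - x0) /\<^sub>R \<rho> + h /\<^sub>R \<rho>"
      by (simp add: algebra_simps)
    then show ?thesis
      unfolding barrier_inside[OF \<rho> x] by (simp add: barrier_def)
  qed
  from this[of h] this[of "- h"] show ?thesis
    unfolding sym_spow_diff_def using q by (intro add_mono spow_mono) auto
qed

definition barrier_operator :: "real \<Rightarrow> real \<Rightarrow> nat \<Rightarrow> real \<Rightarrow> 'a::euclidean_space \<Rightarrow> real \<Rightarrow> 'a \<Rightarrow> real" where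
  "barrier_operator s p i \<epsilon> x0 \<rho> x = (\<integral>h. indicator {h. \<epsilon> \<le> norm h \<and> norm h < \<rho>} h *
        (spow (barrier i x0 \<rho> x - barrier i x0 \<rho> (x + h)) (p - 1) * kern (p * s) h) \<partial>lborel)"

lemma integral_le_of_symmetrized:
  fixes g :: "'a::euclidean_space \<Rightarrow> real"
  assumes [measurable]: "g \<in> borel_measurable borel" and B: "0 \<le> B"
    and le: "(\<integral>\<^sup>+ h. ennreal (g h + g (- h)) \<partial>lborel) \<le> ennreal (2 * B)"
  shows "integral\<^sup>L lborel g \<le> B"
proof (cases "integrable lborel g")
  case False
  then show ?thesis using B by (simp add: not_integrable_integral_eq)
next
  case True
  have reflect: "integrable lborel (\<lambda>h. g (- h))" "(\<integral>h. g (- h) \<partial>lborel) = integral\<^sup>L lborel g"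
    using True lborel_distr_reflect[of "0::'a"]
      integrable_distr_eq[of "\<lambda>h. 0 - h" lborel borel g] integral_distr[of "\<lambda>h. 0 - h" lborel borel g]
    by simp_all
  have "(\<integral>h. g h + g (- h) \<partial>lborel) \<le> 2 * B"
    using B le by (intro integral_real_bounded) auto
  then show ?thesis using True reflect by simp
qed

lemma barrier_integrand_symmetrized_le:
  fixes x0 x e h :: "'a::euclidean_space"
  assumes p: "1 < p" and \<rho>: "0 < \<rho>" and x: "x \<in> ball x0 \<rho>" and h: "norm h < \<rho>" "e \<bullet> h \<noteq> 0"
    and sym: "\<And>h. norm h < 1 \<Longrightarrow> e \<bullet> h \<noteq> 0 \<Longrightarrow>
      sym_spow_diff (p - 1) (norm_power i) ((x - x0) /\<^sub>R \<rho>) h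
        \<le> C * (\<bar>e \<bullet> h\<bar> powr (- \<theta>) * norm h powr (p + \<theta>))"
  shows "(spow (barrier i x0 \<rho> x - barrier i x0 \<rho> (x + h)) (p - 1) +
      spow (barrier i x0 \<rho> x - barrier i x0 \<rho> (x - h)) (p - 1)) * kern (p * s) h
    \<le> C * (\<rho> powr (- (real DIM('a) + p * s)) *
      (\<bar>e \<bullet> (h /\<^sub>R \<rho>)\<bar> powr (- \<theta>) * kern (p * s - (p + \<theta>)) (h /\<^sub>R \<rho>)))"
    (is "?D * kern (p * s) h \<le> C * (?r * (\<bar>e \<bullet> ?H\<bar> powr (- \<theta>) * _))")
proof -
  have H: "norm ?H < 1" "e \<bullet> ?H \<noteq> 0" using \<rho> h by (auto simp: field_simps)
  have "?D \<le> sym_spow_diff (p - 1) (norm_power i) ((x - x0) /\<^sub>R \<rho>) ?H"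
    using p \<rho> x by (intro barrier_sym_spow_diff_le) auto
  also have "\<dots> \<le> C * (\<bar>e \<bullet> ?H\<bar> powr (- \<theta>) * norm ?H powr (p + \<theta>))"
    by (rule sym[OF H])
  finally have "?D * kern (p * s) h \<le> C * (\<bar>e \<bullet> ?H\<bar> powr (- \<theta>) * norm ?H powr (p + \<theta>)) * kern (p * s) h"
    by (intro mult_right_mono) auto
  also have "\<dots> = C * (\<bar>e \<bullet> ?H\<bar> powr (- \<theta>) * norm ?H powr (p + \<theta>)) * (?r * kern (p * s) ?H)"
    using kern_scaleR[OF \<rho>, of "p * s" ?H] \<rho> by simp
  also have "\<dots> = C * (?r * (\<bar>e \<bullet> ?H\<bar> powr (- \<theta>) * kern (p * s - (p + \<theta>)) ?H))"
    unfolding norm_powr_mult_kern[symmetric] by (simp only: mult_ac)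
  finally show ?thesis .
qed

lemma barrier_operator_le_directional:
  fixes x0 x e :: "'a::euclidean_space"
  assumes p: "1 < p" and \<rho>: "0 < \<rho>" and x: "x \<in> ball x0 \<rho>" and e: "e \<noteq> 0" and C: "0 \<le> C" and I: "0 \<le> I"
    and sym: "\<And>h. norm h < 1 \<Longrightarrow> e \<bullet> h \<noteq> 0 \<Longrightarrow>
      sym_spow_diff (p - 1) (norm_power i) ((x - x0) /\<^sub>R \<rho>) h
        \<le> C * (\<bar>e \<bullet> h\<bar> powr (- \<theta>) * norm h powr (p + \<theta>))"
    and int: "(\<integral>\<^sup>+ h. ennreal (indicator (ball 0 1) h *
        (\<bar>e \<bullet> h\<bar> powr (- \<theta>) * kern (p * s - (p + \<theta>)) h)) \<partial>lborel) \<le> ennreal I"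
  shows "barrier_operator s p i \<epsilon> x0 \<rho> x \<le> C * I / 2 * \<rho> powr (- (p * s))"
proof -
  define g where "g h = indicator {h. \<epsilon> \<le> norm h \<and> norm h < \<rho>} h *
      (spow (barrier i x0 \<rho> x - barrier i x0 \<rho> (x + h)) (p - 1) * kern (p * s) h)" for h
  define G where "G h = ennreal (indicator (ball 0 1) h *
    (\<bar>e \<bullet> h\<bar> powr (- \<theta>) * kern (p * s - (p + \<theta>)) h))" for h
  have [measurable]: "ball (0::'a) 1 \<in> sets borel" by simp
  have [measurable]: "g \<in> borel_measurable borel" "G \<in> borel_measurable borel"
    unfolding g_def[abs_def] G_def[abs_def] by measurable
  let ?r = "\<rho> powr (- (real DIM('a) + p * s))"
  have pointwise: "ennreal (g h + g (- h))
    \<le> ennreal C * (ennreal ?r * G (h /\<^sub>R \<rho>))" if eh: "e \<bullet> h \<noteq> 0" for h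
  proof (cases "\<epsilon> \<le> norm h \<and> norm h < \<rho>")
    case True
    then have "g h + g (- h) \<le> C * (?r * (\<bar>e \<bullet> (h /\<^sub>R \<rho>)\<bar> powr (- \<theta>) * kern (p * s - (p + \<theta>)) (h /\<^sub>R \<rho>)))"
      using barrier_integrand_symmetrized_le[OF p \<rho> x _ eh sym, of s] by (simp add: g_def distrib_right)
    moreover have "norm (h /\<^sub>R \<rho>) < 1" using True \<rho> by (simp add: field_simps)
    ultimately show ?thesis
      using C by (simp add: G_def ennreal_mult'[symmetric] ennreal_leI del: norm_scaleR)
  next
    case False
    then have "g h + g (- h) = 0" by (simp add: g_def)
    then show ?thesis by simp
  qed
  have "AE h in lborel. ennreal (g h + g (- h)) \<le> ennreal C * (ennreal ?r * G ((h - 0) /\<^sub>R \<rho>))"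
    using AE_lborel_inner_nonzero[OF e] by eventually_elim (use pointwise in simp)
  then have "(\<integral>\<^sup>+ h. ennreal (g h + g (- h)) \<partial>lborel)
    \<le> (\<integral>\<^sup>+ h. ennreal C * (ennreal ?r * G ((h - 0) /\<^sub>R \<rho>)) \<partial>lborel)"
    by (rule nn_integral_mono_AE)
  also have "\<dots> = ennreal C * (ennreal (\<rho> powr (- (p * s))) * (\<integral>\<^sup>+ h. G h \<partial>lborel))"
    using \<rho> by (subst nn_integral_cmult, measurable, subst nn_integral_lborel_kern_scale) auto
  also have "\<dots> \<le> ennreal C * (ennreal (\<rho> powr (- (p * s))) * ennreal I)"
    using int unfolding G_def by (intro mult_left_mono) auto
  also have "\<dots> = ennreal (2 * (C * I / 2 * \<rho> powr (- (p * s))))"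
    using C I by (simp add: ennreal_mult'[symmetric] mult_ac)
  finally have "integral\<^sup>L lborel g \<le> C * I / 2 * \<rho> powr (- (p * s))"
    using C I by (intro integral_le_of_symmetrized) auto
  then show ?thesis by (simp add: barrier_operator_def g_def[abs_def])
qed

lemma barrier_operator_bounded:
  fixes p s :: real
  assumes p: "1 < p" and s: "s < 1" and i: "1 \<le> (2 * real i + 1) * (p - 1)"
  obtains C where "0 \<le> C"
    "\<And>(x0::real^'n) x \<rho> \<epsilon>. 0 < \<rho> \<Longrightarrow> x \<in> ball x0 \<rho> \<Longrightarrow> barrier_operator s p i \<epsilon> x0 \<rho> x \<le> C * \<rho> powr (- (p * s))"
proof -
  define \<theta> where "\<theta> = max 0 (2 - p)"
  have "p * s < p" using p s by simp
  then have \<theta>: "0 \<le> \<theta>" "\<theta> < 1" "p * s - (p + \<theta>) + \<theta> < 0" using p by (auto simp: \<theta>_def)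
  obtain C where C: "0 \<le> C"
      and sym: "\<And>x :: real^'n. norm x < 1 \<Longrightarrow> \<exists>e. norm e = 1 \<and> (\<forall>h. norm h < 1 \<longrightarrow> e \<bullet> h \<noteq> 0 \<longrightarrow>
      sym_spow_diff (p - 1) (norm_power i) x h \<le> C * (\<bar>e \<bullet> h\<bar> powr (- \<theta>) * norm h powr (p + \<theta>)))"
    using sym_spow_diff_norm_power_le[OF p i, where 'a = "real^'n", folded \<theta>_def] by blast
  obtain I where I: "0 \<le> I" and dir: "\<And>e :: real^'n. norm e = 1 \<Longrightarrow> (\<integral>\<^sup>+ h. ennreal (indicator (ball 0 1) h *
      (\<bar>e \<bullet> h\<bar> powr (- \<theta>) * kern (p * s - (p + \<theta>)) h)) \<partial>lborel) \<le> ennreal I"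
    using nn_integral_directional_kern_bounded[OF \<theta>] by blast
  have "barrier_operator s p i \<epsilon> x0 \<rho> x \<le> C * I / 2 * \<rho> powr (- (p * s))"
    if \<rho>: "0 < \<rho>" and x: "x \<in> ball x0 \<rho>" for x0 x :: "real^'n" and \<rho> \<epsilon> :: real
  proof -
    have "norm ((x - x0) /\<^sub>R \<rho>) < 1"
      unfolding norm_centred_scale[OF \<rho>] using x \<rho> by simp
    from sym[OF this] obtain e where e: "norm e = 1" "\<And>h. norm h < 1 \<Longrightarrow> e \<bullet> h \<noteq> 0 \<Longrightarrow>
        sym_spow_diff (p - 1) (norm_power i) ((x - x0) /\<^sub>R \<rho>) h
          \<le> C * (\<bar>e \<bullet> h\<bar> powr (- \<theta>) * norm h powr (p + \<theta>))"
      by blast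
    then have "e \<noteq> 0" by auto
    then show ?thesis
      using barrier_operator_le_directional[OF p \<rho> x _ C I e(2) dir[OF e(1)]] by blast
  qed
  then show ?thesis using that[of "C * I / 2"] C I by auto
qed

section \<open>Exterior corkscrew balls\<close>

definition corkscrew_at :: "'a::metric_space set \<Rightarrow> 'a \<Rightarrow> real \<Rightarrow> bool" where
  "corkscrew_at \<Omega> z \<tau> \<longleftrightarrow> (\<exists>y. dist z y = \<tau> \<and> ball y (\<tau> / 8) \<inter> \<Omega> = {})"

definition exterior_corkscrew :: "real \<Rightarrow> 'a::metric_space set \<Rightarrow> bool" where
  "exterior_corkscrew r \<Omega> \<longleftrightarrow> (\<forall>z\<in>frontier \<Omega>. \<forall>\<tau>. 0 < \<tau> \<longrightarrow> \<tau> < r \<longrightarrow> corkscrew_at \<Omega> z \<tau>)"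

lemma has_derivative_invariant_direction:
  fixes f :: "'a::real_normed_vector \<Rightarrow> 'b::real_normed_vector"
  assumes der: "(f has_derivative D) (at z)" and inv: "\<And>t. f (z + t *\<^sub>R e) = f z"
  shows "D e = 0"
proof -
  have "((\<lambda>t. f (z + t *\<^sub>R e)) has_derivative (\<lambda>s. D (s *\<^sub>R e))) (at 0)"
    by (rule has_derivative_compose[of "\<lambda>t. z + t *\<^sub>R e" "\<lambda>s. s *\<^sub>R e" 0 UNIV f])
       (auto intro!: derivative_eq_intros der)
  moreover have "((\<lambda>t. f (z + t *\<^sub>R e)) has_derivative (\<lambda>s. 0)) (at (0::real))"
    by (simp add: inv)
  ultimately have "(\<lambda>s. D (s *\<^sub>R e)) = (\<lambda>s::real. 0)" by (rule has_derivative_unique)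
  then show ?thesis by (metis scaleR_one)
qed

lemma lipschitz_derivative_taylor:
  fixes \<gamma> :: "'a::real_normed_vector \<Rightarrow> real"
  assumes der: "\<And>z. (\<gamma> has_derivative D z) (at z)"
    and lip: "\<And>z w h. \<bar>D z h - D w h\<bar> \<le> L * norm (z - w) * norm h"
  shows "\<bar>\<gamma> (z + h) - \<gamma> z - D z h\<bar> \<le> \<bar>L\<bar> * (norm h)\<^sup>2"
proof -
  define g where "g t = \<gamma> (z + t *\<^sub>R h) - t * D z h" for t
  have "(g has_real_derivative (D (z + t *\<^sub>R h) h - D z h)) (at t)" for t
  proof -
    have "((\<lambda>t. \<gamma> (z + t *\<^sub>R h)) has_derivative (\<lambda>s. D (z + t *\<^sub>R h) (s *\<^sub>R h))) (at t)"
      by (rule has_derivative_compose[of "\<lambda>t. z + t *\<^sub>R h" "\<lambda>s. s *\<^sub>R h", OF _ der])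
         (auto intro!: derivative_eq_intros)
    moreover have "D (z + t *\<^sub>R h) (s *\<^sub>R h) = s * D (z + t *\<^sub>R h) h" for s
      using has_derivative_linear[OF der[of "z + t *\<^sub>R h"]] by (simp add: linear_scale)
    ultimately have "((\<lambda>t. \<gamma> (z + t *\<^sub>R h)) has_real_derivative D (z + t *\<^sub>R h) h) (at t)"
      by (simp add: has_field_derivative_def mult_commute_abs)
    then show ?thesis unfolding g_def by (auto intro!: derivative_eq_intros)
  qed
  then obtain t where t: "0 < t" "t < 1" "g 1 - g 0 = (1 - 0) * (D (z + t *\<^sub>R h) h - D z h)"
    using MVT2[of 0 1 g "\<lambda>t. D (z + t *\<^sub>R h) h - D z h"] by auto
  have "\<bar>\<gamma> (z + h) - \<gamma> z - D z h\<bar> = \<bar>D (z + t *\<^sub>R h) h - D z h\<bar>"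
    using t(3) by (simp add: g_def)
  also have "\<dots> \<le> L * norm (z + t *\<^sub>R h - z) * norm h" by (rule lip)
  also have "\<dots> \<le> \<bar>L\<bar> * (1 * norm h) * norm h"
    using t mult_right_mono[of t 1 "norm h"] by (auto intro!: mult_right_mono mult_mono)
  finally show ?thesis by (simp add: power2_eq_square)
qed

lemma epigraph_normal_exists:
  fixes D :: "real^'n \<Rightarrow> real"
  assumes "linear D" "D (axis k 1) = 0"
  obtains n where "1 \<le> norm n" "\<And>h. h $ k - D h = h \<bullet> n"
proof -
  define F where "F h = h $ k - D h" for h
  have "linear F"
    unfolding F_def using assms by (intro linear_compose_sub) (auto intro: linearI)
  then have F: "F h = h \<bullet> adjoint F 1" for h
    using adjoint_works[of F h 1] by simp
  have "F (axis k 1) = 1" using assms by (simp add: F_def axis_def)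
  then have "1 \<le> norm (axis k 1 :: real^'n) * norm (adjoint F 1)"
    using F[of "axis k 1"] Cauchy_Schwarz_ineq2[of "axis k 1" "adjoint F 1"] by simp
  then show ?thesis using that[of "adjoint F 1"] F by (simp add: F_def norm_axis_1)
qed

text \<open>The centre is obtained by moving the distance \<open>\<tau>\<close> against the normal of the graph.\<close>
lemma epigraph_exterior_ball:
  fixes \<gamma> :: "real^'n \<Rightarrow> real"
  assumes inv: "\<And>z. \<gamma> z = \<gamma> (z + (- (z $ k)) *\<^sub>R axis k (1::real))"
    and der: "\<And>z. (\<gamma> has_derivative D z) (at z)"
    and lip: "\<And>z w h. \<bar>D z h - D w h\<bar> \<le> L * norm (z - w) * norm h"
    and z: "z $ k \<le> \<gamma> z" and \<tau>: "0 < \<tau>" "\<bar>L\<bar> * \<tau> \<le> 1 / 2"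
  obtains w where "norm w = \<tau>" "\<And>b. norm b < \<tau> / 8 \<Longrightarrow> (z + w + b) $ k \<le> \<gamma> (z + w + b)"
proof -
  have "\<gamma> (z + t *\<^sub>R axis k 1) = \<gamma> z" for t
    using inv[of "z + t *\<^sub>R axis k 1"] inv[of z] by (simp add: algebra_simps axis_def)
  then have "D z (axis k 1) = 0" by (rule has_derivative_invariant_direction[OF der])
  then obtain n where n: "1 \<le> norm n" "\<And>h. h $ k - D z h = h \<bullet> n"
    using epigraph_normal_exists[OF has_derivative_linear[OF der[of z]]] by blast
  define w where "w = (- \<tau> / norm n) *\<^sub>R n"
  have w: "norm w = \<tau>" "w \<bullet> n = - \<tau> * norm n"
    using n(1) \<tau> by (auto simp: w_def dot_square_norm power2_eq_square)
  have "(z + w + b) $ k \<le> \<gamma> (z + w + b)" if b: "norm b < \<tau> / 8" for b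
  proof -
    let ?h = "w + b"
    have "b \<bullet> n \<le> norm b * norm n" by (rule norm_cauchy_schwarz)
    also have "\<dots> \<le> \<tau> / 8 * norm n" using b by (intro mult_right_mono) auto
    finally have "?h \<bullet> n \<le> - (7 / 8 * \<tau>) * norm n" using w by (simp add: inner_add_left)
    also have "\<dots> \<le> - (7 / 8 * \<tau>)" using n \<tau> by (simp add: mult_le_cancel_left1)
    finally have normal: "?h \<bullet> n \<le> - (7 / 8 * \<tau>)" .
    have "norm ?h \<le> 9 / 8 * \<tau>" using norm_triangle_ineq[of w b] w b by simp
    then have "\<bar>L\<bar> * (norm ?h)\<^sup>2 \<le> \<bar>L\<bar> * (9 / 8 * \<tau>)\<^sup>2" by (intro mult_left_mono power_mono) auto
    also have "\<dots> = (\<bar>L\<bar> * \<tau>) * (81 / 64 * \<tau>)" by (simp add: power2_eq_square)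
    also have "\<dots> \<le> 1 / 2 * (81 / 64 * \<tau>)" using \<tau> by (intro mult_right_mono) auto
    also have "\<dots> \<le> 7 / 8 * \<tau>" using \<tau> by simp
    finally have remainder: "\<bar>L\<bar> * (norm ?h)\<^sup>2 \<le> 7 / 8 * \<tau>" .
    have "\<gamma> (z + ?h) \<ge> \<gamma> z + D z ?h - \<bar>L\<bar> * (norm ?h)\<^sup>2"
      using lipschitz_derivative_taylor[of \<gamma> D L z ?h, OF der lip] by linarith
    moreover have "(z + ?h) $ k = z $ k + ?h \<bullet> n + D z ?h" using n(2)[of ?h] by simp
    ultimately show ?thesis using normal remainder z by (simp add: add.assoc)
  qed
  with w(1) show ?thesis by (rule that)
qed

lemma epigraph_chart_corkscrew:
  fixes \<Omega> :: "(real^'n) set" and R :: "real^'n \<Rightarrow> real^'n"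
  assumes R: "orthogonal_transformation R"
    and inv: "\<And>z. \<gamma> z = \<gamma> (z + (- (z $ k)) *\<^sub>R axis k (1::real))"
    and der: "\<And>z. (\<gamma> has_derivative D z) (at z)"
    and lip: "\<And>z w h. \<bar>D z h - D w h\<bar> \<le> L * norm (z - w) * norm h"
    and chart: "\<Omega> \<inter> ball x0 r = {x \<in> ball x0 r. R (x - x0) $ k > \<gamma> (R (x - x0))}"
    and z: "z \<in> ball x0 (r / 2)" "z \<notin> \<Omega>" and \<tau>: "0 < \<tau>" "\<tau> < r / 4" "\<bar>L\<bar> * \<tau> \<le> 1 / 2"
  shows "corkscrew_at \<Omega> z \<tau>"
proof -
  have "dist x0 z < r / 2" using z by simp
  then have "z \<in> ball x0 r" using zero_le_dist[of x0 z] unfolding mem_ball by linarith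
  then have "R (z - x0) $ k \<le> \<gamma> (R (z - x0))" using chart z by force
  from epigraph_exterior_ball[OF inv der lip this \<tau>(1,3)] obtain w where w: "norm w = \<tau>"
    "\<And>b. norm b < \<tau> / 8 \<Longrightarrow> (R (z - x0) + w + b) $ k \<le> \<gamma> (R (z - x0) + w + b)" by blast
  obtain v where v: "R v = w" using orthogonal_transformation_surj[OF R] by (metis surjD)
  then have nv: "norm v = \<tau>" using w orthogonal_transformation_norm[OF R, of v] by simp
  have "x \<notin> \<Omega>" if x: "x \<in> ball (z + v) (\<tau> / 8)" for x
  proof
    assume "x \<in> \<Omega>"
    define b where "b = x - (z + v)"
    have nb: "norm b < \<tau> / 8" using x by (simp add: b_def dist_norm norm_minus_commute)
    have "norm (x - x0) \<le> norm (z - x0) + norm v + norm b"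
      using norm_triangle_ineq[of "z - x0 + v" b] norm_triangle_ineq[of "z - x0" v] by (simp add: b_def)
    then have "x \<in> ball x0 r" using nb nv z \<tau> by (simp add: dist_norm norm_minus_commute)
    then have "R (x - x0) $ k > \<gamma> (R (x - x0))" using chart \<open>x \<in> \<Omega>\<close> by blast
    moreover have "R (x - x0) = R ((z - x0) + v + b)" by (simp add: b_def)
    then have "R (x - x0) = R (z - x0) + w + R b"
      using v by (simp add: linear_add[OF orthogonal_transformation_linear[OF R]])
    ultimately show False
      using w(2)[of "R b"] nb orthogonal_transformation_norm[OF R, of b] by simp
  qed
  then show ?thesis unfolding corkscrew_at_def by (intro exI[of _ "z + v"]) (auto simp: dist_norm nv)
qed

lemma compact_uniform_threshold:
  fixes K :: "'a::metric_space set" and P :: "'a \<Rightarrow> real \<Rightarrow> bool"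
  assumes K: "compact K"
    and local: "\<And>x. x \<in> K \<Longrightarrow> \<exists>r>0. \<exists>\<delta>>0. \<forall>z\<in>K \<inter> ball x r. \<forall>\<tau>. 0 < \<tau> \<longrightarrow> \<tau> < \<delta> \<longrightarrow> P z \<tau>"
  shows "\<exists>\<delta>>0. \<forall>z\<in>K. \<forall>\<tau>. 0 < \<tau> \<longrightarrow> \<tau> < \<delta> \<longrightarrow> P z \<tau>"
proof -
  obtain r \<delta> where rd: "\<And>x. x \<in> K \<Longrightarrow> 0 < r x \<and> 0 < \<delta> x \<and>
      (\<forall>z\<in>K \<inter> ball x (r x). \<forall>\<tau>. 0 < \<tau> \<longrightarrow> \<tau> < \<delta> x \<longrightarrow> P z \<tau>)"
    using local by metis
  obtain F where F: "F \<subseteq> K" "finite F" "K \<subseteq> (\<Union>x\<in>F. ball x (r x))"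
    by (rule compactE_image[OF K, of K "\<lambda>x. ball x (r x)"]) (use rd in auto)
  define \<delta>\<^sub>0 where "\<delta>\<^sub>0 = Min (insert 1 (\<delta> ` F))"
  have "0 < \<delta>\<^sub>0" unfolding \<delta>\<^sub>0_def using F rd by (subst Min_gr_iff) auto
  moreover have "P z \<tau>" if "z \<in> K" and \<tau>: "0 < \<tau>" "\<tau> < \<delta>\<^sub>0" for z \<tau>
  proof -
    obtain x where x: "x \<in> F" "z \<in> ball x (r x)" using F \<open>z \<in> K\<close> by blast
    have "\<delta>\<^sub>0 \<le> \<delta> x" unfolding \<delta>\<^sub>0_def using F x by (intro Min_le) auto
    then show ?thesis using rd[of x] F x \<open>z \<in> K\<close> \<tau> by auto
  qed
  ultimately show ?thesis by blast
qed

lemma C11_domain_exterior_corkscrew: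
  fixes \<Omega> :: "(real^'n) set"
  assumes \<Omega>: "C11_domain \<Omega>"
  obtains r where "0 < r" "exterior_corkscrew r \<Omega>"
proof -
  have "open \<Omega>" "bounded \<Omega>" using \<Omega> by (auto simp: C11_domain_def)
  have "\<exists>r>0. \<exists>\<delta>>0. \<forall>z\<in>frontier \<Omega> \<inter> ball x0 r. \<forall>\<tau>. 0 < \<tau> \<longrightarrow> \<tau> < \<delta> \<longrightarrow> corkscrew_at \<Omega> z \<tau>"
    if x0: "x0 \<in> frontier \<Omega>" for x0
  proof -
    obtain r R k \<gamma> D L where r: "0 < r" and R: "orthogonal_transformation (R :: real^'n \<Rightarrow> real^'n)"
      and inv: "\<forall>z. \<gamma> z = \<gamma> (z + (- (z $ k)) *\<^sub>R axis k (1::real))"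
      and der: "\<forall>z. (\<gamma> has_derivative D z) (at z)"
      and lip: "\<forall>z w h. \<bar>D z h - D w h\<bar> \<le> L * norm (z - w) * norm h"
      and chart: "\<Omega> \<inter> ball x0 r = {x \<in> ball x0 r. R (x - x0) $ k > \<gamma> (R (x - x0))}"
      using \<Omega>[unfolded C11_domain_def] x0 by (elim conjE) (drule (1) bspec, elim exE conjE, rule that)
    have "corkscrew_at \<Omega> z \<tau>"
      if z: "z \<in> frontier \<Omega>" "z \<in> ball x0 (r / 2)"
          and \<tau>: "0 < \<tau>" "\<tau> < min (r / 4) (1 / (2 * (\<bar>L\<bar> + 1)))" for z \<tau>
    proof (rule epigraph_chart_corkscrew[OF R inv[rule_format] der[rule_format]
        lip[rule_format] chart z(2)])
      show "z \<notin> \<Omega>" using z \<open>open \<Omega>\<close> by (simp add: frontier_def interior_open)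
      have "\<bar>L\<bar> * \<tau> \<le> \<bar>L\<bar> * (1 / (2 * (\<bar>L\<bar> + 1)))"
        using \<tau> by (intro mult_left_mono) auto
      also have "\<dots> \<le> 1 / 2" by (simp add: field_simps)
      finally show "\<bar>L\<bar> * \<tau> \<le> 1 / 2" .
    qed (use \<tau> in auto)
    then show ?thesis
      using r by (intro exI[of _ "r / 2"] conjI exI[of _ "min (r / 4) (1 / (2 * (\<bar>L\<bar> + 1)))"]) auto
  qed
  from compact_uniform_threshold[OF compact_frontier_bounded[OF \<open>bounded \<Omega>\<close>] this] show ?thesis
    using that unfolding exterior_corkscrew_def by blast
qed

section \<open>Hoelder continuous representatives\<close>

definition holder_on :: "real \<Rightarrow> real \<Rightarrow> 'a::metric_space set \<Rightarrow> ('a \<Rightarrow> 'b::metric_space) \<Rightarrow> bool" where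
  "holder_on H \<alpha> S u \<longleftrightarrow> (\<forall>x\<in>S. \<forall>y\<in>S. dist (u x) (u y) \<le> H * dist x y powr \<alpha>)"

lemma holder_on_imp_uniformly_continuous_on:
  assumes \<alpha>: "0 < \<alpha>" and u: "holder_on H \<alpha> S u"
  shows "uniformly_continuous_on S u"
  unfolding uniformly_continuous_on_def
proof (intro allI impI)
  fix \<epsilon> :: real assume \<epsilon>: "\<epsilon> > 0"
  define d where "d = (\<epsilon> / (\<bar>H\<bar> + 1)) powr (1 / \<alpha>)"
  have "d > 0" using \<epsilon> by (simp add: d_def)
  moreover have "dist (u x') (u x) < \<epsilon>" if "x \<in> S" "x' \<in> S" "dist x' x < d" for x x'
  proof -
    have "dist (u x') (u x) \<le> \<bar>H\<bar> * dist x' x powr \<alpha>"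
      using u that mult_right_mono[of H "\<bar>H\<bar>" "dist x' x powr \<alpha>"] unfolding holder_on_def by fastforce
    also have "dist x' x powr \<alpha> \<le> d powr \<alpha>" using that \<alpha> by (intro powr_mono2) auto
    also have "d powr \<alpha> = \<epsilon> / (\<bar>H\<bar> + 1)" using \<alpha> \<epsilon> by (simp add: d_def powr_powr)
    also have "\<bar>H\<bar> * (\<epsilon> / (\<bar>H\<bar> + 1)) < \<epsilon>" using \<epsilon> by (simp add: field_simps)
    finally show ?thesis by (simp add: mult_left_mono)
  qed
  ultimately show "\<exists>d>0. \<forall>x\<in>S. \<forall>x'\<in>S. dist x' x < d \<longrightarrow> dist (u x') (u x) < \<epsilon>" by blast
qed

lemma holder_on_closure:
  assumes \<alpha>: "0 < \<alpha>" and v: "holder_on H \<alpha> S v" and cont: "continuous_on (closure S) v"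
  shows "holder_on H \<alpha> (closure S) v"
  unfolding holder_on_def
proof (intro ballI)
  fix x y assume xy: "x \<in> closure S" "y \<in> closure S"
  then obtain X Y where X: "\<And>n. X n \<in> S" "X \<longlonglongrightarrow> x" and Y: "\<And>n. Y n \<in> S" "Y \<longlonglongrightarrow> y"
    by (metis closure_sequential)
  have XY: "\<And>n. X n \<in> closure S" "\<And>n. Y n \<in> closure S" using X Y closure_subset by blast+
  show "dist (v x) (v y) \<le> H * dist x y powr \<alpha>"
  proof (rule LIMSEQ_le)
    show "(\<lambda>n. dist (v (X n)) (v (Y n))) \<longlonglongrightarrow> dist (v x) (v y)"
      using cont X Y XY xy by (intro tendsto_dist) (auto simp: continuous_on_sequentially o_def)
    show "(\<lambda>n. H * dist (X n) (Y n) powr \<alpha>) \<longlonglongrightarrow> H * dist x y powr \<alpha>"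
      using X Y \<alpha> by (intro tendsto_mult tendsto_const tendsto_powr2 tendsto_dist) auto
    show "\<exists>N. \<forall>n\<ge>N. dist (v (X n)) (v (Y n)) \<le> H * dist (X n) (Y n) powr \<alpha>"
      using v X Y unfolding holder_on_def by blast
  qed
qed

lemma holder_on_extension:
  fixes u :: "'a::metric_space \<Rightarrow> 'b::complete_space"
  assumes \<alpha>: "0 < \<alpha>" and u: "holder_on H \<alpha> S u"
  obtains v where "continuous_on (closure S) v" "holder_on H \<alpha> (closure S) v" "\<And>x. x \<in> S \<Longrightarrow> u x = v x"
proof -
  obtain v where v: "uniformly_continuous_on (closure S) v" "\<And>x. x \<in> S \<Longrightarrow> u x = v x"
    using uniformly_continuous_on_extension_on_closure[OF holder_on_imp_uniformly_continuous_on[OF assms]]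
    by metis
  have cont: "continuous_on (closure S) v"
    using v(1) by (rule uniformly_continuous_imp_continuous)
  have "holder_on H \<alpha> S v" using u v(2) by (simp add: holder_on_def)
  with cont that[OF cont _ v(2)] holder_on_closure[OF \<alpha>] show ?thesis by blast
qed

lemma geometric_scale_exists:
  fixes d r \<kappa> :: real
  assumes "0 < \<kappa>" "\<kappa> < 1" "0 < d" "d < r"
  obtains j where "r * \<kappa> ^ Suc j \<le> d" "d < r * \<kappa> ^ j"
proof -
  have "(\<lambda>j. r * \<kappa> ^ j) \<longlonglongrightarrow> r * 0"
    using assms by (intro tendsto_intros LIMSEQ_realpow_zero) auto
  then have "\<forall>\<^sub>F j in sequentially. r * \<kappa> ^ j < d"
    using assms by (intro order_tendstoD(2)) auto
  then obtain n where "r * \<kappa> ^ n < d" by (auto simp: eventually_sequentially)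
  moreover have "\<not> r * \<kappa> ^ 0 \<le> d" using assms by simp
  ultimately obtain j where "\<not> r * \<kappa> ^ j \<le> d" "r * \<kappa> ^ Suc j \<le> d"
    using ex_least_nat_less[of "\<lambda>j. r * \<kappa> ^ j \<le> d" n] by auto
  then show ?thesis using that by force
qed

lemma closure_point_near_pair:
  fixes x y :: "'a::metric_space"
  assumes "x \<in> closure Q" "dist x y < r"
  obtains q where "q \<in> Q" "x \<in> ball q r" "y \<in> ball q r"
proof -
  from assms obtain q where q: "q \<in> Q" "dist q x < r - dist x y"
    by (meson closure_approachable diff_gt_0_iff_gt)
  moreover have "dist q y \<le> dist q x + dist x y" by (rule dist_triangle)
  ultimately show ?thesis using that[of q] zero_le_dist[of x y] by auto
qed

lemma holder_on_of_oscillation: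
  fixes u :: "'a::metric_space \<Rightarrow> real"
  assumes \<kappa>: "0 < \<kappa>" "\<kappa> < 1" and \<alpha>: "0 < \<alpha>" and r: "0 < r" and \<Lambda>: "0 \<le> \<Lambda>"
    and dense: "S \<subseteq> closure Q"
    and osc: "\<And>q j. q \<in> Q \<Longrightarrow> \<exists>m. \<forall>x\<in>S \<inter> ball q (r * \<kappa> ^ j). m \<le> u x \<and> u x \<le> m + \<Lambda> * (\<kappa> ^ j) powr \<alpha>"
    and bound: "\<And>x. x \<in> S \<Longrightarrow> \<bar>u x\<bar> \<le> \<Lambda> / 2"
  shows "holder_on (\<Lambda> * (1 / (\<kappa> * r)) powr \<alpha>) \<alpha> S u"
  unfolding holder_on_def
proof (intro ballI)
  fix x y assume x: "x \<in> S" and y: "y \<in> S"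
  have "\<bar>u x - u y\<bar> \<le> \<Lambda> * (1 / (\<kappa> * r) * dist x y) powr \<alpha>"
  proof (cases "x = y")
    case False
    then have d: "0 < dist x y" by simp
    show ?thesis
    proof (cases "dist x y < r")
      case True
      obtain j where j: "r * \<kappa> ^ Suc j \<le> dist x y" "dist x y < r * \<kappa> ^ j"
        using geometric_scale_exists[OF \<kappa> d True] by blast
      obtain q where q: "q \<in> Q" "x \<in> ball q (r * \<kappa> ^ j)" "y \<in> ball q (r * \<kappa> ^ j)"
        using closure_point_near_pair[OF subsetD[OF dense x] j(2)] .
      obtain m where "\<forall>x\<in>S \<inter> ball q (r * \<kappa> ^ j). m \<le> u x \<and> u x \<le> m + \<Lambda> * (\<kappa> ^ j) powr \<alpha>"
        using osc[OF q(1)] by blast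
      then have "m \<le> u x" "u x \<le> m + \<Lambda> * (\<kappa> ^ j) powr \<alpha>" "m \<le> u y" "u y \<le> m + \<Lambda> * (\<kappa> ^ j) powr \<alpha>"
        using x y q by blast+
      then have "\<bar>u x - u y\<bar> \<le> \<Lambda> * (\<kappa> ^ j) powr \<alpha>" by linarith
      also have "(\<kappa> ^ j) powr \<alpha> \<le> (1 / (\<kappa> * r) * dist x y) powr \<alpha>"
        using j(1) r \<kappa> \<alpha> by (intro powr_mono2) (auto simp: field_simps)
      finally show ?thesis using \<Lambda> by (simp add: mult_left_mono)
    next
      case False
      have "\<kappa> * r \<le> 1 * r" using \<kappa> r by (intro mult_right_mono) auto
      then have "\<kappa> * r \<le> dist x y" using False by linarith
      then have "1 \<le> (1 / (\<kappa> * r) * dist x y) powr \<alpha>"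
        using r \<kappa> \<alpha> by (intro ge_one_powr_ge_zero) (auto simp: field_simps)
      then have "\<Lambda> * 1 \<le> \<Lambda> * (1 / (\<kappa> * r) * dist x y) powr \<alpha>" using \<Lambda> by (intro mult_left_mono)
      then show ?thesis using bound[OF x] bound[OF y] by linarith
    qed
  qed simp
  also have "\<dots> = \<Lambda> * (1 / (\<kappa> * r)) powr \<alpha> * dist x y powr \<alpha>"
    by (simp only: powr_mult mult.assoc)
  finally show "dist (u x) (u y) \<le> \<Lambda> * (1 / (\<kappa> * r)) powr \<alpha> * dist x y powr \<alpha>"
    by (simp add: dist_real_def)
qed

lemma closure_diff_null_set:
  fixes \<Omega> :: "'a::euclidean_space set"
  assumes \<Omega>: "open \<Omega>" and Z: "Z \<in> null_sets lebesgue"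
  shows "closure (closure \<Omega> - Z) = closure \<Omega>"
proof
  show "closure (closure \<Omega> - Z) \<subseteq> closure \<Omega>" by (intro closure_minimal) auto
  have "\<Omega> \<subseteq> closure (closure \<Omega> - Z)"
  proof
    fix x assume x: "x \<in> \<Omega>"
    show "x \<in> closure (closure \<Omega> - Z)"
      unfolding closure_approachable
    proof (intro allI impI)
      fix \<epsilon> :: real assume "\<epsilon> > 0"
      then have "\<not> negligible (\<Omega> \<inter> ball x \<epsilon>)" using \<Omega> x by (intro open_not_negligible) auto
      then have "\<not> \<Omega> \<inter> ball x \<epsilon> \<subseteq> Z" using Z by (meson negligible_iff_null_sets negligible_subset)
      then obtain y where "y \<in> \<Omega> \<inter> ball x \<epsilon>" "y \<notin> Z" by blast
      then show "\<exists>y\<in>closure \<Omega> - Z. dist y x < \<epsilon>"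
        using closure_subset[of \<Omega>] by (intro bexI[of _ y]) (auto simp: dist_commute)
    qed
  qed
  then show "closure \<Omega> \<subseteq> closure (closure \<Omega> - Z)" by (rule closure_minimal) simp
qed

definition ess_osc_le :: "'a::euclidean_space set \<Rightarrow> ('a \<Rightarrow> real) \<Rightarrow> real \<Rightarrow> bool" where
  "ess_osc_le S u \<omega> \<longleftrightarrow> (\<exists>m. AE x in lebesgue. x \<in> S \<longrightarrow> m \<le> u x \<and> u x \<le> m + \<omega>)"

text \<open>Off a null set, \<open>u\<close> satisfies the oscillation bound on all balls of a countable family.\<close>
lemma oscillation_decay_imp_holder:
  fixes u :: "'a::euclidean_space \<Rightarrow> real"
  assumes \<Omega>: "open \<Omega>" and \<kappa>: "0 < \<kappa>" "\<kappa> < 1" and \<alpha>: "0 < \<alpha>" and r: "0 < r" and \<Lambda>: "0 \<le> \<Lambda>"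
    and osc: "\<And>x0 j. x0 \<in> closure \<Omega> \<Longrightarrow> ess_osc_le (ball x0 (r * \<kappa> ^ j)) u (\<Lambda> * (\<kappa> ^ j) powr \<alpha>)"
    and bound: "AE x in lebesgue. \<bar>u x\<bar> \<le> \<Lambda> / 2"
  obtains v where "AE x in lebesgue. x \<in> closure \<Omega> \<longrightarrow> u x = v x" "continuous_on (closure \<Omega>) v"
    "holder_on (\<Lambda> * (1 / (\<kappa> * r)) powr \<alpha>) \<alpha> (closure \<Omega>) v"
proof -
  obtain Q where Q: "countable Q" "Q \<subseteq> closure \<Omega>" "closure \<Omega> \<subseteq> closure Q"
    using separable[of "closure \<Omega>"] by blast
  have "\<forall>q\<in>Q. \<forall>j. ess_osc_le (ball q (r * \<kappa> ^ j)) u (\<Lambda> * (\<kappa> ^ j) powr \<alpha>)"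
    using osc Q by blast
  then obtain m where m: "\<forall>q\<in>Q. \<forall>j. AE x in lebesgue. x \<in> ball q (r * \<kappa> ^ j) \<longrightarrow>
      m q j \<le> u x \<and> u x \<le> m q j + \<Lambda> * (\<kappa> ^ j) powr \<alpha>"
    unfolding ess_osc_le_def choice_iff bchoice_iff by blast
  have "AE x in lebesgue. \<forall>q\<in>Q. \<forall>j. x \<in> ball q (r * \<kappa> ^ j) \<longrightarrow>
      m q j \<le> u x \<and> u x \<le> m q j + \<Lambda> * (\<kappa> ^ j) powr \<alpha>"
    using Q(1) m by (simp add: AE_ball_countable AE_all_countable)
  with bound have "AE x in lebesgue. \<bar>u x\<bar> \<le> \<Lambda> / 2 \<and> (\<forall>q\<in>Q. \<forall>j. x \<in> ball q (r * \<kappa> ^ j) \<longrightarrow>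
      m q j \<le> u x \<and> u x \<le> m q j + \<Lambda> * (\<kappa> ^ j) powr \<alpha>)"
    by eventually_elim blast
  then obtain Z where Z: "Z \<in> null_sets lebesgue"
    and off_Z: "\<And>x. x \<notin> Z \<Longrightarrow> \<bar>u x\<bar> \<le> \<Lambda> / 2 \<and> (\<forall>q\<in>Q. \<forall>j. x \<in> ball q (r * \<kappa> ^ j) \<longrightarrow>
      m q j \<le> u x \<and> u x \<le> m q j + \<Lambda> * (\<kappa> ^ j) powr \<alpha>)"
    by (rule AE_E3) auto
  have "holder_on (\<Lambda> * (1 / (\<kappa> * r)) powr \<alpha>) \<alpha> (closure \<Omega> - Z) u"
  proof (rule holder_on_of_oscillation[OF \<kappa> \<alpha> r \<Lambda>, of _ Q])
    show "\<exists>m. \<forall>x\<in>(closure \<Omega> - Z) \<inter> ball q (r * \<kappa> ^ j). m \<le> u x \<and> u x \<le> m + \<Lambda> * (\<kappa> ^ j) powr \<alpha>"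
      if "q \<in> Q" for q j
      using off_Z that by (intro exI[of _ "m q j"]) auto
  qed (use Q off_Z in auto)
  then obtain v where v: "continuous_on (closure \<Omega>) v"
    "holder_on (\<Lambda> * (1 / (\<kappa> * r)) powr \<alpha>) \<alpha> (closure \<Omega>) v"
    "\<And>x. x \<in> closure \<Omega> - Z \<Longrightarrow> u x = v x"
    using holder_on_extension[OF \<alpha>] closure_diff_null_set[OF \<Omega> Z] by metis
  moreover have "AE x in lebesgue. x \<in> closure \<Omega> \<longrightarrow> u x = v x"
    using Z by (rule AE_I') (use v(3) in auto)
  ultimately show ?thesis using that by blast
qed

lemma holder_on_imp_holder_space:
  assumes v: "continuous_on K v" "holder_on H \<alpha> K v" and K: "x \<in> K" "y \<in> K" "x \<noteq> y"
  shows "v \<in> holder_space K \<alpha>" "holder_seminorm K \<alpha> v \<le> H"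
proof -
  have le: "t \<le> H" if "t \<in> holder_quotients K \<alpha> v" for t
    using that v(2) by (auto simp: holder_quotients_def holder_on_def dist_real_def divide_le_eq)
  then have "bdd_above (holder_quotients K \<alpha> v)" by (rule bdd_aboveI)
  then show "v \<in> holder_space K \<alpha>" using v by (simp add: holder_space_def)
  have "holder_quotients K \<alpha> v \<noteq> {}" using K by (auto simp: holder_quotients_def)
  then show "holder_seminorm K \<alpha> v \<le> H" unfolding holder_seminorm_def using le by (rule cSup_least)
qed

section \<open>The Gagliardo energy\<close>

subsection \<open>Lebesgue measure on pairs\<close>

lemma (in sigma_finite_measure) sigma_finite_measure_completion: "sigma_finite_measure (completion M)"
proof -
  obtain A :: "nat \<Rightarrow> 'a set" where A: "range A \<subseteq> sets M" "(\<Union>i. A i) = space M" "\<And>i. emeasure M (A i) \<noteq> \<infinity>"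
    using sigma_finite by blast
  show ?thesis
  proof (standard, intro exI[of _ "range A"] conjI ballI)
    show "range A \<subseteq> sets (completion M)" using A(1) by auto
    show "\<Union> (range A) = space (completion M)" using A(2) by simp
    fix a assume "a \<in> range A"
    then show "emeasure (completion M) a \<noteq> \<infinity>" using A(1,3) by auto
  qed simp
qed

lemma (in sigma_finite_measure) AE_pair_measure_same:
  assumes "AE x in M. P x"
  shows "AE z in M \<Otimes>\<^sub>M M. P (fst z) \<and> P (snd z)"
proof -
  obtain N where N: "\<And>x. x \<in> space M - N \<Longrightarrow> P x" "N \<in> null_sets M"
    using assms by (rule AE_E3) blast
  then have "N \<times> space M \<union> space M \<times> N \<in> null_sets (M \<Otimes>\<^sub>M M)"
    using emeasure_pair_measure_Times[of N M "space M"] emeasure_pair_measure_Times[of "space M" M N]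
    by (intro null_sets.Un) (auto simp: null_sets_def)
  then show ?thesis
    by (rule AE_I') (use N(1) in \<open>force simp: space_pair_measure\<close>)
qed

interpretation lebesgue: sigma_finite_measure lebesgue
  by (rule lborel.sigma_finite_measure_completion)

interpretation lebesgue_pair: pair_sigma_finite lebesgue lebesgue ..

abbreviation leb2 :: "('a::euclidean_space \<times> 'a) measure" where
  "leb2 \<equiv> lebesgue \<Otimes>\<^sub>M lebesgue"

lemma measurable_fst_lebesgue:
  "u \<in> borel_measurable lebesgue \<Longrightarrow> (\<lambda>z. u (fst z)) \<in> borel_measurable (lebesgue \<Otimes>\<^sub>M N)"
  by (rule measurable_compose[OF measurable_fst])

lemma measurable_snd_lebesgue:
  "u \<in> borel_measurable lebesgue \<Longrightarrow> (\<lambda>z. u (snd z)) \<in> borel_measurable (N \<Otimes>\<^sub>M lebesgue)"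
  by (rule measurable_compose[OF measurable_snd])

lemma measurable_diff_lebesgue [measurable]:
  "(\<lambda>z. fst z - snd z :: 'a::euclidean_space) \<in> borel_measurable leb2"
  by (intro borel_measurable_diff measurable_fst_lebesgue measurable_snd_lebesgue measurable_completion)
      simp_all

lemma nn_integral_lebesgue_reflect:
  fixes g :: "'a::euclidean_space \<Rightarrow> ennreal"
  assumes [measurable]: "g \<in> borel_measurable borel"
  shows "(\<integral>\<^sup>+ y. g (x - y) \<partial>lebesgue) = (\<integral>\<^sup>+ h. g h \<partial>lborel)"
  by (simp add: nn_integral_completion nn_integral_lborel_reflect)

lemma nn_integral_leb2_convolution:
  fixes g :: "'a::euclidean_space \<Rightarrow> ennreal"
  assumes [measurable]: "a \<in> borel_measurable lebesgue" "g \<in> borel_measurable borel"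
  shows "(\<integral>\<^sup>+ z. a (fst z) * g (fst z - snd z) \<partial>leb2) = (\<integral>\<^sup>+ x. a x \<partial>lebesgue) * (\<integral>\<^sup>+ h. g h \<partial>lborel)"
proof -
  have m: "(\<lambda>z. a (fst z) * g (fst z - snd z)) \<in> borel_measurable leb2"
    using measurable_compose[OF measurable_diff_lebesgue, of g borel] by measurable
  have "(\<lambda>y. g (x - y)) \<in> borel_measurable lebesgue" for x
    by (rule measurable_completion) measurable
  then have "(\<integral>\<^sup>+ y. a x * g (x - y) \<partial>lebesgue) = a x * (\<integral>\<^sup>+ h. g h \<partial>lborel)" for x
    by (subst nn_integral_cmult) (simp_all add: nn_integral_lebesgue_reflect)
  then show ?thesis
    using lebesgue.nn_integral_fst[OF m] by (simp add: nn_integral_multc)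
qed

lemma nn_integral_leb2_swap:
  fixes f :: "'a::euclidean_space \<times> 'a \<Rightarrow> ennreal"
  assumes f: "f \<in> borel_measurable leb2"
  shows "(\<integral>\<^sup>+ z. f (snd z, fst z) \<partial>leb2) = (\<integral>\<^sup>+ z. f z \<partial>leb2)"
  by (subst (2) lebesgue_pair.distr_pair_swap, subst nn_integral_distr[OF measurable_pair_swap'])
     (use f in \<open>simp_all add: case_prod_beta\<close>)

subsection \<open>Energies and the space of test functions\<close>

definition energy_integrand ::
  "real \<Rightarrow> real \<Rightarrow> (real^'n \<Rightarrow> real) \<Rightarrow> (real^'n \<Rightarrow> real) \<Rightarrow> (real^'n) \<times> (real^'n) \<Rightarrow> real" where
  "energy_integrand s p u \<phi> z =
     spow (u (fst z) - u (snd z)) (p - 1) * (\<phi> (fst z) - \<phi> (snd z)) * kern (p * s) (fst z - snd z)"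

definition energy :: "real \<Rightarrow> real \<Rightarrow> (real^'n \<Rightarrow> real) \<Rightarrow> (real^'n \<Rightarrow> real) \<Rightarrow> real" where
  "energy s p u \<phi> = integral\<^sup>L leb2 (energy_integrand s p u \<phi>)"

lemma weak_solution_iff:
  "weak_solution s p \<Omega> f u \<longleftrightarrow> u \<in> W0 s p \<Omega> \<and> (\<forall>\<phi> \<in> W0 s p \<Omega>. energy s p u \<phi> = (\<integral>x\<in>\<Omega>. f x * \<phi> x \<partial>lebesgue))"
  by (simp add: weak_solution_def energy_def energy_integrand_def[abs_def] kern_def powr_minus_divide
      del: powr_minus minus_add_distrib)

lemma gagliardo_eq:
  "gagliardo s p u = (\<integral>\<^sup>+ z. ennreal (\<bar>u (fst z) - u (snd z)\<bar> powr p * kern (p * s) (fst z - snd z)) \<partial>leb2)"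
  by (simp add: gagliardo_def kern_def powr_minus_divide del: minus_add_distrib)

lemma energy_integrand_measurable [measurable]:
  assumes [measurable]: "u \<in> borel_measurable lebesgue" "\<phi> \<in> borel_measurable lebesgue"
  shows "energy_integrand s p u \<phi> \<in> borel_measurable leb2"
  unfolding energy_integrand_def[abs_def] by measurable

lemma abs_spow_mult_le:
  assumes "1 < p"
  shows "\<bar>spow a (p - 1) * b\<bar> \<le> \<bar>a\<bar> powr p + \<bar>b\<bar> powr p"
proof -
  define c where "c = max \<bar>a\<bar> \<bar>b\<bar>"
  have "\<bar>spow a (p - 1) * b\<bar> = \<bar>b\<bar> * \<bar>a\<bar> powr (p - 1)" by (simp add: abs_mult abs_spow)
  also have "\<dots> \<le> c * c powr (p - 1)" using assms by (intro mult_mono powr_mono2) (auto simp: c_def)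
  also have "\<dots> = c powr p" using powr_eq_mult_powr[of c p] by (simp add: c_def)
  also have "\<dots> \<le> \<bar>a\<bar> powr p + \<bar>b\<bar> powr p" by (auto simp: c_def max_def)
  finally show ?thesis .
qed

lemma integrable_energy_integrand:
  fixes u \<phi> :: "real^'n \<Rightarrow> real"
  assumes [measurable]: "u \<in> borel_measurable lebesgue" "\<phi> \<in> borel_measurable lebesgue"
    and p: "1 < p" and finite: "gagliardo s p u < \<infinity>" "gagliardo s p \<phi> < \<infinity>"
  shows "integrable leb2 (energy_integrand s p u \<phi>)"
proof (rule integrableI_bounded)
  define du where "du z = \<bar>u (fst z) - u (snd z)\<bar> powr p * kern (p * s) (fst z - snd z)" for z
  define d\<phi> where "d\<phi> z = \<bar>\<phi> (fst z) - \<phi> (snd z)\<bar> powr p * kern (p * s) (fst z - snd z)" for z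
  have [measurable]: "du \<in> borel_measurable leb2" "d\<phi> \<in> borel_measurable leb2"
    unfolding du_def[abs_def] d\<phi>_def[abs_def] by measurable
  have "norm (energy_integrand s p u \<phi> z) \<le> du z + d\<phi> z" for z
  proof -
    have "norm (energy_integrand s p u \<phi> z)
        = \<bar>spow (u (fst z) - u (snd z)) (p - 1) * (\<phi> (fst z) - \<phi> (snd z))\<bar> * kern (p * s) (fst z - snd z)"
      by (simp add: energy_integrand_def abs_mult)
    also have "\<dots> \<le> du z + d\<phi> z"
      unfolding du_def d\<phi>_def distrib_right[symmetric] by (intro mult_right_mono abs_spow_mult_le p) auto
    finally show ?thesis .
  qed
  then have "(\<integral>\<^sup>+ z. ennreal (norm (energy_integrand s p u \<phi> z)) \<partial>leb2)
    \<le> (\<integral>\<^sup>+ z. ennreal (du z) + ennreal (d\<phi> z) \<partial>leb2)"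
    by (intro nn_integral_mono)
       (simp add: du_def d\<phi>_def ennreal_leI flip: ennreal_plus del: ennreal_plus)
  also have "\<dots> = gagliardo s p u + gagliardo s p \<phi>"
    unfolding gagliardo_eq du_def[symmetric] d\<phi>_def[symmetric] by (rule nn_integral_add) measurable
  also have "\<dots> < \<infinity>" using finite by simp
  finally show "(\<integral>\<^sup>+ z. ennreal (norm (energy_integrand s p u \<phi> z)) \<partial>leb2) < \<infinity>" .
qed measurable

lemma gagliardo_0 [simp]: "gagliardo s p (\<lambda>_. 0) = 0"
  by (simp add: gagliardo_eq)

lemma gagliardo_uminus: "gagliardo s p (\<lambda>x. - u x) = gagliardo s p u"
  by (simp add: gagliardo_def minus_diff_commute abs_minus_commute)

lemma gagliardo_const_add: "gagliardo s p (\<lambda>x. c + u x) = gagliardo s p u"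
  by (simp add: gagliardo_def)

lemma gagliardo_finite_dominated:
  fixes \<eta> :: "real^'n \<Rightarrow> real"
  assumes [measurable]: "u \<in> borel_measurable lebesgue" "\<phi> \<in> borel_measurable lebesgue"
    and p: "0 < p" and finite: "gagliardo s p u < \<infinity>" "gagliardo s p \<phi> < \<infinity>" and c: "0 \<le> c"
    and le: "\<And>x y. \<bar>\<eta> x - \<eta> y\<bar> \<le> c * \<bar>\<phi> x - \<phi> y\<bar> + \<bar>u x - u y\<bar>"
  shows "gagliardo s p \<eta> < \<infinity>"
proof -
  define du where "du z = \<bar>u (fst z) - u (snd z)\<bar> powr p * kern (p * s) (fst z - snd z)" for z
  define d\<phi> where "d\<phi> z = \<bar>\<phi> (fst z) - \<phi> (snd z)\<bar> powr p * kern (p * s) (fst z - snd z)" for z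
  have [measurable]: "du \<in> borel_measurable leb2" "d\<phi> \<in> borel_measurable leb2"
    unfolding du_def[abs_def] d\<phi>_def[abs_def] by measurable
  have "\<bar>\<eta> x - \<eta> y\<bar> powr p * kern (p * s) (x - y) \<le> 2 powr p * c powr p * d\<phi> (x, y) + 2 powr p * du (x, y)"
      for x y
  proof -
    have "\<bar>\<eta> x - \<eta> y\<bar> powr p \<le> (c * \<bar>\<phi> x - \<phi> y\<bar> + \<bar>u x - u y\<bar>) powr p"
      using p le by (intro powr_mono2) auto
    also have "\<dots> \<le> 2 powr p * ((c * \<bar>\<phi> x - \<phi> y\<bar>) powr p + \<bar>u x - u y\<bar> powr p)"
      using p c by (intro powr_add_le) auto
    finally have "\<bar>\<eta> x - \<eta> y\<bar> powr p * kern (p * s) (x - y)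
        \<le> 2 powr p * ((c * \<bar>\<phi> x - \<phi> y\<bar>) powr p + \<bar>u x - u y\<bar> powr p) * kern (p * s) (x - y)"
      by (intro mult_right_mono) auto
    then show ?thesis by (simp add: du_def d\<phi>_def powr_mult algebra_simps)
  qed
  then have "gagliardo s p \<eta> \<le>
    (\<integral>\<^sup>+ z. ennreal (2 powr p * c powr p) * ennreal (d\<phi> z) + ennreal (2 powr p) * ennreal (du z) \<partial>leb2)"
    unfolding gagliardo_eq
    by (intro nn_integral_mono)
       (simp add: du_def d\<phi>_def ennreal_leI flip: ennreal_plus ennreal_mult del: ennreal_plus)
  also have "\<dots> = ennreal (2 powr p * c powr p) * gagliardo s p \<phi> + ennreal (2 powr p) * gagliardo s p u"
    unfolding gagliardo_eq du_def[symmetric] d\<phi>_def[symmetric]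
    by (simp add: nn_integral_add nn_integral_cmult)
  also have "\<dots> < \<infinity>" using finite by (simp add: ennreal_mult_less_top)
  finally show ?thesis .
qed

lemma nn_integral_lipschitz_kern:
  fixes p s L :: real
  assumes p: "0 < p" and s: "0 < s" "s < 1" and L: "0 \<le> L"
  shows "(\<integral>\<^sup>+ h. ennreal (min 1 (L * norm h) powr p * kern (p * s) (h :: 'a::euclidean_space)) \<partial>lborel) < \<infinity>"
proof -
  let ?inner = "\<lambda>h::'a. indicator (ball 0 1) h * kern (p * s - p) h"
  let ?outer = "\<lambda>h::'a. indicator {h. 1 \<le> norm h} h * kern (p * s) h"
  have [measurable]: "ball (0::'a) 1 \<in> sets borel" by simp
  have "min 1 (L * norm h) powr p * kern (p * s) h \<le> L powr p * ?inner h + ?outer h" for h :: 'a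
  proof (cases "norm h < 1")
    case True
    have "min 1 (L * norm h) powr p * kern (p * s) h \<le> (L * norm h) powr p * kern (p * s) h"
      using p L by (intro mult_right_mono powr_mono2) auto
    also have "\<dots> = L powr p * kern (p * s - p) h"
      by (simp add: powr_mult norm_powr_mult_kern mult.assoc)
    finally show ?thesis using True by simp
  next
    case False
    have "min 1 (L * norm h) powr p \<le> 1" using p L by (intro powr_le1) auto
    then show ?thesis using False by (simp add: mult_left_le_one_le)
  qed
  then have "(\<integral>\<^sup>+ h. ennreal (min 1 (L * norm h) powr p * kern (p * s) (h :: 'a)) \<partial>lborel)
      \<le> (\<integral>\<^sup>+ h. ennreal (L powr p) * ennreal (?inner h) + ennreal (?outer h) \<partial>lborel)"
    by (intro nn_integral_mono) (simp add: ennreal_leI flip: ennreal_plus ennreal_mult del: ennreal_plus)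
  also have "\<dots>
    = ennreal (L powr p) * (\<integral>\<^sup>+ h. ennreal (?inner h) \<partial>lborel) + (\<integral>\<^sup>+ h. ennreal (?outer h) \<partial>lborel)"
    by (subst nn_integral_add) (auto simp: nn_integral_cmult)
  also have "\<dots> < \<infinity>"
    using nn_integral_kern_inside_ball[of "p * s - p", where 'a = 'a]
      nn_integral_kern_outside_ball[of "p * s" 1, where 'a = 'a] p s
    by (simp add: ennreal_mult_less_top)
  finally show ?thesis .
qed

lemma gagliardo_lipschitz_finite:
  fixes \<phi> :: "real^'n \<Rightarrow> real"
  assumes p: "0 < p" and s: "0 < s" "s < 1" and L: "0 \<le> L"
    and lip: "\<And>x y. \<bar>\<phi> x - \<phi> y\<bar> \<le> L * norm (x - y)" and bounded: "\<And>x y. \<bar>\<phi> x - \<phi> y\<bar> \<le> 1"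
    and supp: "\<And>x. x \<notin> ball x0 r \<Longrightarrow> \<phi> x = 0"
  shows "gagliardo s p \<phi> < \<infinity>"
proof -
  define g where "g h = ennreal (min 1 (L * norm h) powr p * kern (p * s) h)" for h :: "real^'n"
  define a where "a x = (indicator (ball x0 r) x :: ennreal)" for x
  have [measurable]: "a \<in> borel_measurable lebesgue"
    unfolding a_def[abs_def] by (intro borel_measurable_indicator) simp
  have [measurable]: "g \<in> borel_measurable borel" unfolding g_def[abs_def] by measurable
  have m [measurable]: "(\<lambda>z. a (fst z) * g (fst z - snd z)) \<in> borel_measurable leb2"
    using measurable_compose[OF measurable_diff_lebesgue, of g borel] by measurable
  have m' [measurable]: "(\<lambda>z. a (snd z) * g (snd z - fst z)) \<in> borel_measurable leb2"
    using measurable_compose[OF measurable_pair_swap' m] by (simp add: case_prod_beta')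
  have "ennreal (\<bar>\<phi> x - \<phi> y\<bar> powr p * kern (p * s) (x - y)) \<le> a x * g (x - y) + a y * g (y - x)" for x y
  proof (cases "x \<in> ball x0 r \<or> y \<in> ball x0 r")
    case False
    then show ?thesis using supp[of x] supp[of y] by simp
  next
    case True
    have "\<bar>\<phi> x - \<phi> y\<bar> powr p \<le> min 1 (L * norm (x - y)) powr p"
      using p lip[of x y] bounded[of x y] by (intro powr_mono2) auto
    then have "ennreal (\<bar>\<phi> x - \<phi> y\<bar> powr p * kern (p * s) (x - y)) \<le> g (x - y)"
      unfolding g_def by (intro ennreal_leI mult_right_mono) auto
    moreover have "g (y - x) = g (x - y)"
      by (simp add: g_def norm_minus_commute kern_commute[of _ x y])
    ultimately show ?thesis using True by (auto simp: a_def add_increasing add_increasing2)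
  qed
  then have "gagliardo s p \<phi> \<le> (\<integral>\<^sup>+ z. a (fst z) * g (fst z - snd z) + a (snd z) * g (snd z - fst z) \<partial>leb2)"
    unfolding gagliardo_eq by (intro nn_integral_mono)
  also have "\<dots>
    = (\<integral>\<^sup>+ z. a (fst z) * g (fst z - snd z) \<partial>leb2) + (\<integral>\<^sup>+ z. a (snd z) * g (snd z - fst z) \<partial>leb2)"
    by (rule nn_integral_add[OF m m'])
  also have "\<dots> = 2 * ((\<integral>\<^sup>+ x. a x \<partial>lebesgue) * (\<integral>\<^sup>+ h. g h \<partial>lborel))"
    using nn_integral_leb2_swap[OF m] by (simp add: nn_integral_leb2_convolution mult_2)
  also have "\<dots> < \<infinity>"
    using nn_integral_lipschitz_kern[OF p s L, where 'a = "real^'n"]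
      emeasure_bounded_finite[OF bounded_ball, of x0 r]
    by (simp add: a_def g_def nn_integral_completion ennreal_mult_less_top less_top)
  finally show ?thesis .
qed

lemma
  assumes "u \<in> W0 s p \<Omega>"
  shows W0_measurable: "u \<in> borel_measurable lebesgue"
    and W0_gagliardo: "gagliardo s p u < \<infinity>"
    and W0_outside: "AE x in lebesgue. x \<notin> \<Omega> \<longrightarrow> u x = 0"
    and W0_Lp: "(\<integral>\<^sup>+ x. ennreal (\<bar>u x\<bar> powr p) \<partial>lebesgue) < \<infinity>"
  using assms by (auto simp: W0_def)

lemma W0_uminus: "u \<in> W0 s p \<Omega> \<Longrightarrow> (\<lambda>x. - u x) \<in> W0 s p \<Omega>"
  by (auto simp: W0_def gagliardo_uminus)

lemma emeasure_lebesgue_bounded_open: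
  assumes "open \<Omega>" "bounded \<Omega>"
  shows "\<Omega> \<in> sets lebesgue" "emeasure lebesgue \<Omega> < \<infinity>"
  using assms emeasure_bounded_finite[OF assms(2)] by auto

lemma W0_of_bounded:
  assumes [measurable]: "\<eta> \<in> borel_measurable lebesgue" and \<eta>: "\<And>x. \<bar>\<eta> x\<bar> \<le> k"
    and finite: "gagliardo s p \<eta> < \<infinity>" and outside: "AE x in lebesgue. x \<notin> \<Omega> \<longrightarrow> \<eta> x = 0"
    and \<Omega>: "open \<Omega>" "bounded \<Omega>" and p: "0 < p"
  shows "\<eta> \<in> W0 s p \<Omega>"
proof -
  note [measurable] = emeasure_lebesgue_bounded_open(1)[OF \<Omega>]
  have "(\<integral>\<^sup>+ x. ennreal (\<bar>\<eta> x\<bar> powr p) \<partial>lebesgue) \<le> (\<integral>\<^sup>+ x. ennreal (k powr p) * indicator \<Omega> x \<partial>lebesgue)"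
  proof (rule nn_integral_mono_AE)
    show "AE x in lebesgue. ennreal (\<bar>\<eta> x\<bar> powr p) \<le> ennreal (k powr p) * indicator \<Omega> x"
      using outside
      by eventually_elim (use \<eta> p in \<open>auto simp: indicator_def intro!: ennreal_leI powr_mono2\<close>)
  qed
  also have "\<dots> = ennreal (k powr p) * emeasure lebesgue \<Omega>"
    by (rule nn_integral_cmult_indicator) measurable
  also have "\<dots> < \<infinity>"
    using emeasure_lebesgue_bounded_open(2)[OF \<Omega>]
    by (simp add: ennreal_mult_less_top del: emeasure_completion)
  finally show ?thesis using assms by (simp add: W0_def)
qed

lemma W0_truncation:
  assumes u: "u \<in> W0 s p \<Omega>" and p: "0 < p" and \<kappa>: "0 \<le> \<kappa>"
  shows "(\<lambda>x. max 0 (u x - \<kappa>)) \<in> W0 s p \<Omega>"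
proof -
  note [measurable] = W0_measurable[OF u]
  have "(\<integral>\<^sup>+ x. ennreal (\<bar>max 0 (u x - \<kappa>)\<bar> powr p) \<partial>lebesgue) \<le> (\<integral>\<^sup>+ x. ennreal (\<bar>u x\<bar> powr p) \<partial>lebesgue)"
    using p \<kappa> by (intro nn_integral_mono ennreal_leI powr_mono2) auto
  also have "\<dots> < \<infinity>" by (rule W0_Lp[OF u])
  finally have "(\<integral>\<^sup>+ x. ennreal (\<bar>max 0 (u x - \<kappa>)\<bar> powr p) \<partial>lebesgue) < \<infinity>" .
  moreover have "gagliardo s p (\<lambda>x. max 0 (u x - \<kappa>)) < \<infinity>"
    by (rule gagliardo_finite_dominated[of u "\<lambda>_. 0" p s 0]) (use p W0_gagliardo[OF u] in auto)
  moreover have "AE x in lebesgue. x \<notin> \<Omega> \<longrightarrow> max 0 (u x - \<kappa>) = 0"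
    using W0_outside[OF u] by eventually_elim (use \<kappa> in auto)
  ultimately show ?thesis by (simp add: W0_def)
qed

lemma W0_integrable:
  assumes u: "u \<in> W0 s p \<Omega>" and \<Omega>: "open \<Omega>" "bounded \<Omega>" and p: "1 \<le> p"
  shows "integrable lebesgue u"
proof (rule integrableI_bounded)
  note [measurable] = W0_measurable[OF u] and [simp] = emeasure_lebesgue_bounded_open[OF \<Omega>]
  show "u \<in> borel_measurable lebesgue" by measurable
  have "(\<integral>\<^sup>+ x. ennreal (norm (u x)) \<partial>lebesgue) \<le> (\<integral>\<^sup>+ x. indicator \<Omega> x + ennreal (\<bar>u x\<bar> powr p) \<partial>lebesgue)"
    using W0_outside[OF u]
  proof (intro nn_integral_mono_AE, eventually_elim)
    fix x assume x: "x \<notin> \<Omega> \<longrightarrow> u x = 0"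
    have "\<bar>u x\<bar> \<le> 1 + \<bar>u x\<bar> powr p"
    proof (cases "\<bar>u x\<bar> \<le> 1")
      case False
      then show ?thesis using powr_mono[of 1 p "\<bar>u x\<bar>"] p by simp
    qed (simp add: add_increasing2)
    then have "ennreal \<bar>u x\<bar> \<le> 1 + ennreal (\<bar>u x\<bar> powr p)"
      by (simp del: ennreal_plus add: ennreal_plus[symmetric] ennreal_leI flip: ennreal_1)
    then show "ennreal (norm (u x)) \<le> indicator \<Omega> x + ennreal (\<bar>u x\<bar> powr p)"
      using x by (auto simp: indicator_def)
  qed
  also have "\<dots> = emeasure lebesgue \<Omega> + (\<integral>\<^sup>+ x. ennreal (\<bar>u x\<bar> powr p) \<partial>lebesgue)"
    by (subst nn_integral_add) (auto intro: borel_measurable_indicator)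
  also have "\<dots> < \<infinity>"
    using W0_Lp[OF u] emeasure_lebesgue_bounded_open[OF \<Omega>]
    by (simp only: ennreal_add_less_top infinity_ennreal_def)
  finally show "(\<integral>\<^sup>+ x. ennreal (norm (u x)) \<partial>lebesgue) < \<infinity>" .
qed

lemma energy_uminus: "energy s p (\<lambda>x. - u x) \<phi> = - energy s p u \<phi>"
proof -
  have "- u x - - u y = - (u x - u y)" for x y by simp
  then have "energy_integrand s p (\<lambda>x. - u x) \<phi> = (\<lambda>z. - energy_integrand s p u \<phi> z)"
    unfolding energy_integrand_def by (simp only: spow_minus mult_minus_left)
  then show ?thesis by (simp add: energy_def)
qed

lemma energy_const_add: "energy s p (\<lambda>x. c + u x) \<phi> = energy s p u \<phi>"
  by (simp add: energy_def energy_integrand_def[abs_def])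

section \<open>Weak supersolutions and boundedness\<close>

text \<open>\<open>frac_lap_ge s p \<Omega> K V\<close> says that the fractional p-Laplacian of \<open>V\<close> is at least \<open>K\<close>, weakly in \<open>\<Omega>\<close>.\<close>
definition frac_lap_ge :: "real \<Rightarrow> real \<Rightarrow> (real^'n) set \<Rightarrow> real \<Rightarrow> (real^'n \<Rightarrow> real) \<Rightarrow> bool" where
  "frac_lap_ge s p \<Omega> K V \<longleftrightarrow> (\<forall>\<eta>\<in>W0 s p \<Omega>. (\<forall>x. 0 \<le> \<eta> x) \<longrightarrow> K * integral\<^sup>L lebesgue \<eta> \<le> energy s p V \<eta>)"

lemma frac_lap_geD:
  "frac_lap_ge s p \<Omega> K V \<Longrightarrow> \<eta> \<in> W0 s p \<Omega> \<Longrightarrow> (\<And>x. 0 \<le> \<eta> x) \<Longrightarrow> K * integral\<^sup>L lebesgue \<eta> \<le> energy s p V \<eta>"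
  by (simp add: frac_lap_ge_def)

lemma frac_lap_ge_const_add: "frac_lap_ge s p \<Omega> K (\<lambda>x. c + V x) \<longleftrightarrow> frac_lap_ge s p \<Omega> K V"
  by (simp add: frac_lap_ge_def energy_const_add)

lemma abs_set_integral_mult_le:
  fixes f \<eta> :: "'a \<Rightarrow> real"
  assumes f: "set_borel_measurable M \<Omega> f" "AE x in M. x \<in> \<Omega> \<longrightarrow> \<bar>f x\<bar> \<le> K" and K: "0 \<le> K"
    and \<eta>: "integrable M \<eta>" "\<And>x. 0 \<le> \<eta> x"
  shows "\<bar>\<integral>x\<in>\<Omega>. f x * \<eta> x \<partial>M\<bar> \<le> K * integral\<^sup>L M \<eta>"
proof -
  let ?g = "\<lambda>x. indicator \<Omega> x *\<^sub>R (f x * \<eta> x)"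
  have "?g = (\<lambda>x. (indicator \<Omega> x *\<^sub>R f x) * \<eta> x)" by (simp add: fun_eq_iff)
  then have m: "?g \<in> borel_measurable M"
    using f(1) \<eta>(1) unfolding set_borel_measurable_def by (auto intro!: borel_measurable_times)
  have le: "AE x in M. norm (?g x) \<le> K * \<eta> x"
    using f(2) by eventually_elim
        (use \<eta>(2) K in \<open>auto simp: indicator_def abs_mult intro!: mult_right_mono\<close>)
  have int: "integrable M (\<lambda>x. K * \<eta> x)" using \<eta> by simp
  have "AE x in M. norm (?g x) \<le> norm (K * \<eta> x)"
    using le by eventually_elim (use \<eta>(2) K in \<open>simp add: abs_mult\<close>)
  then have "integrable M ?g"
    by (rule Bochner_Integration.integrable_bound[OF int m])
  then have "norm (integral\<^sup>L M ?g) \<le> (\<integral>x. K * \<eta> x \<partial>M)"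
    using le int by (intro order_trans[OF integral_norm_bound integral_mono_AE]) auto
  then show ?thesis using \<eta> by (simp add: set_lebesgue_integral_def)
qed

lemma weak_solution_imp_frac_lap_ge:
  assumes u: "weak_solution s p \<Omega> f u" and f: "set_borel_measurable lebesgue \<Omega> f"
    "AE x in lebesgue. x \<in> \<Omega> \<longrightarrow> \<bar>f x\<bar> \<le> K" "0 \<le> K" and \<Omega>: "open \<Omega>" "bounded \<Omega>" and p: "1 \<le> p"
  shows "frac_lap_ge s p \<Omega> (- K) u" "frac_lap_ge s p \<Omega> (- K) (\<lambda>x. - u x)"
proof -
  have "\<bar>energy s p u \<eta>\<bar> \<le> K * integral\<^sup>L lebesgue \<eta>" if "\<eta> \<in> W0 s p \<Omega>" "\<forall>x. 0 \<le> \<eta> x" for \<eta>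
    using abs_set_integral_mult_le[OF f W0_integrable[OF that(1) \<Omega> p]] u that
    by (simp add: weak_solution_iff)
  then show "frac_lap_ge s p \<Omega> (- K) u" "frac_lap_ge s p \<Omega> (- K) (\<lambda>x. - u x)"
    unfolding frac_lap_ge_def energy_uminus by (fastforce simp: abs_le_iff)+
qed

subsection \<open>Boundedness\<close>

lemma kern_ge_on_far_ball:
  fixes \<Omega> :: "'a::euclidean_space set"
  assumes \<Omega>: "bounded \<Omega>" and a: "0 \<le> a"
  obtains y0 k where "0 < k" "ball y0 1 \<inter> \<Omega> = {}" "\<And>x y. x \<in> \<Omega> \<Longrightarrow> y \<in> ball y0 1 \<Longrightarrow> k \<le> kern a (x - y)"
proof -
  obtain B where B: "B > 0" "\<Omega> \<subseteq> ball 0 B" using bounded_subset_ballD[OF \<Omega>, of 0] by blast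
  obtain y0 :: 'a where y0: "norm y0 = B + 1" using vector_choose_size[of "B + 1"] B by auto
  have far: "B < norm y" "norm y < B + 2" if "y \<in> ball y0 1" for y
    using that norm_triangle_ineq2[of y0 y] norm_triangle_ineq2[of y y0] y0
    by (auto simp: dist_norm norm_minus_commute)
  show ?thesis
  proof
    show "0 < (2 * B + 2) powr (- (real DIM('a) + a))" using B by simp
    show "ball y0 1 \<inter> \<Omega> = {}" using far(1) B by fastforce
    fix x y assume x: "x \<in> \<Omega>" and y: "y \<in> ball y0 1"
    then have "norm x < B" using B by auto
    then show "(2 * B + 2) powr (- (real DIM('a) + a)) \<le> kern a (x - y)"
      using far[OF y] norm_triangle_ineq4[of x y] a by (intro kern_ge) auto
  qed
qed

lemma nn_integral_leb2_times:
  assumes [measurable]: "f \<in> borel_measurable lebesgue" "g \<in> borel_measurable lebesgue"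
  shows "(\<integral>\<^sup>+ z. f (fst z) * g (snd z) \<partial>leb2) = (\<integral>\<^sup>+ x. f x \<partial>lebesgue) * (\<integral>\<^sup>+ y. g y \<partial>lebesgue)"
proof -
  have "(\<lambda>z. f (fst z) * g (snd z)) \<in> borel_measurable leb2" by measurable
  from lebesgue.nn_integral_fst[OF this] show ?thesis
    by (simp add: nn_integral_cmult nn_integral_multc)
qed

lemma energy_integrand_truncation_nonneg: "0 \<le> energy_integrand s p u (\<lambda>x. max 0 (u x - \<kappa>)) z"
proof -
  let ?\<eta> = "\<lambda>x. max 0 (u x - \<kappa>)"
  have "0 \<le> spow (u (fst z) - u (snd z)) (p - 1) * (?\<eta> (fst z) - ?\<eta> (snd z))"
  proof (cases "u (snd z) \<le> u (fst z)")
    case True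
    then show ?thesis by (intro mult_nonneg_nonneg) auto
  next
    case False
    then show ?thesis by (intro mult_nonpos_nonpos) (auto simp: spow_nonpos_eq)
  qed
  then show ?thesis by (simp add: energy_integrand_def)
qed

lemma energy_integrand_truncation_ge:
  assumes p: "1 < p" and \<kappa>: "0 < \<kappa>" and outside: "x \<notin> \<Omega> \<longrightarrow> u x = 0" "y \<notin> \<Omega> \<longrightarrow> u y = 0"
    and k: "0 \<le> k" "x \<in> \<Omega> \<Longrightarrow> y \<in> Y \<Longrightarrow> k \<le> kern (p * s) (x - y)" and Y: "Y \<inter> \<Omega> = {}"
  defines "\<eta> \<equiv> \<lambda>x. max 0 (u x - \<kappa>)"
  shows "\<kappa> powr (p - 1) * k * (\<eta> x * indicator Y y) \<le> energy_integrand s p u \<eta> (x, y)"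
proof (cases "y \<in> Y \<and> 0 < \<eta> x")
  case True
  then have ux: "\<kappa> < u x" by (auto simp: \<eta>_def max_def split: if_splits)
  then have x: "x \<in> \<Omega>" using outside \<kappa> by auto
  have y: "u y = 0" "\<eta> y = 0" using outside Y True \<kappa> by (auto simp: \<eta>_def)
  have "\<kappa> powr (p - 1) * k * \<eta> x \<le> u x powr (p - 1) * kern (p * s) (x - y) * \<eta> x"
    using ux \<kappa> p k x True by (intro mult_mono powr_mono2 mult_nonneg_nonneg) auto
  also have "\<dots> = energy_integrand s p u \<eta> (x, y)"
    using y ux \<kappa> by (simp add: energy_integrand_def spow_nonneg_eq)
  finally show ?thesis using True by simp
next
  case False
  then have "\<eta> x * indicator Y y = 0" by (auto simp: \<eta>_def indicator_def)
  moreover have "0 \<le> energy_integrand s p u \<eta> (x, y)"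
    unfolding \<eta>_def by (rule energy_integrand_truncation_nonneg)
  ultimately show ?thesis by (simp only: mult_zero_right)
qed

lemma energy_truncation_ge:
  fixes u :: "real^'n \<Rightarrow> real"
  assumes u: "u \<in> W0 s p \<Omega>" and \<Omega>: "open \<Omega>" "bounded \<Omega>" and p: "1 < p" and \<kappa>: "0 < \<kappa>"
    and Y: "Y \<in> sets lebesgue" "emeasure lebesgue Y < \<infinity>" "Y \<inter> \<Omega> = {}"
    and k: "0 \<le> k" "\<And>x y. x \<in> \<Omega> \<Longrightarrow> y \<in> Y \<Longrightarrow> k \<le> kern (p * s) (x - y)"
  defines "\<eta> \<equiv> \<lambda>x. max 0 (u x - \<kappa>)"
  shows "\<kappa> powr (p - 1) * k * measure lebesgue Y * integral\<^sup>L lebesgue \<eta> \<le> energy s p u \<eta>"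
proof -
  have \<eta>: "\<eta> \<in> W0 s p \<Omega>" unfolding \<eta>_def using u p \<kappa> by (intro W0_truncation) auto
  note [measurable] = W0_measurable[OF u] W0_measurable[OF \<eta>] Y(1)
  have \<eta>0: "0 \<le> \<eta> x" for x by (simp add: \<eta>_def)
  let ?G = "energy_integrand s p u \<eta>"
  have G0: "0 \<le> ?G z" for z
    unfolding \<eta>_def by (rule energy_integrand_truncation_nonneg)
  have int: "integrable leb2 ?G"
    using p W0_gagliardo[OF u] W0_gagliardo[OF \<eta>] by (intro integrable_energy_integrand) auto
  have "(\<integral>\<^sup>+ x. ennreal (\<eta> x) \<partial>lebesgue) = ennreal (integral\<^sup>L lebesgue \<eta>)"
    using \<eta>0 W0_integrable[OF \<eta> \<Omega>] p by (intro nn_integral_eq_integral) auto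
  moreover have "emeasure lebesgue Y = ennreal (measure lebesgue Y)"
    using Y by (intro emeasure_eq_ennreal_measure) auto
  ultimately have "ennreal (\<kappa> powr (p - 1) * k * (integral\<^sup>L lebesgue \<eta> * measure lebesgue Y))
      = ennreal (\<kappa> powr (p - 1) * k) * ((\<integral>\<^sup>+ x. ennreal (\<eta> x) \<partial>lebesgue) * emeasure lebesgue Y)"
    using k \<eta>0 by (simp only: ennreal_mult Bochner_Integration.integral_nonneg measure_nonneg
        mult_nonneg_nonneg powr_ge_zero)
  also have "\<dots> = (\<integral>\<^sup>+ z. ennreal (\<kappa> powr (p - 1) * k) * (ennreal (\<eta> (fst z)) * indicator Y (snd z)) \<partial>leb2)"
    by (subst nn_integral_cmult, measurable, subst nn_integral_leb2_times)
      (auto simp del: emeasure_completion)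
  also have "\<dots> \<le> (\<integral>\<^sup>+ z. ennreal (?G z) \<partial>leb2)"
    using lebesgue.AE_pair_measure_same[OF W0_outside[OF u]]
  proof (intro nn_integral_mono_AE, eventually_elim)
    fix z :: "(real^'n) \<times> (real^'n)"
    assume "(fst z \<notin> \<Omega> \<longrightarrow> u (fst z) = 0) \<and> (snd z \<notin> \<Omega> \<longrightarrow> u (snd z) = 0)"
    then have "\<kappa> powr (p - 1) * k * (\<eta> (fst z) * indicator Y (snd z)) \<le> ?G z"
      unfolding \<eta>_def using energy_integrand_truncation_ge[OF p \<kappa>, of "fst z" \<Omega> u "snd z"] k Y(3) by simp
    then show "ennreal (\<kappa> powr (p - 1) * k) * (ennreal (\<eta> (fst z)) * indicator Y (snd z)) \<le> ennreal (?G z)"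
      using k \<eta>0 by (simp add: ennreal_leI flip: ennreal_mult ennreal_indicator)
  qed
  also have "\<dots> = ennreal (energy s p u \<eta>)"
    unfolding energy_def using int G0 by (intro nn_integral_eq_integral) auto
  finally have "\<kappa> powr (p - 1) * k * (integral\<^sup>L lebesgue \<eta> * measure lebesgue Y) \<le> energy s p u \<eta>"
    using G0 by (subst (asm) ennreal_le_iff)
      (auto simp: energy_def intro!: Bochner_Integration.integral_nonneg)
  then show ?thesis by (simp only: mult_ac)
qed

lemma AE_le_if_AE_le_add:
  fixes f :: "'a \<Rightarrow> real"
  assumes "\<And>\<epsilon>. 0 < \<epsilon> \<Longrightarrow> AE x in M. P x \<longrightarrow> f x \<le> c + \<epsilon>"
  shows "AE x in M. P x \<longrightarrow> f x \<le> c"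
proof -
  have "AE x in M. \<forall>n. P x \<longrightarrow> f x \<le> c + 1 / real (Suc n)"
    using assms by (subst AE_all_countable) auto
  then show ?thesis
  proof (eventually_elim, intro impI)
    fix x assume le: "\<forall>n. P x \<longrightarrow> f x \<le> c + 1 / real (Suc n)" and "P x"
    have "(\<lambda>n. c + 1 / real (Suc n)) \<longlonglongrightarrow> c + 0"
      by (intro tendsto_intros LIMSEQ_Suc[OF lim_1_over_n])
    then show "f x \<le> c" using le \<open>P x\<close> by (intro LIMSEQ_le_const[where X = "\<lambda>n. c + 1 / real (Suc n)"]) auto
  qed
qed

lemma integral_zero_if_coefficient_gap:
  fixes \<eta> :: "'a \<Rightarrow> real"
  assumes \<eta>: "integrable M \<eta>" "\<And>x. 0 \<le> \<eta> x" and le: "a * integral\<^sup>L M \<eta> \<le> b * integral\<^sup>L M \<eta>" "b < a"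
  shows "AE x in M. \<eta> x = 0"
proof -
  have "(a - b) * integral\<^sup>L M \<eta> \<le> 0" using le by (simp add: algebra_simps)
  moreover have "0 \<le> integral\<^sup>L M \<eta>" using \<eta> by (intro Bochner_Integration.integral_nonneg) auto
  ultimately have "integral\<^sup>L M \<eta> = 0" using le by (simp add: mult_le_0_iff)
  then show ?thesis using integral_nonneg_eq_0_iff_AE[OF \<eta>(1)] \<eta>(2) by simp
qed

text \<open>Test with the truncation: the interaction with a ball far away from the domain, where \<open>u\<close> vanishes,
  already bounds the energy from below by \<open>\<kappa> powr (p - 1)\<close> times the integral of the test function.\<close>
lemma frac_lap_le_imp_bounded_above:
  fixes \<Omega> :: "(real^'n) set"
  assumes \<Omega>: "open \<Omega>" "bounded \<Omega>" and p: "1 < p" and s: "0 \<le> s"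
  obtains c where "0 < c" "\<And>u K. u \<in> W0 s p \<Omega> \<Longrightarrow> frac_lap_ge s p \<Omega> (- K) (\<lambda>x. - u x) \<Longrightarrow> 0 \<le> K \<Longrightarrow>
    AE x in lebesgue. u x \<le> (K / c) powr (1 / (p - 1))"
proof -
  have ps: "0 \<le> p * s" using p s by simp
  obtain y0 k where k: "0 < k" "ball y0 1 \<inter> \<Omega> = {}" "\<And>x y. x \<in> \<Omega> \<Longrightarrow> y \<in> ball y0 1 \<Longrightarrow> k \<le> kern (p * s) (x - y)"
    by (rule kern_ge_on_far_ball[OF \<Omega>(2) ps]) (rule that)
  define c where "c = k * measure lebesgue (ball y0 1)"
  have "0 < c" using k content_ball_gt_0_iff[of y0 1] by (simp add: c_def)
  moreover have "AE x in lebesgue. u x \<le> (K / c) powr (1 / (p - 1))"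
    if u: "u \<in> W0 s p \<Omega>" "frac_lap_ge s p \<Omega> (- K) (\<lambda>x. - u x)" and K: "0 \<le> K" for u K
  proof -
    define b where "b = (K / c) powr (1 / (p - 1))"
    have b: "0 \<le> b" "K = c * b powr (p - 1)"
      using \<open>0 < c\<close> K p by (auto simp: b_def powr_powr)
    have "AE x in lebesgue. True \<longrightarrow> u x \<le> b + \<epsilon>" if "0 < \<epsilon>" for \<epsilon>
    proof -
      define \<kappa> where "\<kappa> = b + \<epsilon>"
      define \<eta> where "\<eta> x = max 0 (u x - \<kappa>)" for x
      have \<kappa>: "b < \<kappa>" "0 < \<kappa>" using b that by (auto simp: \<kappa>_def)
      have \<eta>: "\<eta> \<in> W0 s p \<Omega>" "\<And>x. 0 \<le> \<eta> x"
        unfolding \<eta>_def using u \<kappa> p by (auto intro!: W0_truncation)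
      have "\<kappa> powr (p - 1) * k * measure lebesgue (ball y0 1) * integral\<^sup>L lebesgue \<eta> \<le> energy s p u \<eta>"
        unfolding \<eta>_def[abs_def] using emeasure_lebesgue_bounded_open[of "ball y0 1"] k \<kappa>
        by (intro energy_truncation_ge[OF u(1) \<Omega> p]) auto
      also have "\<dots> \<le> K * integral\<^sup>L lebesgue \<eta>"
        using frac_lap_geD[OF u(2) \<eta>] by (simp add: energy_uminus)
      finally have "c * \<kappa> powr (p - 1) * integral\<^sup>L lebesgue \<eta> \<le> K * integral\<^sup>L lebesgue \<eta>"
        by (simp add: c_def mult_ac)
      moreover have "K < c * \<kappa> powr (p - 1)"
        unfolding b(2) using \<open>0 < c\<close> p b \<kappa> by (intro mult_strict_left_mono powr_less_mono2) auto
      ultimately have "AE x in lebesgue. \<eta> x = 0"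
        using \<eta> p by (intro integral_zero_if_coefficient_gap W0_integrable[OF \<eta>(1) \<Omega>]) auto
      then show ?thesis by eventually_elim (simp add: \<eta>_def \<kappa>_def max_def split: if_splits)
    qed
    from AE_le_if_AE_le_add[OF this] show ?thesis by (simp add: b_def)
  qed
  ultimately show ?thesis using that by blast
qed

lemma frac_lap_bounded_imp_bounded:
  fixes \<Omega> :: "(real^'n) set"
  assumes \<Omega>: "open \<Omega>" "bounded \<Omega>" and p: "1 < p" and s: "0 \<le> s"
  obtains c where "0 < c" "\<And>u K. u \<in> W0 s p \<Omega> \<Longrightarrow> frac_lap_ge s p \<Omega> (- K) u \<Longrightarrow>
    frac_lap_ge s p \<Omega> (- K) (\<lambda>x. - u x) \<Longrightarrow> 0 \<le> K \<Longrightarrow> AE x in lebesgue. \<bar>u x\<bar> \<le> (K / c) powr (1 / (p - 1))"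
proof -
  obtain c where c: "0 < c" and above: "\<And>u K. u \<in> W0 s p \<Omega> \<Longrightarrow> frac_lap_ge s p \<Omega> (- K) (\<lambda>x. - u x) \<Longrightarrow> 0 \<le> K \<Longrightarrow>
      AE x in lebesgue. u x \<le> (K / c) powr (1 / (p - 1))"
    using frac_lap_le_imp_bounded_above[OF assms] by blast
  have "AE x in lebesgue. \<bar>u x\<bar> \<le> (K / c) powr (1 / (p - 1))"
    if u: "u \<in> W0 s p \<Omega>" "frac_lap_ge s p \<Omega> (- K) u" "frac_lap_ge s p \<Omega> (- K) (\<lambda>x. - u x)"
        and K: "0 \<le> K" for u K
    using above[OF u(1,3) K] above[of "\<lambda>x. - u x" K] W0_uminus[OF u(1)] u(2) K
    by (auto elim: eventually_elim2 simp: abs_le_iff)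
  with c show ?thesis by (rule that)
qed

subsection \<open>The essential supremum norm\<close>

lemma Linf_norm_candidates:
  assumes "f \<in> Linf \<Omega>"
  shows "{C. 0 \<le> C \<and> (AE x in lebesgue. x \<in> \<Omega> \<longrightarrow> \<bar>f x\<bar> \<le> C)} \<noteq> {}"
proof -
  obtain C where "AE x in lebesgue. x \<in> \<Omega> \<longrightarrow> \<bar>f x\<bar> \<le> C" using assms by (auto simp: Linf_def)
  then have "AE x in lebesgue. x \<in> \<Omega> \<longrightarrow> \<bar>f x\<bar> \<le> max 0 C" by eventually_elim auto
  then show ?thesis by (auto intro!: exI[of _ "max 0 C"])
qed

lemma Linf_norm_nonneg: "f \<in> Linf \<Omega> \<Longrightarrow> 0 \<le> Linf_norm \<Omega> f"
  unfolding Linf_norm_def by (rule cInf_greatest[OF Linf_norm_candidates]) auto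

lemma Linf_norm_le:
  assumes "0 \<le> C" "AE x in lebesgue. x \<in> \<Omega> \<longrightarrow> \<bar>f x\<bar> \<le> C"
  shows "Linf_norm \<Omega> f \<le> C"
  unfolding Linf_norm_def by (rule cInf_lower) (use assms in \<open>auto intro!: bdd_belowI[of _ 0]\<close>)

lemma AE_le_Linf_norm:
  assumes "f \<in> Linf \<Omega>"
  shows "AE x in lebesgue. x \<in> \<Omega> \<longrightarrow> \<bar>f x\<bar> \<le> Linf_norm \<Omega> f"
proof (rule AE_le_if_AE_le_add)
  fix \<epsilon> :: real assume "0 < \<epsilon>"
  then obtain C where C: "AE x in lebesgue. x \<in> \<Omega> \<longrightarrow> \<bar>f x\<bar> \<le> C" "C < Linf_norm \<Omega> f + \<epsilon>"
    using cInf_lessD[OF Linf_norm_candidates[OF assms], of "Linf_norm \<Omega> f + \<epsilon>"]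
    unfolding Linf_norm_def by auto
  from C(1) show "AE x in lebesgue. x \<in> \<Omega> \<longrightarrow> \<bar>f x\<bar> \<le> Linf_norm \<Omega> f + \<epsilon>"
    by eventually_elim (use C(2) in auto)
qed

section \<open>Growth of supersolutions\<close>

subsection \<open>The contribution of the tail\<close>

definition growth :: "real \<Rightarrow> real \<Rightarrow> real" where
  "growth \<sigma> r = 2 * (r powr (\<sigma> / 16) - 1)"

lemma growth_mono: "0 \<le> \<sigma> \<Longrightarrow> 0 \<le> r \<Longrightarrow> r \<le> r' \<Longrightarrow> growth \<sigma> r \<le> growth \<sigma> r'"
  by (simp add: growth_def powr_mono2)

lemma growth_nonneg: "0 \<le> \<sigma> \<Longrightarrow> 1 \<le> r \<Longrightarrow> 0 \<le> growth \<sigma> r"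
  by (simp add: growth_def ge_one_powr_ge_zero)

text \<open>At unit scale and height, the far contribution to the operator when the values outside a ball grow like
  the \<open>\<sigma>/16\<close>-th power of the distance, as they do in the iteration of the oscillation estimate.\<close>
definition tail_kern :: "real \<Rightarrow> real \<Rightarrow> real \<Rightarrow> 'a::euclidean_space \<Rightarrow> real" where
  "tail_kern s p \<sigma> h = indicator {h. 1 / 8 \<le> norm h} h *
     ((\<sigma> + growth \<sigma> (32 * norm h)) powr (p - 1) * kern (p * s) h)"

lemma tail_kern_nonneg [simp]: "0 \<le> tail_kern s p \<sigma> h"
  by (simp add: tail_kern_def)

lemma tail_kern_measurable [measurable]: "tail_kern s p \<sigma> \<in> borel_measurable borel"
  unfolding tail_kern_def[abs_def] growth_def by measurable

lemma tail_kern_le: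
  assumes p: "1 \<le> p" and \<sigma>: "0 \<le> \<sigma>" "\<sigma> \<le> 2" "\<sigma> / 16 * (p - 1) \<le> b"
  shows "tail_kern s p \<sigma> h
    \<le> 2 powr (p - 1) * 32 powr b * (indicator {h. 1 / 8 \<le> norm h} h * kern (p * s - b) h)"
proof (cases "1 / 8 \<le> norm h")
  case True
  then have X: "1 \<le> 32 * norm h" by simp
  have "\<sigma> + growth \<sigma> (32 * norm h) \<le> 2 * (32 * norm h) powr (\<sigma> / 16)" "0 \<le> growth \<sigma> (32 * norm h)"
    using \<sigma> X growth_nonneg[of \<sigma> "32 * norm h"] by (auto simp: growth_def)
  then have "(\<sigma> + growth \<sigma> (32 * norm h)) powr (p - 1) \<le> (2 * (32 * norm h) powr (\<sigma> / 16)) powr (p - 1)"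
    using \<sigma> p by (intro powr_mono2) auto
  also have "\<dots> = 2 powr (p - 1) * (32 * norm h) powr (\<sigma> / 16 * (p - 1))"
    by (simp only: powr_mult powr_powr)
  also have "(32 * norm h) powr (\<sigma> / 16 * (p - 1)) \<le> (32 * norm h) powr b"
    using X \<sigma> by (intro powr_mono) auto
  also have "(32 * norm h) powr b = 32 powr b * norm h powr b"
    by (rule powr_mult)
  finally have "(\<sigma> + growth \<sigma> (32 * norm h)) powr (p - 1) \<le> 2 powr (p - 1) * 32 powr b * norm h powr b"
    by (simp add: mult.assoc)
  then have "(\<sigma> + growth \<sigma> (32 * norm h)) powr (p - 1) * kern (p * s) h
      \<le> 2 powr (p - 1) * 32 powr b * (norm h powr b * kern (p * s) h)"
    unfolding mult.assoc[symmetric] by (intro mult_right_mono) (simp_all add: mult.assoc)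
  then show ?thesis using True by (simp add: tail_kern_def norm_powr_mult_kern)
qed (simp add: tail_kern_def)

lemma tail_kern_tendsto_0:
  fixes S :: "nat \<Rightarrow> real"
  assumes p: "1 < p" and S: "\<And>n. 0 < S n" "S \<longlonglongrightarrow> 0"
  shows "(\<lambda>n. tail_kern s p (S n) h) \<longlonglongrightarrow> 0"
proof (cases "1 / 8 \<le> norm h")
  case True
  then have X: "1 \<le> 32 * norm h" "32 * norm h \<noteq> 0" by auto
  have "(\<lambda>n. S n + 2 * ((32 * norm h) powr (S n / 16) - 1)) \<longlonglongrightarrow> 0 + 2 * ((32 * norm h) powr (0 / 16) - 1)"
    using X by (intro tendsto_intros S(2)) auto
  then have lim: "(\<lambda>n. S n + growth (S n) (32 * norm h)) \<longlonglongrightarrow> 0" using X by (simp add: growth_def)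
  have "0 \<le> S n + growth (S n) (32 * norm h)" for n
    using growth_nonneg[of "S n" "32 * norm h"] X S(1)[of n] by simp
  then have "(\<lambda>n. (S n + growth (S n) (32 * norm h)) powr (p - 1)) \<longlonglongrightarrow> 0 powr (p - 1)"
    using p by (intro tendsto_powr2[OF lim tendsto_const]) auto
  then have "(\<lambda>n. (S n + growth (S n) (32 * norm h)) powr (p - 1) * kern (p * s) h) \<longlonglongrightarrow> 0 * kern (p * s) h"
    by (intro tendsto_intros) auto
  then show ?thesis using True by (simp add: tail_kern_def)
qed (simp add: tail_kern_def)

lemma nn_integral_tail_kern_tendsto_0:
  assumes p: "1 < p" and s: "0 < s"
  shows "((\<lambda>\<sigma>. \<integral>\<^sup>+ h. ennreal (tail_kern s p \<sigma> (h :: 'a::euclidean_space)) \<partial>lborel) \<longlongrightarrow> 0) (at_right 0)"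
proof (rule tendsto_at_right_sequentially)
  define \<sigma>\<^sub>0 where "\<sigma>\<^sub>0 = min 2 (8 * p * s / (p - 1))"
  show "0 < \<sigma>\<^sub>0" using p s by (simp add: \<sigma>\<^sub>0_def)
  let ?w = "\<lambda>h::'a. 2 powr (p - 1) * 32 powr (p * s / 2) * (indicator {h. 1 / 8 \<le> norm h} h *
    kern (p * s - p * s / 2) h)"
  fix S :: "nat \<Rightarrow> real"
  assume S: "\<And>n. 0 < S n" "\<And>n. S n < \<sigma>\<^sub>0" "S \<longlonglongrightarrow> 0"
  have "S n / 16 * (p - 1) \<le> p * s / 2" for n
  proof -
    have "S n \<le> 8 * p * s / (p - 1)" using S(2)[of n] by (simp add: \<sigma>\<^sub>0_def)
    then show ?thesis using p by (simp add: field_simps)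
  qed
  then have le: "tail_kern s p (S n) h \<le> ?w h" for n and h :: 'a
    using S(1,2)[of n] p by (intro tail_kern_le) (auto simp: \<sigma>\<^sub>0_def)
  have "(\<integral>\<^sup>+ h. ennreal (?w h) \<partial>lborel)
      = ennreal (2 powr (p - 1) * 32 powr (p * s / 2)) *
        (\<integral>\<^sup>+ h. ennreal (indicator {h. 1 / 8 \<le> norm h} h * kern (p * s - p * s / 2) (h::'a)) \<partial>lborel)"
    by (subst nn_integral_cmult[symmetric]) (auto simp: ennreal_mult)
  also have "\<dots> < \<infinity>"
    using nn_integral_kern_outside_ball[of "p * s - p * s / 2" "1 / 8", where 'a = 'a] p s
    by (simp add: ennreal_mult_less_top)
  finally have finite: "(\<integral>\<^sup>+ h. ennreal (?w h) \<partial>lborel) < \<infinity>" .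
  have "(\<lambda>n. ennreal (tail_kern s p (S n) h)) \<longlonglongrightarrow> 0" for h :: 'a
    using tendsto_ennrealI[OF tail_kern_tendsto_0[OF p S(1,3), of s h]] by simp
  then have "(\<lambda>n. \<integral>\<^sup>+ h. ennreal (tail_kern s p (S n) (h :: 'a)) \<partial>lborel)
    \<longlonglongrightarrow> (\<integral>\<^sup>+ h. (0::ennreal) \<partial>(lborel :: 'a measure))"
    by (intro nn_integral_dominated_convergence[where w = "\<lambda>h. ennreal (?w h)"])
        (use le finite in \<open>auto intro!: ennreal_leI\<close>)
  then show "(\<lambda>n. \<integral>\<^sup>+ h. ennreal (tail_kern s p (S n) (h :: 'a)) \<partial>lborel) \<longlonglongrightarrow> 0" by simp
qed

subsection \<open>Choice of the parameters\<close>

text \<open>At unit scale and height, a lower bound for the contribution to the operator of a set with the volume of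
  \<open>ball 0 (1 / 16)\<close> and at distance at most 2 on which the function exceeds the barrier by at least 1/2.\<close>
definition density_gain :: "real \<Rightarrow> real \<Rightarrow> 'a::euclidean_space itself \<Rightarrow> real" where
  "density_gain s p _ =
     (1 / 2) powr (p - 1) * (2 powr (- (real DIM('a) + p * s)) * measure lebesgue (ball (0::'a) (1 / 16)))"

lemma density_gain_pos: "0 < density_gain s p (ty :: 'a::euclidean_space itself)"
  using content_ball_gt_0_iff[of "0::'a" "1 / 16"] by (simp add: density_gain_def)

text \<open>The gain by density dominates both the barrier of height \<open>\<sigma>\<close> and the tail.\<close>
locale growth_parameters =
  fixes s p \<sigma> :: real and i :: nat and ty :: "(real^'n) itself"
  assumes p: "1 < p" and s: "0 < s" "s < 1" and \<sigma>: "0 < \<sigma>" "\<sigma> \<le> 1 / 2" "\<sigma> / 16 * (p - 1) \<le> p * s"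
    and barrier_operator_le: "\<And>(x0::real^'n) x \<rho> \<epsilon>. 0 < \<rho> \<Longrightarrow> x \<in> ball x0 \<rho> \<Longrightarrow>
      \<sigma> powr (p - 1) * barrier_operator s p i \<epsilon> x0 \<rho> x \<le> density_gain s p ty / 4 * (8 * \<rho>) powr (- (p * s))"
    and tail_le: "(\<integral>\<^sup>+ h. ennreal (tail_kern s p \<sigma> (h :: real^'n)) \<partial>lborel)
      \<le> ennreal (density_gain s p ty / 4)"

lemma small_barrier_height_exists:
  fixes s p C m \<sigma>\<^sub>0 :: real
  assumes p: "1 < p" and s: "0 < s" and pos: "0 < m" "0 < \<sigma>\<^sub>0"
  obtains \<sigma> where "0 < \<sigma>" "\<sigma> < \<sigma>\<^sub>0" "\<sigma> powr (p - 1) * C < m"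
    "(\<integral>\<^sup>+ h. ennreal (tail_kern s p \<sigma> (h :: 'a::euclidean_space)) \<partial>lborel) < ennreal m"
proof -
  have "\<forall>\<^sub>F \<sigma> in at_right 0. (\<integral>\<^sup>+ h. ennreal (tail_kern s p \<sigma> (h :: 'a)) \<partial>lborel) < ennreal m"
    using pos by (intro order_tendstoD(2)[OF nn_integral_tail_kern_tendsto_0[OF p s]]) simp
  moreover have "((\<lambda>\<sigma>. \<sigma> powr (p - 1) * C) \<longlongrightarrow> 0 powr (p - 1) * C) (at_right 0)"
    using p by (intro tendsto_mult tendsto_powr2 tendsto_const tendsto_ident_at)
      (auto simp: eventually_at_filter)
  then have "\<forall>\<^sub>F \<sigma> in at_right 0. \<sigma> powr (p - 1) * C < m"
    using pos by (intro order_tendstoD(2)) auto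
  moreover have "\<forall>\<^sub>F \<sigma> in at_right 0. \<sigma> \<in> {0<..<\<sigma>\<^sub>0}"
    using pos by (intro eventually_at_rightI[of 0 \<sigma>\<^sub>0])
  ultimately have "\<forall>\<^sub>F \<sigma> in at_right 0. \<sigma> \<in> {0<..<\<sigma>\<^sub>0} \<and> \<sigma> powr (p - 1) * C < m \<and>
      (\<integral>\<^sup>+ h. ennreal (tail_kern s p \<sigma> (h :: 'a)) \<partial>lborel) < ennreal m"
    by eventually_elim blast
  from eventually_happens[OF this] show ?thesis by (auto intro: that)
qed

lemma growth_parameters_exist:
  fixes s p :: real
  assumes p: "1 < p" and s: "0 < s" "s < 1"
  obtains \<sigma> i where "growth_parameters s p \<sigma> i TYPE(real^'n)" "\<sigma> / 16 \<le> s"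
proof -
  define m where "m = density_gain s p TYPE(real^'n) / 4"
  have m: "0 < m" by (simp add: m_def density_gain_pos)
  obtain i :: nat where "1 / (p - 1) \<le> real i" using real_arch_simple by blast
  then have "1 \<le> real i * (p - 1)" using p by (simp add: field_simps)
  also have "\<dots> \<le> (2 * real i + 1) * (p - 1)" using p by (intro mult_right_mono) auto
  finally obtain C where barrier: "\<And>(x0::real^'n) x \<rho> \<epsilon>. 0 < \<rho> \<Longrightarrow> x \<in> ball x0 \<rho> \<Longrightarrow>
      barrier_operator s p i \<epsilon> x0 \<rho> x \<le> C * \<rho> powr (- (p * s))"
    by (rule barrier_operator_bounded[OF p s(2)]) (rule that)
  have "0 < min (1 / 2) (min (16 * s) (16 * p * s / (p - 1)))" using p s by simp
  then obtain \<sigma> where \<sigma>: "0 < \<sigma>" "\<sigma> < min (1 / 2) (min (16 * s) (16 * p * s / (p - 1)))"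
    and \<sigma>C: "\<sigma> powr (p - 1) * (C * 8 powr (p * s)) < m"
    and tail: "(\<integral>\<^sup>+ h. ennreal (tail_kern s p \<sigma> (h :: real^'n)) \<partial>lborel) < ennreal m"
    by (rule small_barrier_height_exists[OF p s(1) m]) (rule that)
  have "growth_parameters s p \<sigma> i TYPE(real^'n)"
  proof
    fix x0 x :: "real^'n" and \<rho> \<epsilon> :: real
    assume \<rho>: "0 < \<rho>" and x: "x \<in> ball x0 \<rho>"
    have "\<sigma> powr (p - 1) * barrier_operator s p i \<epsilon> x0 \<rho> x \<le> \<sigma> powr (p - 1) * (C * \<rho> powr (- (p * s)))"
      using barrier[OF \<rho> x] by (intro mult_left_mono) auto
    also have "\<dots> = \<sigma> powr (p - 1) * (C * 8 powr (p * s)) * (8 * \<rho>) powr (- (p * s))"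
      by (simp add: powr_mult powr_minus)
    also have "\<dots> \<le> m * (8 * \<rho>) powr (- (p * s))"
      using \<sigma>C by (intro mult_right_mono) auto
    finally show "\<sigma> powr (p - 1) * barrier_operator s p i \<epsilon> x0 \<rho> x
        \<le> density_gain s p TYPE(real^'n) / 4 * (8 * \<rho>) powr (- (p * s))" by (simp only: m_def)
  next
    show "\<sigma> / 16 * (p - 1) \<le> p * s" using \<sigma> p by (simp add: field_simps)
  qed (use p s \<sigma> tail in \<open>auto simp: m_def\<close>)
  then show ?thesis using that \<sigma> by simp
qed

subsection \<open>The truncated operator\<close>

lemma integrable_kern_truncated:
  assumes "0 < a" "0 < \<epsilon>"
  shows "integrable lebesgue (\<lambda>y. indicator {y. \<epsilon> \<le> norm (x - y)} y *
    kern a (x - y :: 'a::euclidean_space))"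
proof (rule integrableI_bounded)
  show "(\<lambda>y. indicator {y. \<epsilon> \<le> norm (x - y)} y * kern a (x - y)) \<in> borel_measurable lebesgue"
    by (rule measurable_completion) measurable
  let ?g = "\<lambda>h::'a. ennreal (indicator {h. \<epsilon> \<le> norm h} h * kern a h)"
  have "(\<integral>\<^sup>+ y. ennreal (norm (indicator {y. \<epsilon> \<le> norm (x - y)} y * kern a (x - y))) \<partial>lebesgue)
    = (\<integral>\<^sup>+ y. ?g (x - y) \<partial>lebesgue)"
    by (intro nn_integral_cong) (auto simp: indicator_def)
  also have "\<dots> = (\<integral>\<^sup>+ h. ?g h \<partial>lborel)" by (rule nn_integral_lebesgue_reflect) measurable
  also have "\<dots> < \<infinity>" using assms by (rule nn_integral_kern_outside_ball)
  finally show "(\<integral>\<^sup>+ y. ennreal (norm (indicator {y. \<epsilon> \<le> norm (x - y)} y *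
    kern a (x - y))) \<partial>lebesgue) < \<infinity>" .
qed

lemma integrable_bounded_mult_kern_truncated:
  fixes u :: "'a::euclidean_space \<Rightarrow> real"
  assumes [measurable]: "u \<in> borel_measurable lebesgue" and B: "AE y in lebesgue. \<bar>u y\<bar> \<le> B" and a: "0 < a"
      and \<epsilon>: "0 < \<epsilon>"
  shows "integrable lebesgue (\<lambda>y. indicator {y. \<epsilon> \<le> norm (x - y)} y * (u y * kern a (x - y)))"
proof (rule Bochner_Integration.integrable_bound)
  show "integrable lebesgue (\<lambda>y. B * (indicator {y. \<epsilon> \<le> norm (x - y)} y * kern a (x - y)))"
    using integrable_kern_truncated[OF a \<epsilon>, of x] by simp
  have [measurable]: "(\<lambda>y. kern a (x - y)) \<in> borel_measurable lebesgue"
      "(\<lambda>y. norm (x - y)) \<in> borel_measurable lebesgue"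
    by (rule measurable_completion, measurable)+
  show "(\<lambda>y. indicator {y. \<epsilon> \<le> norm (x - y)} y * (u y * kern a (x - y))) \<in> borel_measurable lebesgue"
    by measurable
  show "AE y in lebesgue. norm (indicator {y. \<epsilon> \<le> norm (x - y)} y * (u y * kern a (x - y)))
      \<le> norm (B * (indicator {y. \<epsilon> \<le> norm (x - y)} y * kern a (x - y)))"
    using B by eventually_elim (auto simp: indicator_def abs_mult intro!: mult_right_mono)
qed

lemma measure_lebesgue_ball_scale:
  "0 < r \<Longrightarrow> 0 \<le> t \<Longrightarrow> measure lebesgue (ball (x :: 'a::euclidean_space) (r * t))
    = r ^ DIM('a) * measure lebesgue (ball (0::'a) t)"
  using content_ball[of "r * t" x] content_ball[of t "0::'a"] by (simp add: power_mult_distrib)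

locale growth_situation = growth_parameters s p \<sigma> i ty
  for s p \<sigma> :: real and i :: nat and ty :: "(real^'n) itself" +
  fixes x0 :: "real^'n" and R \<mu> M :: real and A :: "(real^'n) set" and V :: "real^'n \<Rightarrow> real"
  assumes R: "0 < R" and \<mu>: "0 < \<mu>"
    and A: "A \<in> sets lebesgue" "A \<subseteq> ball x0 R - ball x0 (R / 4)"
      "measure lebesgue (ball x0 (R / 16)) \<le> measure lebesgue A"
    and V_measurable [measurable]: "V \<in> borel_measurable lebesgue"
    and V_bounded: "AE y in lebesgue. \<bar>V y\<bar> \<le> M"
    and V_nonneg: "AE y in lebesgue. y \<in> ball x0 R \<longrightarrow> 0 \<le> V y"
    and V_tail: "AE y in lebesgue. y \<notin> ball x0 R \<longrightarrow> - (\<mu> * growth \<sigma> (16 * dist x0 y / R)) \<le> V y"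
    and V_dense: "AE y in lebesgue. y \<in> A \<longrightarrow> \<mu> \<le> V y"
begin

definition bump :: "real^'n \<Rightarrow> real" where
  "bump x = \<sigma> * \<mu> * barrier i x0 (R / 8) x"

abbreviation gain :: real where
  "gain \<equiv> density_gain s p ty * (\<mu> powr (p - 1) * R powr (- (p * s)))"

definition near_bound :: "real \<Rightarrow> real^'n \<Rightarrow> real^'n \<Rightarrow> real" where
  "near_bound \<epsilon> x y = indicator {y. \<epsilon> \<le> norm (x - y) \<and> norm (x - y) < R / 8} y * ((\<sigma> * \<mu>) powr (p - 1) *
     (spow (barrier i x0 (R / 8) x - barrier i x0 (R / 8) y) (p - 1) * kern (p * s) (x - y)))"

definition far_bound :: "real^'n \<Rightarrow> real^'n \<Rightarrow> real" where
  "far_bound x y =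
     \<mu> powr (p - 1) * (R powr (- (real DIM(real^'n) + p * s)) * tail_kern s p \<sigma> ((y - x) /\<^sub>R R))"

definition dense_bound :: real where
  "dense_bound = (\<mu> / 2) powr (p - 1) * (2 * R) powr (- (real DIM(real^'n) + p * s))"

lemma far_bound_nonneg: "0 \<le> far_bound x y"
  by (simp add: far_bound_def)

lemma ps_pos: "0 < p * s"
  using p s by simp

lemma \<sigma>\<mu>: "0 < \<sigma> * \<mu>" "\<sigma> * \<mu> \<le> \<mu> / 2"
  using \<sigma> \<mu> mult_right_mono[of \<sigma> "1 / 2" \<mu>] by auto

lemma bump_measurable [measurable]: "bump \<in> borel_measurable lebesgue"
  unfolding bump_def[abs_def] by (rule measurable_completion) measurable

lemma bump_nonneg: "0 \<le> bump x"
  using \<sigma>\<mu> by (simp add: bump_def)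

lemma bump_le: "bump x \<le> \<sigma> * \<mu>"
  using \<sigma>\<mu> barrier_le_1[of i x0 "R / 8" x] by (simp add: bump_def mult_left_le del: barrier_le_1)

lemma bump_outside: "x \<notin> ball x0 (R / 8) \<Longrightarrow> bump x = 0"
  using barrier_outside[of "R / 8" x x0 i] R by (simp add: bump_def)

lemma operator_near_le:
  assumes "bump y \<le> V y"
  shows "spow (bump x - V y) (p - 1) * kern (p * s) (x - y)
    \<le> (\<sigma> * \<mu>) powr (p - 1) *
      (spow (barrier i x0 (R / 8) x - barrier i x0 (R / 8) y) (p - 1) * kern (p * s) (x - y))"
proof -
  have "spow (bump x - V y) (p - 1)
    \<le> spow (\<sigma> * \<mu> * (barrier i x0 (R / 8) x - barrier i x0 (R / 8) y)) (p - 1)"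
    using assms p by (intro spow_mono) (auto simp: bump_def algebra_simps)
  also have "\<dots> = (\<sigma> * \<mu>) powr (p - 1) * spow (barrier i x0 (R / 8) x - barrier i x0 (R / 8) y) (p - 1)"
    using \<sigma>\<mu> by (intro spow_mult) simp
  finally show ?thesis unfolding mult.assoc[symmetric] by (intro mult_right_mono) auto
qed

lemma operator_dense_le:
  assumes x: "x \<in> ball x0 R" and y: "y \<in> ball x0 R" "x \<noteq> y" "\<mu> \<le> V y"
  shows "spow (bump x - V y) (p - 1) * kern (p * s) (x - y) \<le> - dense_bound"
proof -
  have "bump x - V y \<le> - (\<mu> / 2)" using bump_le[of x] \<sigma>\<mu> y by linarith
  then have "spow (bump x - V y) (p - 1) \<le> spow (- (\<mu> / 2)) (p - 1)"
    using p by (intro spow_mono) auto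
  then have "spow (bump x - V y) (p - 1) \<le> - ((\<mu> / 2) powr (p - 1))"
    using \<mu> by (simp add: spow_nonpos_eq)
  then have "spow (bump x - V y) (p - 1) * kern (p * s) (x - y)
    \<le> - ((\<mu> / 2) powr (p - 1)) * kern (p * s) (x - y)"
    by (intro mult_right_mono) auto
  moreover have "(2 * R) powr (- (real DIM(real^'n) + p * s)) \<le> kern (p * s) (x - y)"
  proof (rule kern_ge)
    show "norm (x - y) \<le> 2 * R"
      using x y dist_triangle2[of x y x0] by (simp add: dist_norm norm_minus_commute)
  qed (use y ps_pos in auto)
  then have "dense_bound \<le> (\<mu> / 2) powr (p - 1) * kern (p * s) (x - y)"
    unfolding dense_bound_def by (intro mult_left_mono) auto
  ultimately show ?thesis by linarith
qed

lemma negative_part_le_growth: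
  assumes x: "x \<in> ball x0 (R / 8)" and far: "R / 8 \<le> norm (x - y)"
    and inside: "y \<in> ball x0 R \<longrightarrow> 0 \<le> V y"
    and outside: "y \<notin> ball x0 R \<longrightarrow> - (\<mu> * growth \<sigma> (16 * dist x0 y / R)) \<le> V y"
  shows "- V y \<le> \<mu> * growth \<sigma> (32 * (norm (x - y) / R))"
proof (cases "y \<in> ball x0 R")
  case True
  have "0 \<le> growth \<sigma> (32 * (norm (x - y) / R))"
    using \<sigma> R far by (intro growth_nonneg) (auto simp: field_simps)
  then have "0 \<le> \<mu> * growth \<sigma> (32 * (norm (x - y) / R))" using \<mu> by simp
  with True inside show ?thesis by linarith
next
  case False
  have "dist x0 y \<le> 2 * norm (x - y)"
    using dist_triangle[of x0 y x] x far by (simp add: dist_norm)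
  then have "growth \<sigma> (16 * dist x0 y / R) \<le> growth \<sigma> (32 * (norm (x - y) / R))"
    using \<sigma> R by (intro growth_mono) (auto simp: field_simps)
  then have "\<mu> * growth \<sigma> (16 * dist x0 y / R) \<le> \<mu> * growth \<sigma> (32 * (norm (x - y) / R))"
    using \<mu> by (intro mult_left_mono) auto
  with False outside show ?thesis by linarith
qed

lemma operator_far_le:
  assumes x: "x \<in> ball x0 (R / 8)" and far: "R / 8 \<le> norm (x - y)"
    and inside: "y \<in> ball x0 R \<longrightarrow> 0 \<le> V y"
    and outside: "y \<notin> ball x0 R \<longrightarrow> - (\<mu> * growth \<sigma> (16 * dist x0 y / R)) \<le> V y"
  shows "spow (bump x - V y) (p - 1) * kern (p * s) (x - y) \<le> far_bound x y"
proof -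
  define h where "h = (y - x) /\<^sub>R R"
  have h: "norm h = norm (x - y) / R"
    unfolding h_def using norm_centred_scale[OF R, of y x] by (simp add: dist_norm)
  have h8: "1 / 8 \<le> norm h" unfolding h using R far by (simp add: field_simps)
  then have G: "0 \<le> growth \<sigma> (32 * norm h)" using \<sigma> by (intro growth_nonneg) auto
  have "- V y \<le> \<mu> * growth \<sigma> (32 * norm h)"
    unfolding h using assms by (rule negative_part_le_growth)
  then have "bump x - V y \<le> \<mu> * (\<sigma> + growth \<sigma> (32 * norm h))"
    using bump_le[of x] by (simp add: algebra_simps)
  then have "spow (bump x - V y) (p - 1) \<le> spow (\<mu> * (\<sigma> + growth \<sigma> (32 * norm h))) (p - 1)"
    using p by (intro spow_mono) auto
  also have "\<dots> = \<mu> powr (p - 1) * (\<sigma> + growth \<sigma> (32 * norm h)) powr (p - 1)"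
    using \<mu> \<sigma> G by (simp add: spow_nonneg_eq powr_mult)
  finally have "spow (bump x - V y) (p - 1) * kern (p * s) (x - y)
      \<le> \<mu> powr (p - 1) * (\<sigma> + growth \<sigma> (32 * norm h)) powr (p - 1) * kern (p * s) (x - y)"
    by (intro mult_right_mono) auto
  also have "\<dots> = \<mu> powr (p - 1) * (\<sigma> + growth \<sigma> (32 * norm h)) powr (p - 1) *
      (R powr (- (real DIM(real^'n) + p * s)) * kern (p * s) h)"
    using kern_scaleR[OF R, of "p * s" h] R kern_commute[of "p * s" x y] by (simp add: h_def)
  also have "\<dots> = \<mu> powr (p - 1) * (R powr (- (real DIM(real^'n) + p * s)) * tail_kern s p \<sigma> h)"
    using h8 by (simp add: tail_kern_def)
  finally show ?thesis by (simp only: h_def far_bound_def)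
qed

lemma near_bound_integrable:
  assumes "0 < \<epsilon>"
  shows "integrable lebesgue (near_bound \<epsilon> x)"
proof -
  let ?b = "barrier i x0 (R / 8)"
  have [measurable]: "?b \<in> borel_measurable lebesgue" "(\<lambda>y. norm (x - y)) \<in> borel_measurable lebesgue"
    by (rule measurable_completion, measurable)+
  have "\<bar>spow (?b x - ?b y) (p - 1)\<bar> \<le> 1" for y
    unfolding abs_spow using p abs_barrier_diff_le_1[of i x0 "R / 8" x y] by (intro powr_le1) auto
  then have "integrable lebesgue (\<lambda>y. indicator {y. \<epsilon> \<le> norm (x - y)} y *
      (indicator {y. norm (x - y) < R / 8} y * spow (?b x - ?b y) (p - 1) * kern (p * s) (x - y)))"
    by (intro integrable_bounded_mult_kern_truncated[OF _ _ ps_pos assms, where B = 1])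
      (measurable, auto simp: indicator_def)
  moreover have "near_bound \<epsilon> x = (\<lambda>y. (\<sigma> * \<mu>) powr (p - 1) * (indicator {y. \<epsilon> \<le> norm (x - y)} y *
      (indicator {y. norm (x - y) < R / 8} y * spow (?b x - ?b y) (p - 1) * kern (p * s) (x - y))))"
    by (auto simp: near_bound_def fun_eq_iff indicator_def)
  ultimately show ?thesis by simp
qed

lemma near_bound_integral_le:
  assumes x: "x \<in> ball x0 (R / 8)"
  shows "integral\<^sup>L lebesgue (near_bound \<epsilon> x) \<le> gain / 4"
proof -
  have g: "near_bound \<epsilon> x \<in> borel_measurable borel" unfolding near_bound_def[abs_def] by measurable
  then have "integral\<^sup>L lebesgue (near_bound \<epsilon> x)
    = integral\<^sup>L (distr lborel borel ((+) x)) (near_bound \<epsilon> x)"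
    by (simp add: integral_completion lborel_distr_plus)
  also have "\<dots> = (\<integral>h. near_bound \<epsilon> x (x + h) \<partial>lborel)" using g by (intro integral_distr) auto
  also have "\<dots> = (\<integral>h. (\<sigma> * \<mu>) powr (p - 1) * (indicator {h. \<epsilon> \<le> norm h \<and> norm h < R / 8} h *
      (spow (barrier i x0 (R / 8) x - barrier i x0 (R / 8) (x + h)) (p - 1) * kern (p * s) h)) \<partial>lborel)"
    by (intro Bochner_Integration.integral_cong) (auto simp: near_bound_def indicator_def)
  also have "\<dots> = \<mu> powr (p - 1) * (\<sigma> powr (p - 1) * barrier_operator s p i \<epsilon> x0 (R / 8) x)"
    unfolding barrier_operator_def integral_mult_right_zero by (simp add: powr_mult)
  also have "\<dots> \<le> \<mu> powr (p - 1) * (density_gain s p ty / 4 * R powr (- (p * s)))"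
    using barrier_operator_le[of "R / 8" x x0 \<epsilon>] x R by (intro mult_left_mono) auto
  also have "\<dots> = gain / 4" by simp
  finally show ?thesis .
qed

lemma far_bound_integral_le:
  shows "integrable lebesgue (far_bound x)" "integral\<^sup>L lebesgue (far_bound x) \<le> gain / 4"
proof -
  have gain: "0 \<le> gain" using density_gain_pos[of s p ty] by simp
  have "(\<integral>\<^sup>+ y. ennreal (far_bound x y) \<partial>lebesgue) = (\<integral>\<^sup>+ y. ennreal (\<mu> powr (p - 1)) *
      (ennreal (R powr (- (real DIM(real^'n) + p * s))) *
        ennreal (tail_kern s p \<sigma> ((y - x) /\<^sub>R R))) \<partial>lborel)"
    unfolding far_bound_def nn_integral_completion by (intro nn_integral_cong) (simp add: ennreal_mult)
  also have "\<dots> = ennreal (\<mu> powr (p - 1)) *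
      (ennreal (R powr (- (p * s))) * (\<integral>\<^sup>+ h. ennreal (tail_kern s p \<sigma> (h :: real^'n)) \<partial>lborel))"
    using R by (subst nn_integral_cmult, measurable, subst nn_integral_lborel_kern_scale) auto
  also have "\<dots>
    \<le> ennreal (\<mu> powr (p - 1)) * (ennreal (R powr (- (p * s))) * ennreal (density_gain s p ty / 4))"
    using tail_le by (intro mult_left_mono) auto
  also have "\<dots> = ennreal (gain / 4)" by (simp add: ennreal_mult'[symmetric] mult_ac)
  finally have le: "(\<integral>\<^sup>+ y. ennreal (far_bound x y) \<partial>lebesgue) \<le> ennreal (gain / 4)" .
  then show "integral\<^sup>L lebesgue (far_bound x) \<le> gain / 4" using gain by (intro integral_real_bounded) auto
  show "integrable lebesgue (far_bound x)"
  proof (rule integrableI_bounded)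
    show "far_bound x \<in> borel_measurable lebesgue"
      unfolding far_bound_def[abs_def] by (rule measurable_completion) measurable
    show "(\<integral>\<^sup>+ y. ennreal (norm (far_bound x y)) \<partial>lebesgue) < \<infinity>"
      using le_less_trans[OF le] far_bound_nonneg by simp
  qed
qed

lemma gain_le_dense_bound: "gain \<le> dense_bound * measure lebesgue A"
proof -
  let ?N = "real DIM(real^'n)" and ?m = "measure lebesgue (ball (0::real^'n) (1 / 16))"
  have "(2 * R) powr (- (?N + p * s)) * R ^ DIM(real^'n) = 2 powr (- (?N + p * s)) * R powr (- (p * s))"
    using R by (simp add: powr_mult mult.assoc flip: powr_realpow powr_add)
  moreover have "(\<mu> / 2) powr (p - 1) = (1 / 2) powr (p - 1) * \<mu> powr (p - 1)"
    by (simp flip: powr_mult)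
  ultimately have "gain = (\<mu> / 2) powr (p - 1) * ((2 * R) powr (- (?N + p * s)) * R ^ DIM(real^'n)) * ?m"
    unfolding density_gain_def by (simp only: mult_ac)
  also have "\<dots> = dense_bound * measure lebesgue (ball x0 (R * (1 / 16)))"
    unfolding dense_bound_def using R
    by (subst measure_lebesgue_ball_scale) (simp_all only: mult_ac zero_le_divide_1_iff zero_le_numeral)
  also have "\<dots> \<le> dense_bound * measure lebesgue A"
    using A(3) by (intro mult_left_mono) (auto simp: dense_bound_def)
  finally show ?thesis .
qed

lemma truncated_operator_pointwise_le:
  assumes x: "x \<in> ball x0 (R / 8)" and \<epsilon>: "0 < \<epsilon>" "\<epsilon> \<le> R / 8"
    and bump: "y \<in> ball x0 R \<longrightarrow> bump y \<le> V y" and dense: "y \<in> A \<longrightarrow> \<mu> \<le> V y"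
    and tail: "y \<notin> ball x0 R \<longrightarrow> - (\<mu> * growth \<sigma> (16 * dist x0 y / R)) \<le> V y"
  shows "indicator {y. \<epsilon> \<le> norm (x - y)} y * (spow (bump x - V y) (p - 1) * kern (p * s) (x - y))
    \<le> near_bound \<epsilon> x y + far_bound x y - dense_bound * indicator A y"
    (is "?F \<le> _")
proof -
  note far0 = far_bound_nonneg[of x y]
  have A_far: "R / 8 \<le> norm (x - y)" if "y \<in> A"
    using that A(2) x dist_triangle[of x0 y x] by (auto simp: dist_norm)
  consider "norm (x - y) < \<epsilon>" | "\<epsilon> \<le> norm (x - y)" "norm (x - y) < R / 8"
    | "R / 8 \<le> norm (x - y)" "y \<in> A" | "R / 8 \<le> norm (x - y)" "y \<notin> A" by linarith
  then show ?thesis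
  proof cases
    case 1
    then have "y \<notin> A" using A_far \<epsilon> by auto
    then have "?F = 0" "near_bound \<epsilon> x y = 0" "dense_bound * indicator A y = 0"
      using 1 \<epsilon> by (auto simp: near_bound_def)
    then show ?thesis using far0 by linarith
  next
    case 2
    then have "y \<in> ball x0 R" using x R dist_triangle[of x0 y x] by (simp add: dist_norm)
    then have "?F \<le> near_bound \<epsilon> x y" using 2 bump operator_near_le[of y x] by (simp add: near_bound_def)
    moreover have "dense_bound * indicator A y = 0" using 2 A_far by (auto simp: indicator_def)
    ultimately show ?thesis using far0 by linarith
  next
    case 3
    have "y \<in> ball x0 R" "\<mu> \<le> V y" using A(2) dense 3 by blast+
    moreover have "x \<in> ball x0 R" "x \<noteq> y" using x R 3 by auto
    ultimately have "?F \<le> - dense_bound" using operator_dense_le[of x y] 3 \<epsilon> by simp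
    moreover have "near_bound \<epsilon> x y = 0" "dense_bound * indicator A y = dense_bound"
      using 3 by (auto simp: near_bound_def)
    ultimately show ?thesis using far0 by linarith
  next
    case 4
    have "y \<in> ball x0 R \<longrightarrow> 0 \<le> V y" using bump bump_nonneg[of y] by auto
    then have "?F \<le> far_bound x y" using operator_far_le[OF x 4(1) _ tail] 4(1) \<epsilon> by simp
    moreover have "near_bound \<epsilon> x y = 0" "dense_bound * indicator A y = 0" using 4
        by (auto simp: near_bound_def)
    ultimately show ?thesis by linarith
  qed
qed

lemma truncated_operator_le:
  assumes x: "x \<in> ball x0 (R / 8)" and \<epsilon>: "0 < \<epsilon>" "\<epsilon> \<le> R / 8"
    and bump_le_V: "AE y in lebesgue. y \<in> ball x0 R \<longrightarrow> bump y \<le> V y"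
  shows "(\<integral>y. indicator {y. \<epsilon> \<le> norm (x - y)} y *
      (spow (bump x - V y) (p - 1) * kern (p * s) (x - y)) \<partial>lebesgue)
    \<le> - (gain / 2)" (is "integral\<^sup>L lebesgue ?F \<le> _")
proof -
  have "AE y in lebesgue. ?F y \<le> near_bound \<epsilon> x y + far_bound x y - dense_bound * indicator A y"
    using bump_le_V V_dense V_tail
    by eventually_elim (rule truncated_operator_pointwise_le[OF x \<epsilon>])
  moreover have "integrable lebesgue ?F"
  proof (rule integrable_bounded_mult_kern_truncated[OF _ _ ps_pos \<epsilon>(1)])
    show "AE y in lebesgue. \<bar>spow (bump x - V y) (p - 1)\<bar> \<le> (\<sigma> * \<mu> + M) powr (p - 1)"
      using V_bounded
    proof eventually_elim
      fix y assume "\<bar>V y\<bar> \<le> M"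
      then have "\<bar>bump x - V y\<bar> \<le> \<sigma> * \<mu> + M" using bump_nonneg[of x] bump_le[of x] by linarith
      then show "\<bar>spow (bump x - V y) (p - 1)\<bar> \<le> (\<sigma> * \<mu> + M) powr (p - 1)"
        unfolding abs_spow using p by (intro powr_mono2) auto
    qed
  qed measurable
  moreover note near = near_bound_integrable[OF \<epsilon>(1), of x]
  moreover note far = far_bound_integral_le[of x]
  moreover have dense: "integrable lebesgue (\<lambda>y. dense_bound * indicator A y)"
    "(\<integral>y. dense_bound * indicator A y \<partial>lebesgue) = dense_bound * measure lebesgue A"
  proof -
    have "emeasure lebesgue A \<le> emeasure lebesgue (ball x0 R)" using A by (intro emeasure_mono) auto
    also have "\<dots> < \<infinity>" by (rule emeasure_lebesgue_bounded_open) auto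
    finally show "integrable lebesgue (\<lambda>y. dense_bound * indicator A y)"
      "(\<integral>y. dense_bound * indicator A y \<partial>lebesgue) = dense_bound * measure lebesgue A"
      using A(1) by simp_all
  qed
  ultimately have "integral\<^sup>L lebesgue ?F
      \<le> (\<integral>y. near_bound \<epsilon> x y + far_bound x y - dense_bound * indicator A y \<partial>lebesgue)"
    by (intro integral_mono_AE Bochner_Integration.integrable_add Bochner_Integration.integrable_diff)
  also have "\<dots> = integral\<^sup>L lebesgue (near_bound \<epsilon> x) + integral\<^sup>L lebesgue (far_bound x)
      - dense_bound * measure lebesgue A"
    using near far(1) dense by simp
  also have "\<dots> \<le> gain / 4 + gain / 4 - gain"
    using near_bound_integral_le[OF x, of \<epsilon>] far(2) gain_le_dense_bound by (intro diff_mono add_mono)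
  finally show ?thesis by simp
qed

end

subsection \<open>Truncated energies\<close>

definition half_energy_integrand ::
  "real \<Rightarrow> real \<Rightarrow> real \<Rightarrow> (real^'n \<Rightarrow> real) \<Rightarrow> (real^'n \<Rightarrow> real) \<Rightarrow> (real^'n) \<times> (real^'n) \<Rightarrow> real" where
  "half_energy_integrand s p \<epsilon> w \<eta> z = indicator {z. \<epsilon> \<le> norm (fst z - snd z)} z *
     (spow (w (fst z) - w (snd z)) (p - 1) * \<eta> (fst z) * kern (p * s) (fst z - snd z))"

lemma half_energy_integrand_measurable [measurable]:
  assumes [measurable]: "w \<in> borel_measurable lebesgue" "\<eta> \<in> borel_measurable lebesgue"
  shows "half_energy_integrand s p \<epsilon> w \<eta> \<in> borel_measurable leb2"
  unfolding half_energy_integrand_def[abs_def] by measurable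

lemma integrable_half_energy_integrand:
  fixes w \<eta> :: "real^'n \<Rightarrow> real"
  assumes [measurable]: "w \<in> borel_measurable lebesgue" and w: "AE x in lebesgue. \<bar>w x\<bar> \<le> B"
    and \<eta>: "integrable lebesgue \<eta>" "\<And>x. 0 \<le> \<eta> x" and p: "1 \<le> p" and ps: "0 < p * s" and \<epsilon>: "0 < \<epsilon>"
  shows "integrable leb2 (half_energy_integrand s p \<epsilon> w \<eta>)"
proof (rule integrableI_bounded)
  note [measurable] = borel_measurable_integrable[OF \<eta>(1)]
  let ?b = "(2 * B) powr (p - 1)"
  let ?g = "\<lambda>h::real^'n. ennreal (indicator {h. \<epsilon> \<le> norm h} h * kern (p * s) h)"
  show "half_energy_integrand s p \<epsilon> w \<eta> \<in> borel_measurable leb2" by measurable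
  have "(\<integral>\<^sup>+ z. ennreal (norm (half_energy_integrand s p \<epsilon> w \<eta> z)) \<partial>leb2)
      \<le> (\<integral>\<^sup>+ z. ennreal (?b * \<eta> (fst z)) * ?g (fst z - snd z) \<partial>leb2)"
    using lebesgue.AE_pair_measure_same[OF w]
  proof (intro nn_integral_mono_AE, eventually_elim)
    fix z :: "(real^'n) \<times> (real^'n)"
    assume "\<bar>w (fst z)\<bar> \<le> B \<and> \<bar>w (snd z)\<bar> \<le> B"
    then have "\<bar>w (fst z) - w (snd z)\<bar> \<le> 2 * B" by linarith
    then have "\<bar>spow (w (fst z) - w (snd z)) (p - 1)\<bar> \<le> ?b"
      unfolding abs_spow using p by (intro powr_mono2) auto
    then have "norm (half_energy_integrand s p \<epsilon> w \<eta> z)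
        \<le> ?b * \<eta> (fst z) * (indicator {h. \<epsilon> \<le> norm h} (fst z - snd z) * kern (p * s) (fst z - snd z))"
      unfolding half_energy_integrand_def using \<eta>(2)
      by (auto simp: abs_mult indicator_def intro!: mult_right_mono)
    then show "ennreal (norm (half_energy_integrand s p \<epsilon> w \<eta> z))
      \<le> ennreal (?b * \<eta> (fst z)) * ?g (fst z - snd z)"
      using \<eta>(2) by (subst ennreal_mult[symmetric]) (auto intro: ennreal_leI)
  qed
  also have "\<dots> = (\<integral>\<^sup>+ x. ennreal (?b * \<eta> x) \<partial>lebesgue) * (\<integral>\<^sup>+ h. ?g h \<partial>lborel)"
    by (rule nn_integral_leb2_convolution) measurable
  also have "\<dots> < \<infinity>"
  proof -
    have "(\<integral>\<^sup>+ x. ennreal (?b * \<eta> x) \<partial>lebesgue) = ennreal (\<integral>x. ?b * \<eta> x \<partial>lebesgue)"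
      using \<eta> by (intro nn_integral_eq_integral) auto
    then show ?thesis
      using nn_integral_kern_outside_ball[OF ps \<epsilon>, where 'a = "real^'n"]
      by (simp add: ennreal_mult_less_top)
  qed
  finally show "(\<integral>\<^sup>+ z. ennreal (norm (half_energy_integrand s p \<epsilon> w \<eta> z)) \<partial>leb2) < \<infinity>" .
qed

text \<open>Adding \<open>\<eta>\<close> to \<open>V\<close> increases the energy against \<open>\<eta>\<close>, by monotonicity; symmetry of the kernel then
  splits the energy into two equal halves.\<close>
lemma truncated_energy_integrand_le:
  fixes V \<eta> :: "real^'n \<Rightarrow> real"
  assumes p: "1 < p"
  defines "w \<equiv> \<lambda>x. V x + \<eta> x"
  shows "indicator {z. \<epsilon> \<le> norm (fst z - snd z)} z * energy_integrand s p V \<eta> z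
    \<le> half_energy_integrand s p \<epsilon> w \<eta> z + half_energy_integrand s p \<epsilon> w \<eta> (snd z, fst z)"
proof -
  obtain x y where z: "z = (x, y)" by (cases z)
  have mono: "spow (V x - V y) (p - 1) * (\<eta> x - \<eta> y) \<le> spow (w x - w y) (p - 1) * (\<eta> x - \<eta> y)"
  proof (cases "\<eta> y \<le> \<eta> x")
    case True
    then show ?thesis using p by (intro mult_right_mono spow_mono) (auto simp: w_def)
  next
    case False
    then show ?thesis using p by (intro mult_right_mono_neg spow_mono) (auto simp: w_def)
  qed
  have "indicator {z. \<epsilon> \<le> norm (fst z - snd z)} z * energy_integrand s p V \<eta> z
      \<le> indicator {z. \<epsilon> \<le> norm (fst z - snd z)} z *
        (spow (w x - w y) (p - 1) * (\<eta> x - \<eta> y) * kern (p * s) (x - y))"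
    unfolding energy_integrand_def z fst_conv snd_conv
    by (rule mult_left_mono[OF mult_right_mono[OF mono]]) auto
  also have "\<dots> = half_energy_integrand s p \<epsilon> w \<eta> z + half_energy_integrand s p \<epsilon> w \<eta> (snd z, fst z)"
  proof -
    have "spow (w y - w x) (p - 1) = - spow (w x - w y) (p - 1)"
      using spow_minus[of "w x - w y" "p - 1"] by simp
    then show ?thesis
      by (simp add: half_energy_integrand_def z indicator_def norm_minus_commute
          kern_commute[of "p * s" y x] algebra_simps)
  qed
  finally show ?thesis .
qed

lemma truncated_integral_tendsto:
  fixes F :: "'a::euclidean_space \<times> 'a \<Rightarrow> real"
  assumes F: "integrable leb2 F" and diagonal: "\<And>x. F (x, x) = 0"
  shows "(\<lambda>n. \<integral>z. indicator {z. 1 / real (Suc n) \<le> norm (fst z - snd z)} z * F z \<partial>leb2) \<longlonglongrightarrow> integral\<^sup>L leb2 F"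
proof (rule integral_dominated_convergence[where w = "\<lambda>z. norm (F z)"])
  note [measurable] = borel_measurable_integrable[OF F]
  let ?T = "\<lambda>n z. indicator {z. 1 / real (Suc n) \<le> norm (fst z - snd z)} z * F z"
  show "F \<in> borel_measurable leb2" "\<And>n. ?T n \<in> borel_measurable leb2" by measurable
  show "integrable leb2 (\<lambda>z. norm (F z))" using F by (rule integrable_norm)
  show "AE z in leb2. norm (?T n z) \<le> norm (F z)" for n
    by (rule AE_I2) (simp add: indicator_def)
  show "AE z in leb2. (\<lambda>n. ?T n z) \<longlonglongrightarrow> F z"
  proof (rule AE_I2)
    fix z :: "'a \<times> 'a"
    show "(\<lambda>n. ?T n z) \<longlonglongrightarrow> F z"
    proof (cases "fst z = snd z")
      case True
      then show ?thesis using diagonal[of "fst z"] by (cases z) simp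
    next
      case False
      then have "\<forall>\<^sub>F n in sequentially. 1 / real (Suc n) < norm (fst z - snd z)"
        using LIMSEQ_Suc[OF lim_1_over_n[where 'a = real]] by (intro order_tendstoD(2)) auto
      then have "\<forall>\<^sub>F n in sequentially. ?T n z = F z" by eventually_elim simp
      then show ?thesis by (rule tendsto_eventually)
    qed
  qed
qed

lemma energy_le_half_energies:
  fixes V \<eta> :: "real^'n \<Rightarrow> real"
  assumes V [measurable]: "V \<in> borel_measurable lebesgue"
      "AE x in lebesgue. \<bar>V x + \<eta> x\<bar> \<le> B" "gagliardo s p V < \<infinity>"
    and \<eta>: "integrable lebesgue \<eta>" "\<And>x. 0 \<le> \<eta> x" "gagliardo s p \<eta> < \<infinity>"
    and p: "1 < p" and s: "0 < s" and \<epsilon>\<^sub>0: "0 < \<epsilon>\<^sub>0"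
    and half: "\<And>\<epsilon>. 0 < \<epsilon> \<Longrightarrow> \<epsilon> \<le> \<epsilon>\<^sub>0 \<Longrightarrow> integral\<^sup>L leb2 (half_energy_integrand s p \<epsilon> (\<lambda>x. V x + \<eta> x) \<eta>) \<le> c"
  shows "energy s p V \<eta> \<le> 2 * c"
proof -
  note [measurable] = borel_measurable_integrable[OF \<eta>(1)]
  let ?E = "energy_integrand s p V \<eta>"
    and ?T = "\<lambda>\<epsilon> z. indicator {z. \<epsilon> \<le> norm (fst z - snd z :: real^'n)} z :: real"
  have intE: "integrable leb2 ?E"
    by (rule integrable_energy_integrand[OF V(1) _ p V(3) \<eta>(3)]) measurable
  have truncated: "(\<integral>z. ?T \<epsilon> z * ?E z \<partial>leb2) \<le> 2 * c" if \<epsilon>: "0 < \<epsilon>" "\<epsilon> \<le> \<epsilon>\<^sub>0" for \<epsilon>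
  proof -
    define H where "H = half_energy_integrand s p \<epsilon> (\<lambda>x. V x + \<eta> x) \<eta>"
    have H: "integrable leb2 H"
      unfolding H_def using p s \<epsilon> \<eta>(1,2) V(2) by (intro integrable_half_energy_integrand) auto
    have swap: "integrable leb2 (\<lambda>z. H (snd z, fst z))" "(\<integral>z. H (snd z, fst z) \<partial>leb2) = integral\<^sup>L leb2 H"
      using lebesgue_pair.integrable_product_swap[OF H]
        lebesgue_pair.integral_product_swap[OF borel_measurable_integrable[OF H]]
      by (simp_all add: case_prod_beta')
    have "(\<integral>z. ?T \<epsilon> z * ?E z \<partial>leb2) \<le> (\<integral>z. H z + H (snd z, fst z) \<partial>leb2)"
    proof (rule integral_mono)
      show "integrable leb2 (\<lambda>z. ?T \<epsilon> z * ?E z)"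
        by (rule Bochner_Integration.integrable_bound[OF intE]) (auto simp: indicator_def)
      show "integrable leb2 (\<lambda>z. H z + H (snd z, fst z))" using H swap by simp
      show "?T \<epsilon> z * ?E z \<le> H z + H (snd z, fst z)" for z
        unfolding H_def by (rule truncated_energy_integrand_le[OF p])
    qed
    also have "\<dots> = 2 * integral\<^sup>L leb2 H" using H swap by simp
    also have "\<dots> \<le> 2 * c" using half[OF \<epsilon>] by (simp add: H_def)
    finally show ?thesis .
  qed
  have "\<forall>\<^sub>F n in sequentially. 1 / real (Suc n) < \<epsilon>\<^sub>0"
    using \<epsilon>\<^sub>0 LIMSEQ_Suc[OF lim_1_over_n[where 'a = real]] by (intro order_tendstoD(2)) auto
  then have "\<forall>\<^sub>F n in sequentially. (\<integral>z. ?T (1 / real (Suc n)) z * ?E z \<partial>leb2) \<le> 2 * c"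
    by eventually_elim (intro truncated, auto)
  moreover have "(\<lambda>n. \<integral>z. ?T (1 / real (Suc n)) z * ?E z \<partial>leb2) \<longlonglongrightarrow> energy s p V \<eta>"
    unfolding energy_def by (rule truncated_integral_tendsto[OF intE]) (simp add: energy_integrand_def)
  ultimately show ?thesis by (intro tendsto_upperbound[OF _ _ sequentially_bot])
qed

lemma (in growth_situation) half_energy_le:
  assumes \<epsilon>: "0 < \<epsilon>" "\<epsilon> \<le> R / 8" and bump_le_V: "AE y in lebesgue. y \<in> ball x0 R \<longrightarrow> bump y \<le> V y"
    and \<eta>: "integrable lebesgue \<eta>" "\<And>x. 0 \<le> \<eta> x"
    and contact: "AE x in lebesgue. \<eta> x \<noteq> 0 \<longrightarrow> x \<in> ball x0 (R / 8) \<and> V x = bump x"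
  shows "integral\<^sup>L leb2 (half_energy_integrand s p \<epsilon> V \<eta>) \<le> - (gain / 2) * integral\<^sup>L lebesgue \<eta>"
proof -
  let ?H = "half_energy_integrand s p \<epsilon> V \<eta>"
  have H: "integrable leb2 ?H"
    using V_bounded \<eta> p ps_pos \<epsilon> by (intro integrable_half_energy_integrand) auto
  have "integral\<^sup>L leb2 ?H = (\<integral>x. (\<integral>y. ?H (x, y) \<partial>lebesgue) \<partial>lebesgue)"
    by (rule lebesgue_pair.integral_fst'[OF H, symmetric])
  also have "\<dots> \<le> (\<integral>x. - (gain / 2) * \<eta> x \<partial>lebesgue)"
  proof (rule integral_mono_AE)
    show "integrable lebesgue (\<lambda>x. \<integral>y. ?H (x, y) \<partial>lebesgue)" by (rule lebesgue_pair.integrable_fst'[OF H])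
    show "integrable lebesgue (\<lambda>x. - (gain / 2) * \<eta> x)" using \<eta> by simp
    show "AE x in lebesgue. (\<integral>y. ?H (x, y) \<partial>lebesgue) \<le> - (gain / 2) * \<eta> x"
      using contact
    proof eventually_elim
      fix x assume x: "\<eta> x \<noteq> 0 \<longrightarrow> x \<in> ball x0 (R / 8) \<and> V x = bump x"
      let ?F = "\<lambda>y. indicator {y. \<epsilon> \<le> norm (x - y)} y *
        (spow (bump x - V y) (p - 1) * kern (p * s) (x - y))"
      show "(\<integral>y. ?H (x, y) \<partial>lebesgue) \<le> - (gain / 2) * \<eta> x"
      proof (cases "\<eta> x = 0")
        case True
        then show ?thesis by (simp add: half_energy_integrand_def)
      next
        case False
        have "(\<integral>y. ?H (x, y) \<partial>lebesgue) = (\<integral>y. \<eta> x * ?F y \<partial>lebesgue)"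
          using x False by (intro Bochner_Integration.integral_cong)
              (auto simp: half_energy_integrand_def indicator_def)
        also have "\<dots> = \<eta> x * integral\<^sup>L lebesgue ?F" by (rule integral_mult_right_zero)
        also have "\<dots> \<le> \<eta> x * (- (gain / 2))"
          using x False \<eta>(2) by (intro mult_left_mono truncated_operator_le[OF _ \<epsilon> bump_le_V]) auto
        finally show ?thesis by (simp add: mult.commute)
      qed
    qed
  qed
  also have "\<dots> = - (gain / 2) * integral\<^sup>L lebesgue \<eta>" by (rule integral_mult_right_zero)
  finally show ?thesis .
qed

subsection \<open>Comparison with the barrier\<close>

locale supersolution_growth = growth_situation s p \<sigma> i ty x0 R \<mu> M A V
  for s p \<sigma> :: real and i :: nat and ty :: "(real^'n) itself"
    and x0 :: "real^'n" and R \<mu> M :: real and A :: "(real^'n) set" and V :: "real^'n \<Rightarrow> real" +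
  fixes \<Omega> :: "(real^'n) set" and K :: real
  assumes \<Omega>: "open \<Omega>" "bounded \<Omega>" and V_gagliardo: "gagliardo s p V < \<infinity>"
    and V_supersolution: "frac_lap_ge s p \<Omega> (- K) V" and K: "K < gain"
    and V_outside: "AE y in lebesgue. y \<in> ball x0 (R / 8) - \<Omega> \<longrightarrow> \<mu> \<le> V y"
begin

definition excess :: "real^'n \<Rightarrow> real" where
  "excess x = max 0 (min (bump x) (bump x - V x))"

lemma excess_nonneg: "0 \<le> excess x"
  by (simp add: excess_def)

lemma excess_le: "excess x \<le> \<sigma> * \<mu>"
  using bump_le[of x] \<sigma>\<mu> by (simp add: excess_def min_def)

lemma excess_outside: "x \<notin> ball x0 (R / 8) \<Longrightarrow> excess x = 0"
  using bump_outside[of x] by (simp add: excess_def)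

lemma excess_measurable [measurable]: "excess \<in> borel_measurable lebesgue"
  unfolding excess_def[abs_def] by measurable

lemma excess_gagliardo: "gagliardo s p excess < \<infinity>"
proof -
  let ?b = "barrier i x0 (R / 8)"
  have lipschitz: "\<bar>excess x - excess y\<bar> \<le> \<sigma> * \<mu> * \<bar>?b x - ?b y\<bar> + \<bar>V x - V y\<bar>" for x y
  proof -
    have "\<bar>excess x - excess y\<bar> \<le> \<bar>bump x - bump y\<bar> + \<bar>V x - V y\<bar>"
      unfolding excess_def by (auto simp: max_def min_def abs_if)
    also have "\<bar>bump x - bump y\<bar> = \<sigma> * \<mu> * \<bar>?b x - ?b y\<bar>"
      using \<sigma>(1) \<mu> by (simp add: bump_def abs_mult flip: right_diff_distrib)
    finally show ?thesis .
  qed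
  have "?b \<in> borel_measurable lebesgue" by (rule measurable_completion) measurable
  moreover have "gagliardo s p ?b < \<infinity>"
  proof (rule gagliardo_lipschitz_finite[OF _ s _ barrier_lipschitz abs_barrier_diff_le_1])
    show "?b x = 0" if "x \<notin> ball x0 (R / 8)" for x
      using that R by (intro barrier_outside) auto
  qed (use p R in auto)
  ultimately show ?thesis
    using p \<sigma>\<mu> by (intro gagliardo_finite_dominated[OF V_measurable _ _ V_gagliardo _ _ lipschitz]) auto
qed

lemma excess_W0: "excess \<in> W0 s p \<Omega>"
proof (rule W0_of_bounded[OF _ _ excess_gagliardo _ \<Omega>])
  show "\<bar>excess x\<bar> \<le> \<sigma> * \<mu>" for x using excess_nonneg[of x] excess_le[of x] by simp
  show "AE x in lebesgue. x \<notin> \<Omega> \<longrightarrow> excess x = 0"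
    using V_outside
  proof (eventually_elim, intro impI)
    fix x assume V: "x \<in> ball x0 (R / 8) - \<Omega> \<longrightarrow> \<mu> \<le> V x" and x: "x \<notin> \<Omega>"
    show "excess x = 0"
    proof (cases "x \<in> ball x0 (R / 8)")
      case True
      then have "\<mu> \<le> V x" using V x by blast
      then have "bump x - V x \<le> 0" using bump_le[of x] \<sigma>\<mu> \<mu> by linarith
      then show ?thesis by (simp add: excess_def)
    qed (rule excess_outside)
  qed
qed (use p in auto)

lemma excess_integrable: "integrable lebesgue excess"
  using p by (intro W0_integrable[OF excess_W0 \<Omega>]) simp

lemma bounded_add_excess: "AE y in lebesgue. \<bar>V y + excess y\<bar> \<le> M + \<sigma> * \<mu>"
  using V_bounded
proof eventually_elim
  fix y assume "\<bar>V y\<bar> \<le> M"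
  then show "\<bar>V y + excess y\<bar> \<le> M + \<sigma> * \<mu>" using excess_nonneg[of y] excess_le[of y] by linarith
qed

lemma growth_situation_add_excess:
  "growth_situation s p \<sigma> i ty x0 R \<mu> (M + \<sigma> * \<mu>) A (\<lambda>x. V x + excess x)"
proof
  have mono: "AE y in lebesgue. Q y \<longrightarrow> c y \<le> V y + excess y" if "AE y in lebesgue. Q y \<longrightarrow> c y \<le> V y" for Q c
    using that by eventually_elim (use excess_nonneg in \<open>simp add: add_increasing2\<close>)
  show "AE y in lebesgue. y \<in> ball x0 R \<longrightarrow> 0 \<le> V y + excess y"
    "AE y in lebesgue. y \<notin> ball x0 R \<longrightarrow> - (\<mu> * growth \<sigma> (16 * dist x0 y / R)) \<le> V y + excess y"
    "AE y in lebesgue. y \<in> A \<longrightarrow> \<mu> \<le> V y + excess y"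
    by (intro mono V_nonneg V_tail V_dense)+
qed (use R \<mu> A bounded_add_excess in auto)

lemma energy_excess_le: "energy s p V excess \<le> - gain * integral\<^sup>L lebesgue excess"
proof -
  interpret comparison: growth_situation s p \<sigma> i ty x0 R \<mu> "M + \<sigma> * \<mu>" A "\<lambda>x. V x + excess x"
    by (rule growth_situation_add_excess)
  have ge_bump: "AE y in lebesgue. y \<in> ball x0 R \<longrightarrow> bump y \<le> V y + excess y"
    using V_nonneg by eventually_elim (auto simp: excess_def)
  have contact: "AE x in lebesgue. excess x \<noteq> 0 \<longrightarrow> x \<in> ball x0 (R / 8) \<and> V x + excess x = bump x"
    using V_nonneg
  proof (eventually_elim, intro impI)
    fix x assume V: "x \<in> ball x0 R \<longrightarrow> 0 \<le> V x" and x: "excess x \<noteq> 0"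
    then have "x \<in> ball x0 (R / 8)" using excess_outside by blast
    then show "x \<in> ball x0 (R / 8) \<and> V x + excess x = bump x"
      using V x R by (auto simp: excess_def max_def min_def split: if_splits)
  qed
  have "energy s p V excess \<le> 2 * (- (gain / 2) * integral\<^sup>L lebesgue excess)"
  proof (rule energy_le_half_energies[OF V_measurable bounded_add_excess V_gagliardo
        excess_integrable excess_nonneg excess_gagliardo p s(1)])
    show "0 < R / 8" using R by simp
    show "integral\<^sup>L leb2 (half_energy_integrand s p \<epsilon> (\<lambda>x. V x + excess x) excess)
      \<le> - (gain / 2) * integral\<^sup>L lebesgue excess"
      if "0 < \<epsilon>" "\<epsilon> \<le> R / 8" for \<epsilon>
      using that ge_bump excess_integrable excess_nonneg contact by (rule comparison.half_energy_le)
  qed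
  then show ?thesis by simp
qed

lemma lower_bound: "AE y in lebesgue. y \<in> ball x0 (R / 16) \<longrightarrow> \<sigma> * \<mu> / 2 \<le> V y"
proof -
  have "- K * integral\<^sup>L lebesgue excess \<le> - gain * integral\<^sup>L lebesgue excess"
    using frac_lap_geD[OF V_supersolution excess_W0 excess_nonneg] energy_excess_le by (rule order_trans)
  then have "gain * integral\<^sup>L lebesgue excess \<le> K * integral\<^sup>L lebesgue excess"
    by (simp only: mult_minus_left neg_le_iff_le)
  then have "AE x in lebesgue. excess x = 0"
    using K by (rule integral_zero_if_coefficient_gap[OF excess_integrable excess_nonneg])
  then show ?thesis
  proof (eventually_elim, intro impI)
    fix y assume "excess y = 0" and y: "y \<in> ball x0 (R / 16)"
    then have "1 / 2 \<le> barrier i x0 (R / 8) y" using R by (intro barrier_ge_half) auto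
    then have "\<sigma> * \<mu> * (1 / 2) \<le> bump y" unfolding bump_def using \<sigma>\<mu> by (intro mult_left_mono) auto
    moreover have "0 < bump y" using calculation \<sigma>\<mu> by linarith
    then have "bump y \<le> V y" using \<open>excess y = 0\<close>
        by (auto simp: excess_def max_def min_def split: if_splits)
    ultimately show "\<sigma> * \<mu> / 2 \<le> V y" by simp
  qed
qed

end

section \<open>Oscillation decay\<close>

lemma ball_subset_annulus:
  fixes x0 y0 :: "'a::metric_space"
  assumes "dist x0 y0 + r \<le> R" "t + r \<le> dist x0 y0"
  shows "ball y0 r \<subseteq> ball x0 R - ball x0 t"
proof
  fix y assume "y \<in> ball y0 r"
  then have "dist y0 y < r" by simp
  then have "dist x0 y < R" "t \<le> dist x0 y"
    using assms dist_triangle[of x0 y y0] dist_triangle2[of x0 y0 y] by linarith+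
  then show "y \<in> ball x0 R - ball x0 t" by simp
qed


lemma one_minus_le_powr_sixteenth:
  fixes \<sigma> :: real
  assumes "0 \<le> \<sigma>"
  shows "1 - \<sigma> / 4 \<le> (1 / 16) powr (\<sigma> / 16)"
proof -
  have "ln (16::real) = 4 * ln 2" using ln_realpow[of 2 4] by simp
  also have "\<dots> \<le> 4" using ln_2_less_1 by simp
  finally have "\<sigma> / 16 * ln 16 \<le> \<sigma> / 16 * 4" using assms by (intro mult_left_mono) auto
  then have "1 - \<sigma> / 4 \<le> 1 + - (\<sigma> / 16 * ln 16)" by simp
  also have "\<dots> \<le> exp (- (\<sigma> / 16 * ln 16))" by (rule exp_ge_add_one_self)
  also have "\<dots> = (1 / 16) powr (\<sigma> / 16)" by (simp add: powr_def ln_div)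
  finally show ?thesis .
qed

locale oscillation_iteration = growth_parameters s p \<sigma> i ty
  for s p \<sigma> :: real and i :: nat and ty :: "(real^'n) itself" +
  fixes \<Omega> :: "(real^'n) set" and K \<Lambda> R0 :: real and x0 :: "real^'n"
  assumes \<Omega>: "open \<Omega>" "bounded \<Omega>" and R0: "0 < R0" and corkscrew: "exterior_corkscrew R0 \<Omega>"
    and x0: "x0 \<in> closure \<Omega>" and \<Lambda>: "0 < \<Lambda>"
    and K: "K < density_gain s p ty * ((\<Lambda> / 2) powr (p - 1) * R0 powr (- (p * s)))"
begin

subsection \<open>Scales\<close>

definition radius :: "nat \<Rightarrow> real" where
  "radius j = R0 * (1 / 16) ^ j"

definition osc :: "nat \<Rightarrow> real" where
  "osc j = \<Lambda> * ((1 / 16) ^ j) powr (\<sigma> / 16)"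

lemma radius_pos: "0 < radius j"
  using R0 by (simp add: radius_def)

lemma radius_0: "radius 0 = R0"
  by (simp add: radius_def)

lemma radius_Suc: "radius (Suc j) = radius j / 16"
  by (simp add: radius_def)

lemma radius_antimono: "k \<le> j \<Longrightarrow> radius j \<le> radius k"
  using R0 by (simp add: radius_def power_decreasing)

lemma osc_pos: "0 < osc j"
  using \<Lambda> by (simp add: osc_def)

lemma osc_0: "osc 0 = \<Lambda>"
  by (simp add: osc_def)

lemma osc_Suc: "osc (Suc j) = osc j * (1 / 16) powr (\<sigma> / 16)"
  unfolding osc_def power_Suc powr_mult by simp

lemma osc_diff_Suc_le: "osc j - osc (Suc j) \<le> \<sigma> * osc j / 4"
proof -
  have "osc j * (1 - \<sigma> / 4) \<le> osc (Suc j)"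
    unfolding osc_Suc using osc_pos[of j] \<sigma> by (intro mult_left_mono one_minus_le_powr_sixteenth) auto
  then show ?thesis by (simp add: algebra_simps)
qed

lemma osc_Suc_le: "osc (Suc j) \<le> osc j"
proof -
  have "(1 / 16 :: real) powr (\<sigma> / 16) \<le> 1" using \<sigma> by (intro powr_le1) auto
  then show ?thesis unfolding osc_Suc using osc_pos[of j] by (simp add: mult_left_le)
qed

lemma osc_diff_le_growth:
  assumes "radius k \<le> 16 * d"
  shows "osc k - osc j \<le> osc j / 2 * growth \<sigma> (16 * d / radius j)"
proof -
  have "(1 / 16) ^ k = (1 / 16) ^ j * (radius k / radius j)"
    using R0 by (simp add: radius_def)
  then have "osc k = osc j * (radius k / radius j) powr (\<sigma> / 16)"
    unfolding osc_def by (simp only: powr_mult mult.assoc)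
  also have "\<dots> \<le> osc j * (16 * d / radius j) powr (\<sigma> / 16)"
    using assms radius_pos[of k] radius_pos[of j] osc_pos[of j] \<sigma>
    by (intro mult_left_mono powr_mono2 divide_right_mono) auto
  finally show ?thesis by (simp add: growth_def algebra_simps)
qed

lemma K_less_scaled: "K < density_gain s p ty * ((osc j / 2) powr (p - 1) * radius j powr (- (p * s)))"
proof -
  define t where "t = (1 / 16 :: real) ^ j"
  have t: "0 < t" "t \<le> 1" by (auto simp: t_def power_le_one)
  have "osc j / 2 = \<Lambda> / 2 * t powr (\<sigma> / 16)" by (simp add: osc_def t_def)
  then have "(osc j / 2) powr (p - 1) = (\<Lambda> / 2) powr (p - 1) * t powr (\<sigma> / 16 * (p - 1))"
    by (simp only: powr_mult powr_powr)
  moreover have "radius j powr (- (p * s)) = R0 powr (- (p * s)) * t powr (- (p * s))"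
    by (simp only: radius_def t_def powr_mult)
  ultimately have "(osc j / 2) powr (p - 1) * radius j powr (- (p * s))
      = (\<Lambda> / 2) powr (p - 1) * R0 powr (- (p * s)) * (t powr (\<sigma> / 16 * (p - 1)) * t powr (- (p * s)))"
    by (simp only: mult_ac)
  also have "t powr (\<sigma> / 16 * (p - 1)) * t powr (- (p * s)) = t powr (\<sigma> / 16 * (p - 1) - p * s)"
    by (simp flip: powr_add)
  finally have eq: "(osc j / 2) powr (p - 1) * radius j powr (- (p * s))
      = (\<Lambda> / 2) powr (p - 1) * R0 powr (- (p * s)) * t powr (\<sigma> / 16 * (p - 1) - p * s)" .
  have "t powr 0 \<le> t powr (\<sigma> / 16 * (p - 1) - p * s)" using t \<sigma> by (intro powr_mono') auto
  then have "1 \<le> t powr (\<sigma> / 16 * (p - 1) - p * s)" using t by simp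
  then have "(\<Lambda> / 2) powr (p - 1) * R0 powr (- (p * s)) * 1
    \<le> (osc j / 2) powr (p - 1) * radius j powr (- (p * s))"
    unfolding eq by (intro mult_left_mono) auto
  then have "density_gain s p ty * ((\<Lambda> / 2) powr (p - 1) * R0 powr (- (p * s)))
      \<le> density_gain s p ty * ((osc j / 2) powr (p - 1) * radius j powr (- (p * s)))"
    using density_gain_pos[of s p ty] by (intro mult_left_mono) auto
  with K show ?thesis by linarith
qed

subsection \<open>Trapping a solution between barriers\<close>

definition bounded_solution :: "(real^'n \<Rightarrow> real) \<Rightarrow> bool" where
  "bounded_solution u \<longleftrightarrow> u \<in> W0 s p \<Omega> \<and> (AE x in lebesgue. \<bar>u x\<bar> \<le> \<Lambda> / 2) \<and>
     frac_lap_ge s p \<Omega> (- K) u \<and> frac_lap_ge s p \<Omega> (- K) (\<lambda>x. - u x)"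

definition trapped :: "(real^'n \<Rightarrow> real) \<Rightarrow> nat \<Rightarrow> real \<Rightarrow> bool" where
  "trapped u j m \<longleftrightarrow> - (\<Lambda> / 2) \<le> m \<and> m + osc j \<le> \<Lambda> / 2 \<and>
     (\<forall>k\<le>j. AE y in lebesgue. y \<in> ball x0 (radius k) \<longrightarrow> m + osc j - osc k \<le> u y \<and> u y \<le> m + osc k)"

definition improved :: "(real^'n \<Rightarrow> real) \<Rightarrow> nat \<Rightarrow> real \<Rightarrow> bool" where
  "improved u j m \<longleftrightarrow> (AE y in lebesgue. y \<in> ball x0 (radius (Suc j)) \<longrightarrow> m + \<sigma> * osc j / 4 \<le> u y)"

lemma bounded_solution_W0: "bounded_solution u \<Longrightarrow> u \<in> W0 s p \<Omega>"
  by (simp add: bounded_solution_def)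

lemma bounded_solution_uminus: "bounded_solution u \<Longrightarrow> bounded_solution (\<lambda>x. - u x)"
  by (simp add: bounded_solution_def W0_uminus)

lemma trapped_uminus:
  assumes "trapped u j m"
  shows "trapped (\<lambda>x. - u x) j (- (m + osc j))"
  unfolding trapped_def
proof (intro conjI allI impI)
  fix k assume "k \<le> j"
  with assms have "AE y in lebesgue. y \<in> ball x0 (radius k) \<longrightarrow> m + osc j - osc k \<le> u y \<and> u y \<le> m + osc k"
    by (simp add: trapped_def)
  then show "AE y in lebesgue. y \<in> ball x0 (radius k) \<longrightarrow>
      - (m + osc j) + osc j - osc k \<le> - u y \<and> - u y \<le> - (m + osc j) + osc k"
    by eventually_elim auto
qed (use assms in \<open>auto simp: trapped_def\<close>)

lemma trapped_all_scales:
  assumes "trapped u j m"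
  shows "AE y in lebesgue. \<forall>k\<le>j. y \<in> ball x0 (radius k) \<longrightarrow> m + osc j - osc k \<le> u y \<and> u y \<le> m + osc k"
  using assms by (simp add: trapped_def AE_all_countable)

lemma trapped_inside:
  assumes "trapped u j m"
  shows "AE y in lebesgue. y \<in> ball x0 (radius j) \<longrightarrow> m \<le> u y \<and> u y \<le> m + osc j"
  using trapped_all_scales[OF assms] by eventually_elim force

lemma trapped_tail:
  assumes u: "bounded_solution u" and trapped: "trapped u j m"
  shows "AE y in lebesgue. y \<notin> ball x0 (radius j) \<longrightarrow>
    - (osc j / 2 * growth \<sigma> (16 * dist x0 y / radius j)) \<le> - m + u y"
proof -
  have "AE y in lebesgue. \<bar>u y\<bar> \<le> \<Lambda> / 2" using u by (simp add: bounded_solution_def)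
  with trapped_all_scales[OF trapped] show ?thesis
  proof (eventually_elim, intro impI)
    fix y
    assume scales: "\<forall>k\<le>j. y \<in> ball x0 (radius k) \<longrightarrow> m + osc j - osc k \<le> u y \<and> u y \<le> m + osc k"
      and u: "\<bar>u y\<bar> \<le> \<Lambda> / 2" and y: "y \<notin> ball x0 (radius j)"
    obtain k where "radius k \<le> 16 * dist x0 y" "m + osc j - osc k \<le> u y"
    proof (cases "dist x0 y < R0")
      case True
      have "0 < dist x0 y" using y radius_pos[of j] by auto
      then obtain k where k: "R0 * (1 / 16) ^ Suc k \<le> dist x0 y" "dist x0 y < R0 * (1 / 16) ^ k"
        using True by (rule geometric_scale_exists[of "1 / 16", rotated 2]) auto
      then have "radius k \<le> 16 * dist x0 y" "y \<in> ball x0 (radius k)" by (auto simp: radius_def)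
      moreover from this have "k \<le> j" using y radius_antimono[of j k] by (cases "k \<le> j") auto
      ultimately show ?thesis using scales that by blast
    next
      case False
      then have "radius 0 \<le> 16 * dist x0 y" using R0 by (simp add: radius_0)
      moreover have "m + osc j - osc 0 \<le> u y" using u trapped by (auto simp: trapped_def osc_0)
      ultimately show ?thesis by (rule that)
    qed
    then show "- (osc j / 2 * growth \<sigma> (16 * dist x0 y / radius j)) \<le> - m + u y"
      using osc_diff_le_growth[of k "dist x0 y" j] by linarith
  qed
qed

lemma improved_of_density:
  assumes u: "bounded_solution u" and trapped: "trapped u j m"
    and A: "A \<in> sets lebesgue" "A \<subseteq> ball x0 (radius j) - ball x0 (radius j / 4)"
      "measure lebesgue (ball x0 (radius j / 16)) \<le> measure lebesgue A"
    and dense: "AE y in lebesgue. y \<in> A \<longrightarrow> osc j / 2 \<le> - m + u y"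
    and outside: "AE y in lebesgue. y \<in> ball x0 (radius j / 8) - \<Omega> \<longrightarrow> osc j / 2 \<le> - m + u y"
  shows "improved u j m"
proof -
  note [measurable] = W0_measurable[OF bounded_solution_W0[OF u]]
  interpret supersolution_growth s p \<sigma> i ty x0 "radius j" "osc j / 2" "\<bar>m\<bar> + \<Lambda> / 2" A "\<lambda>y. - m + u y" \<Omega> K
  proof
    show "AE y in lebesgue. \<bar>- m + u y\<bar> \<le> \<bar>m\<bar> + \<Lambda> / 2"
      using u unfolding bounded_solution_def by (auto elim: eventually_mono)
    show "AE y in lebesgue. y \<in> ball x0 (radius j) \<longrightarrow> 0 \<le> - m + u y"
      using trapped_inside[OF trapped] by eventually_elim auto
    show "gagliardo s p (\<lambda>y. - m + u y) < \<infinity>"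
      unfolding gagliardo_const_add by (rule W0_gagliardo[OF bounded_solution_W0[OF u]])
    show "frac_lap_ge s p \<Omega> (- K) (\<lambda>y. - m + u y)"
      using u by (simp only: frac_lap_ge_const_add bounded_solution_def)
  qed (use \<Omega> radius_pos[of j] osc_pos[of j] A dense outside
      trapped_tail[OF u trapped] K_less_scaled in auto)
  show ?thesis
    using lower_bound unfolding improved_def radius_Suc by eventually_elim auto
qed

lemma annulus_contains_ball:
  obtains y where "ball y (radius j / 4) \<subseteq> ball x0 (radius j) - ball x0 (radius j / 4)"
    "2 * measure lebesgue (ball x0 (radius j / 16)) \<le> measure lebesgue (ball y (radius j / 4))"
proof -
  obtain e :: "real^'n" where e: "norm e = 5 * radius j / 8"
    using vector_choose_size[of "5 * radius j / 8"] radius_pos[of j] by auto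
  have "ball (x0 + e) (radius j / 4) \<subseteq> ball x0 (radius j) - ball x0 (radius j / 4)"
    using e radius_pos[of j] by (intro ball_subset_annulus) (auto simp: dist_norm)
  moreover have "measure lebesgue (ball (x0 + e) (radius j / 4))
    = 4 ^ DIM(real^'n) * measure lebesgue (ball x0 (radius j / 16))"
    using measure_lebesgue_ball_scale[of 4 "radius j / 16" "x0 + e"]
        measure_lebesgue_ball_scale[of 1 "radius j / 16" x0]
      radius_pos[of j] by simp
  moreover have "(4::real) ^ 1 \<le> 4 ^ DIM(real^'n)" by (intro power_increasing) (auto simp: Suc_leI)
  ultimately show ?thesis
    using measure_nonneg[of lebesgue "ball x0 (radius j / 16)"]
    by (intro that) (auto intro!: mult_right_mono)
qed

lemma improved_interior:
  assumes u: "bounded_solution u" and trapped: "trapped u j m" and interior: "ball x0 (radius j / 8) \<subseteq> \<Omega>"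
  shows "improved u j m \<or> improved (\<lambda>x. - u x) j (- (m + osc j))"
proof -
  obtain y0 where Y: "ball y0 (radius j / 4) \<subseteq> ball x0 (radius j) - ball x0 (radius j / 4)"
    and Y_volume: "2 * measure lebesgue (ball x0 (radius j / 16))
      \<le> measure lebesgue (ball y0 (radius j / 4))"
    by (rule annulus_contains_ball)
  define Y where "Y = ball y0 (radius j / 4)"
  define A where "A c v = Y \<inter> {y. osc j / 2 \<le> - c + v y}" for c and v :: "real^'n \<Rightarrow> real"
  have A_sets: "A c v \<in> sets lebesgue" if "bounded_solution v" for c v
  proof -
    note [measurable] = W0_measurable[OF bounded_solution_W0[OF that]]
    have "{y. osc j / 2 \<le> - c + v y} \<in> sets lebesgue"
      using borel_measurable_le[of "\<lambda>_. osc j / 2" lebesgue "\<lambda>y. - c + v y"] by simp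
    then show ?thesis unfolding A_def Y_def by (intro sets.Int) auto
  qed
  have improved: "improved v j c"
    if "bounded_solution v" "trapped v j c"
      "measure lebesgue (ball x0 (radius j / 16)) \<le> measure lebesgue (A c v)" for v c
  proof (rule improved_of_density[OF that(1,2) A_sets[OF that(1)] _ that(3)])
    show "AE y in lebesgue. y \<in> ball x0 (radius j / 8) - \<Omega> \<longrightarrow> osc j / 2 \<le> - c + v y"
      by (rule AE_I2) (use interior in blast)
  qed (use Y in \<open>auto simp: A_def Y_def\<close>)
  have "Y = A m u \<union> A (- (m + osc j)) (\<lambda>x. - u x)" by (auto simp: A_def)
  then have "measure lebesgue Y
    \<le> measure lebesgue (A m u) + measure lebesgue (A (- (m + osc j)) (\<lambda>x. - u x))"
    using measure_Un_le[OF A_sets[OF u] A_sets[OF bounded_solution_uminus[OF u]]] by simp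
  then consider "measure lebesgue (ball x0 (radius j / 16)) \<le> measure lebesgue (A m u)"
    | "measure lebesgue (ball x0 (radius j / 16)) \<le> measure lebesgue (A (- (m + osc j)) (\<lambda>x. - u x))"
    using Y_volume unfolding Y_def by linarith
  then show ?thesis
    using improved[OF u trapped]
      improved[OF bounded_solution_uminus[OF u] trapped_uminus[OF trapped]]
    by blast
qed

lemma annulus_contains_exterior_ball:
  assumes boundary: "\<not> ball x0 (radius j / 8) \<subseteq> \<Omega>"
  obtains y where "ball y (radius j / 16) \<subseteq> ball x0 (radius j) - ball x0 (radius j / 4)"
    "ball y (radius j / 16) \<inter> \<Omega> = {}"
proof -
  have R: "0 < radius j" "radius j \<le> R0" using radius_pos radius_antimono[of 0 j] by (auto simp: radius_0)
  have "\<Omega> \<inter> ball x0 (radius j / 8) \<noteq> {}"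
    using x0 R unfolding closure_approachable
    by (metis disjoint_iff dist_commute divide_pos_pos mem_ball zero_less_numeral)
  then have "ball x0 (radius j / 8) \<inter> frontier \<Omega> \<noteq> {}"
    using boundary by (intro connected_Int_frontier) auto
  then obtain z where z: "z \<in> frontier \<Omega>" "dist x0 z < radius j / 8" by auto
  then have "corkscrew_at \<Omega> z (radius j / 2)"
    using corkscrew R unfolding exterior_corkscrew_def by simp
  then obtain y where y: "dist z y = radius j / 2" "ball y (radius j / 16) \<inter> \<Omega> = {}"
    by (auto simp: corkscrew_at_def)
  have "dist x0 y + radius j / 16 \<le> radius j" "radius j / 4 + radius j / 16 \<le> dist x0 y"
    using y(1) z(2) R(1) dist_triangle[of x0 y z] dist_triangle3[of z y x0] by linarith+
  then have "ball y (radius j / 16) \<subseteq> ball x0 (radius j) - ball x0 (radius j / 4)"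
    by (rule ball_subset_annulus)
  then show ?thesis using y(2) by (rule that)
qed

lemma improved_boundary:
  assumes u: "bounded_solution u" and trapped: "trapped u j m" and boundary: "\<not> ball x0 (radius j / 8) \<subseteq> \<Omega>"
  shows "improved u j m \<or> improved (\<lambda>x. - u x) j (- (m + osc j))"
proof -
  obtain y0 where exterior: "ball y0 (radius j / 16) \<subseteq> ball x0 (radius j) - ball x0 (radius j / 4)"
      "ball y0 (radius j / 16) \<inter> \<Omega> = {}"
    using boundary by (rule annulus_contains_exterior_ball)
  define A where "A = ball y0 (radius j / 16)"
  have A: "A \<in> sets lebesgue" "A \<inter> \<Omega> = {}" "A \<subseteq> ball x0 (radius j) - ball x0 (radius j / 4)"
    using exterior by (auto simp: A_def)
  have A_volume: "measure lebesgue (ball x0 (radius j / 16)) \<le> measure lebesgue A"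
    using content_ball[of "radius j / 16" x0] content_ball[of "radius j / 16" y0] radius_pos[of j]
    by (simp add: A_def)
  have u0: "AE x in lebesgue. x \<notin> \<Omega> \<longrightarrow> u x = 0" by (rule W0_outside[OF bounded_solution_W0[OF u]])
  have improved: "improved v j c"
    if v: "bounded_solution v" "trapped v j c" "osc j / 2 \<le> - c" "AE x in lebesgue. x \<notin> \<Omega> \<longrightarrow> v x = 0" for v c
  proof (rule improved_of_density[OF v(1,2) A(1,3) A_volume])
    show "AE y in lebesgue. y \<in> A \<longrightarrow> osc j / 2 \<le> - c + v y"
      using v(4) by eventually_elim (use v(3) A(2) in auto)
    show "AE y in lebesgue. y \<in> ball x0 (radius j / 8) - \<Omega> \<longrightarrow> osc j / 2 \<le> - c + v y"
      using v(4) by eventually_elim (use v(3) in auto)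
  qed
  show ?thesis
  proof (cases "osc j / 2 \<le> - m")
    case True
    then show ?thesis using improved[OF u trapped _ u0] by blast
  next
    case False
    then have "osc j / 2 \<le> - (- (m + osc j))" by simp
    moreover have "AE x in lebesgue. x \<notin> \<Omega> \<longrightarrow> - u x = 0" using u0 by eventually_elim simp
    ultimately show ?thesis
      using improved[OF bounded_solution_uminus[OF u] trapped_uminus[OF trapped]] by blast
  qed
qed

lemma trapped_Suc:
  assumes trapped: "trapped u j m" and improved: "improved u j m"
  shows "trapped u (Suc j) (m + osc j - osc (Suc j))"
  unfolding trapped_def
proof (intro conjI allI impI)
  show "- (\<Lambda> / 2) \<le> m + osc j - osc (Suc j)" "m + osc j - osc (Suc j) + osc (Suc j) \<le> \<Lambda> / 2"
    using trapped osc_Suc_le[of j] by (auto simp: trapped_def)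
  fix k assume k: "k \<le> Suc j"
  show "AE y in lebesgue. y \<in> ball x0 (radius k) \<longrightarrow>
      m + osc j - osc (Suc j) + osc (Suc j) - osc k \<le> u y \<and> u y \<le> m + osc j - osc (Suc j) + osc k"
  proof (cases "k = Suc j")
    case True
    show ?thesis
      using trapped_inside[OF trapped] improved[unfolded improved_def]
    proof (eventually_elim, intro impI)
      fix y
      assume bounds: "y \<in> ball x0 (radius j) \<longrightarrow> m \<le> u y \<and> u y \<le> m + osc j"
        "y \<in> ball x0 (radius (Suc j)) \<longrightarrow> m + \<sigma> * osc j / 4 \<le> u y" and y: "y \<in> ball x0 (radius k)"
      then have "y \<in> ball x0 (radius j)" using radius_antimono[of j "Suc j"] True by auto
      then show "m + osc j - osc (Suc j) + osc (Suc j) - osc k \<le> u y \<and>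
          u y \<le> m + osc j - osc (Suc j) + osc k"
        using bounds y True osc_diff_Suc_le[of j] by auto
    qed
  next
    case False
    with k have "k \<le> j" by simp
    show ?thesis
      using trapped_all_scales[OF trapped]
    proof (eventually_elim, intro impI)
      fix y assume "\<forall>k\<le>j. y \<in> ball x0 (radius k) \<longrightarrow>
        m + osc j - osc k \<le> u y \<and> u y \<le> m + osc k" "y \<in> ball x0 (radius k)"
      with \<open>k \<le> j\<close> have "m + osc j - osc k \<le> u y \<and> u y \<le> m + osc k" by blast
      then show "m + osc j - osc (Suc j) + osc (Suc j) - osc k \<le> u y \<and>
          u y \<le> m + osc j - osc (Suc j) + osc k"
        using osc_Suc_le[of j] by auto
    qed
  qed
qed

lemma trapped_exists:
  assumes u: "bounded_solution u"
  shows "\<exists>m. trapped u j m"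
proof (induction j)
  case 0
  have "AE y in lebesgue. \<bar>u y\<bar> \<le> \<Lambda> / 2" using u by (simp add: bounded_solution_def)
  then have "AE y in lebesgue. y \<in> ball x0 (radius 0) \<longrightarrow> - (\<Lambda> / 2) \<le> u y \<and> u y \<le> \<Lambda> / 2"
    by eventually_elim auto
  then have "trapped u 0 (- (\<Lambda> / 2))" by (simp add: trapped_def osc_0)
  then show ?case ..
next
  case (Suc j)
  then obtain m where m: "trapped u j m" ..
  then consider "improved u j m" | "improved (\<lambda>x. - u x) j (- (m + osc j))"
    using improved_interior[OF u] improved_boundary[OF u] by blast
  then show ?case
  proof cases
    case 1
    then show ?thesis using trapped_Suc[OF m] by blast
  next
    case 2
    then show ?thesis using trapped_uminus[OF trapped_Suc[OF trapped_uminus[OF m]]] by auto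
  qed
qed

lemma ess_osc_le_of_bounded_solution:
  assumes "bounded_solution u"
  shows "ess_osc_le (ball x0 (radius j)) u (osc j)"
  using trapped_exists[OF assms, of j] trapped_inside unfolding ess_osc_le_def by blast

end

section \<open>Global Hoelder regularity\<close>

lemma (in growth_parameters) ess_osc_le_of_frac_lap_bounded:
  fixes \<Omega> :: "(real^'n) set"
  assumes \<Omega>: "open \<Omega>" "bounded \<Omega>" and R0: "0 < R0" and corkscrew: "exterior_corkscrew R0 \<Omega>"
      and x0: "x0 \<in> closure \<Omega>"
    and D: "0 < D" "2 * R0 powr (p * s) \<le> density_gain s p ty * D powr (p - 1)"
    and u: "u \<in> W0 s p \<Omega>" "frac_lap_ge s p \<Omega> (- K) u" "frac_lap_ge s p \<Omega> (- K) (\<lambda>x. - u x)" and K: "0 \<le> K"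
    and bound: "AE x in lebesgue. \<bar>u x\<bar> \<le> D * K powr (1 / (p - 1))"
  shows "ess_osc_le (ball x0 (R0 * (1 / 16) ^ j)) u
    (2 * (D * K powr (1 / (p - 1))) * ((1 / 16) ^ j) powr (\<sigma> / 16))"
proof (cases "K = 0")
  case True
  have "AE x in lebesgue. x \<in> ball x0 (R0 * (1 / 16) ^ j) \<longrightarrow> 0 \<le> u x \<and> u x \<le> 0 + 0"
    using bound by eventually_elim (use True in simp)
  then show ?thesis unfolding ess_osc_le_def using True by (intro exI[of _ 0]) simp
next
  case False
  define \<Lambda> where "\<Lambda> = 2 * (D * K powr (1 / (p - 1)))"
  have "0 < \<Lambda>" using D K False by (simp add: \<Lambda>_def)
  have "K < 2 * K" using K False by simp
  also have "\<dots> = 2 * R0 powr (p * s) * (K * R0 powr (- (p * s)))"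
    using R0 by (simp add: powr_minus field_simps)
  also have "\<dots> \<le> density_gain s p ty * D powr (p - 1) * (K * R0 powr (- (p * s)))"
    using D K by (intro mult_right_mono) auto
  also have "\<dots> = density_gain s p ty * ((\<Lambda> / 2) powr (p - 1) * R0 powr (- (p * s)))"
    using p K by (simp add: \<Lambda>_def powr_mult powr_powr)
  finally interpret oscillation_iteration s p \<sigma> i ty \<Omega> K \<Lambda> R0 x0
    using \<Omega> R0 corkscrew x0 \<open>0 < \<Lambda>\<close> by unfold_locales
  have "bounded_solution u" unfolding bounded_solution_def using u bound by (simp add: \<Lambda>_def)
  from ess_osc_le_of_bounded_solution[OF this, of j] show ?thesis
    unfolding radius_def osc_def by (simp only: \<Lambda>_def)
qed

lemma (in growth_parameters) frac_lap_bounded_imp_holder: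
  fixes \<Omega> :: "(real^'n) set"
  assumes \<Omega>: "open \<Omega>" "bounded \<Omega>" and R0: "0 < R0" and corkscrew: "exterior_corkscrew R0 \<Omega>"
  obtains D where "0 < D" "\<And>u K. u \<in> W0 s p \<Omega> \<Longrightarrow> frac_lap_ge s p \<Omega> (- K) u \<Longrightarrow>
    frac_lap_ge s p \<Omega> (- K) (\<lambda>x. - u x) \<Longrightarrow> 0 \<le> K \<Longrightarrow>
    (AE x in lebesgue. \<bar>u x\<bar> \<le> D * K powr (1 / (p - 1))) \<and>
    (\<exists>v. (AE x in lebesgue. x \<in> closure \<Omega> \<longrightarrow> u x = v x) \<and> continuous_on (closure \<Omega>) v \<and>
       holder_on (2 * (D * K powr (1 / (p - 1))) * (16 / R0) powr (\<sigma> / 16)) (\<sigma> / 16) (closure \<Omega>) v)"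
proof -
  obtain c where c: "0 < c" and bound: "\<And>u K. u \<in> W0 s p \<Omega> \<Longrightarrow> frac_lap_ge s p \<Omega> (- K) u \<Longrightarrow>
      frac_lap_ge s p \<Omega> (- K) (\<lambda>x. - u x) \<Longrightarrow> 0 \<le> K \<Longrightarrow> AE x in lebesgue. \<bar>u x\<bar> \<le> (K / c) powr (1 / (p - 1))"
    by (rule frac_lap_bounded_imp_bounded[OF \<Omega> p less_imp_le[OF s(1)]]) (rule that)
  define q where "q = 2 * R0 powr (p * s) / density_gain s p ty"
  define D where "D = max ((1 / c) powr (1 / (p - 1))) (q powr (1 / (p - 1)))"
  have D: "0 < D" using c by (simp add: D_def less_max_iff_disj)
  have q: "0 \<le> q" using density_gain_pos[of s p ty] by (simp add: q_def)
  have "q = (q powr (1 / (p - 1))) powr (p - 1)" using p q by (simp add: powr_powr)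
  also have "\<dots> \<le> D powr (p - 1)" using p by (intro powr_mono2) (auto simp: D_def)
  finally have gain: "2 * R0 powr (p * s) \<le> density_gain s p ty * D powr (p - 1)"
    using density_gain_pos[of s p ty] by (simp add: q_def divide_le_eq mult.commute)
  have D_bound: "AE x in lebesgue. \<bar>u x\<bar> \<le> D * K powr (1 / (p - 1))"
    if u: "u \<in> W0 s p \<Omega>" "frac_lap_ge s p \<Omega> (- K) u" "frac_lap_ge s p \<Omega> (- K) (\<lambda>x. - u x)" "0 \<le> K" for u K
    using bound[OF u]
  proof eventually_elim
    fix x assume "\<bar>u x\<bar> \<le> (K / c) powr (1 / (p - 1))"
    also have "\<dots> = (1 / c) powr (1 / (p - 1)) * K powr (1 / (p - 1))"
      using powr_mult[of "1 / c" K "1 / (p - 1)"] by simp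
    also have "\<dots> \<le> D * K powr (1 / (p - 1))" by (intro mult_right_mono) (auto simp: D_def)
    finally show "\<bar>u x\<bar> \<le> D * K powr (1 / (p - 1))" .
  qed
  have "\<exists>v. (AE x in lebesgue. x \<in> closure \<Omega> \<longrightarrow> u x = v x) \<and> continuous_on (closure \<Omega>) v \<and>
       holder_on (2 * (D * K powr (1 / (p - 1))) * (16 / R0) powr (\<sigma> / 16)) (\<sigma> / 16) (closure \<Omega>) v"
    if u: "u \<in> W0 s p \<Omega>" "frac_lap_ge s p \<Omega> (- K) u" "frac_lap_ge s p \<Omega> (- K) (\<lambda>x. - u x)" "0 \<le> K" for u K
    using oscillation_decay_imp_holder[OF \<Omega>(1) _ _ _ R0 _
        ess_osc_le_of_frac_lap_bounded[OF \<Omega> R0 corkscrew _ D gain u D_bound[OF u]]] D_bound[OF u] D \<sigma>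
    by (auto simp: algebra_simps)
  with D D_bound show ?thesis by (intro that) auto
qed

lemma open_two_points:
  fixes \<Omega> :: "'a::euclidean_space set"
  assumes "open \<Omega>" "\<Omega> \<noteq> {}"
  obtains x y where "x \<in> \<Omega>" "y \<in> \<Omega>" "x \<noteq> y"
proof -
  obtain x where "x \<in> \<Omega>" using assms by blast
  moreover have "infinite \<Omega>"
    using open_not_negligible[OF assms] negligible_finite by blast
  then have "\<Omega> \<noteq> {x}" by auto
  ultimately show ?thesis using that by blast
qed

lemma (in growth_parameters) weak_solution_holder_estimate:
  fixes \<Omega> :: "(real^'n) set"
  assumes \<Omega>: "open \<Omega>" "bounded \<Omega>" "\<Omega> \<noteq> {}" and R0: "0 < R0" and corkscrew: "exterior_corkscrew R0 \<Omega>"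
  shows "\<exists>C>0. \<forall>f u. f \<in> Linf \<Omega> \<longrightarrow> weak_solution s p \<Omega> f u \<longrightarrow>
    (\<exists>v. (AE x in lebesgue. x \<in> closure \<Omega> \<longrightarrow> u x = v x) \<and>
      v \<in> holder_space (closure \<Omega>) (\<sigma> / 16) \<and>
      Linf_norm \<Omega> u + holder_seminorm (closure \<Omega>) (\<sigma> / 16) v \<le> C * Linf_norm \<Omega> f powr (1 / (p - 1)))"
proof -
  obtain D where D: "0 < D" and holder: "\<And>u K. u \<in> W0 s p \<Omega> \<Longrightarrow> frac_lap_ge s p \<Omega> (- K) u \<Longrightarrow>
      frac_lap_ge s p \<Omega> (- K) (\<lambda>x. - u x) \<Longrightarrow> 0 \<le> K \<Longrightarrow>
      (AE x in lebesgue. \<bar>u x\<bar> \<le> D * K powr (1 / (p - 1))) \<and>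
      (\<exists>v. (AE x in lebesgue. x \<in> closure \<Omega> \<longrightarrow> u x = v x) \<and> continuous_on (closure \<Omega>) v \<and>
        holder_on (2 * (D * K powr (1 / (p - 1))) * (16 / R0) powr (\<sigma> / 16)) (\<sigma> / 16) (closure \<Omega>) v)"
    by (rule frac_lap_bounded_imp_holder[OF \<Omega>(1,2) R0 corkscrew]) (rule that)
  obtain x y where xy: "x \<in> closure \<Omega>" "y \<in> closure \<Omega>" "x \<noteq> y"
    using open_two_points[OF \<Omega>(1,3)] closure_subset[of \<Omega>] by (metis subsetD)
  define C where "C = D + 2 * D * (16 / R0) powr (\<sigma> / 16)"
  have "0 < C" using D by (simp add: C_def add_pos_nonneg)
  moreover have "\<exists>v. (AE x in lebesgue. x \<in> closure \<Omega> \<longrightarrow> u x = v x) \<and> v \<in> holder_space (closure \<Omega>) (\<sigma> / 16) \<and>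
      Linf_norm \<Omega> u + holder_seminorm (closure \<Omega>) (\<sigma> / 16) v \<le> C * Linf_norm \<Omega> f powr (1 / (p - 1))"
    if f: "f \<in> Linf \<Omega>" and u: "weak_solution s p \<Omega> f u" for f u
  proof -
    define \<kappa> where "\<kappa> = Linf_norm \<Omega> f powr (1 / (p - 1))"
    have "frac_lap_ge s p \<Omega> (- Linf_norm \<Omega> f) u" "frac_lap_ge s p \<Omega> (- Linf_norm \<Omega> f) (\<lambda>x. - u x)"
      using f p by (auto simp: Linf_def
          intro!: weak_solution_imp_frac_lap_ge[OF u _ AE_le_Linf_norm[OF f] Linf_norm_nonneg[OF f] \<Omega>(1,2)])
    with holder[of u] u Linf_norm_nonneg[OF f] obtain v where u_bound: "AE x in lebesgue. \<bar>u x\<bar> \<le> D * \<kappa>"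
      and v: "AE x in lebesgue. x \<in> closure \<Omega> \<longrightarrow> u x = v x" "continuous_on (closure \<Omega>) v"
        "holder_on (2 * (D * \<kappa>) * (16 / R0) powr (\<sigma> / 16)) (\<sigma> / 16) (closure \<Omega>) v"
      unfolding weak_solution_iff \<kappa>_def by blast
    note v_holder = holder_on_imp_holder_space[OF v(2,3) xy]
    have "Linf_norm \<Omega> u \<le> D * \<kappa>"
      using D u_bound by (intro Linf_norm_le) (auto simp: \<kappa>_def elim: eventually_mono)
    then have "Linf_norm \<Omega> u + holder_seminorm (closure \<Omega>) (\<sigma> / 16) v \<le> C * \<kappa>"
      using v_holder(2) by (simp add: C_def algebra_simps)
    then show ?thesis using v(1) v_holder(1) unfolding \<kappa>_def by blast
  qed
  ultimately show ?thesis by blast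
qed

theorem theorem1p1:
  fixes s p :: real
  assumes "CARD('n::finite) \<ge> 2" and "0 < s" and "s < 1" and "1 < p"
  shows "\<exists>\<alpha>. 0 < \<alpha> \<and> \<alpha> \<le> s \<and>
    (\<forall>\<Omega>::(real^'n) set. C11_domain \<Omega> \<longrightarrow>
      (\<exists>C>0. \<forall>f u. f \<in> Linf \<Omega> \<longrightarrow> weak_solution s p \<Omega> f u \<longrightarrow>
         (\<exists>v. (AE x in lebesgue. x \<in> closure \<Omega> \<longrightarrow> u x = v x) \<and>
              v \<in> holder_space (closure \<Omega>) \<alpha> \<and>
              Linf_norm \<Omega> u + holder_seminorm (closure \<Omega>) \<alpha> v
                \<le> C * Linf_norm \<Omega> f powr (1 / (p - 1)))))"
proof -
  obtain \<sigma> i where parameters: "growth_parameters s p \<sigma> i TYPE(real^'n)" and exponent: "\<sigma> / 16 \<le> s"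
    by (rule growth_parameters_exist[OF assms(4,2,3)])
  interpret growth_parameters s p \<sigma> i "TYPE(real^'n)" by (rule parameters)
  show ?thesis
  proof (rule exI[of _ "\<sigma> / 16"], intro conjI allI impI)
    show "0 < \<sigma> / 16" using \<sigma> by simp
    show "\<sigma> / 16 \<le> s" by (rule exponent)
    fix \<Omega> :: "(real^'n) set" assume \<Omega>: "C11_domain \<Omega>"
    then have domain: "open \<Omega>" "bounded \<Omega>" "\<Omega> \<noteq> {}" by (auto simp: C11_domain_def)
    obtain r where "0 < r" "exterior_corkscrew r \<Omega>"
      using C11_domain_exterior_corkscrew[OF \<Omega>] .
    then show "\<exists>C>0. \<forall>f u. f \<in> Linf \<Omega> \<longrightarrow> weak_solution s p \<Omega> f u \<longrightarrow>
         (\<exists>v. (AE x in lebesgue. x \<in> closure \<Omega> \<longrightarrow> u x = v x) \<and>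
              v \<in> holder_space (closure \<Omega>) (\<sigma> / 16) \<and>
              Linf_norm \<Omega> u + holder_seminorm (closure \<Omega>) (\<sigma> / 16) v
                \<le> C * Linf_norm \<Omega> f powr (1 / (p - 1)))"
      by (rule weak_solution_holder_estimate[OF domain])
  qed
qed

end
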